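(* Suppose that conditions (A1), (A2), (A3) of the context hold, and let $E=U\cup D$ be a partition of $E$ into two nonempty disjoint subsets. Then, on $\mathbb R^{U\times\mathbb N}$ equipped with the product topology, $$\sqrt{M}\,\bigl(\hat{\bm R}(M)-\bm R\bigr)\ \xrightarrow[M\to\infty]{\ \mathrm d\ }\ \mathcal N(\bm 0,V^{\bm R})$$ (convergence in distribution) under $\mathbb P_{i_0}$ for every initial value $i_0\in U$, where the asymptotic variance matrix $V^{\bm R}=(V^{\bm R}_{ee'})_{e,e'\in U\times\mathbb N}$ is given by $$\begin{aligned}V^{\bm R}=&\sum_{\tilde e\in\tilde U}\bar q_{\tilde e}\,\bigl(\bm\psi_{UU}*\bm\delta^{\tilde e}_{UU}*\bm\psi_{UU}*(\mathcal S\bm q)_U+\bm\psi_{UU}*(\mathcal S\bm\delta^{\tilde e})_U\bigr)^{\otimes2}\\&-\sum_{\tilde i\in U}\mu_{\tilde i\tilde i}\,\bigl(\bm\psi_{UU}*\bm q^{\tilde i}_{UU}*\bm\psi_{UU}*(\mathcal S\bm q)_U+\bm\psi_{UU}*(\mathcal S\bm q^{\tilde i})_U\bigr)^{\otimes2}\\&+\sum_{\tilde e\in U\times D\times\mathbb N}\bar q_{\tilde e}\,\bigl(\bm\psi_{UU}*(\mathcal S\bm\delta^{\tilde e})_U\bigr)^{\otimes2}.\end{aligned}$$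
   Context: $E$ is a finite set, $\mathbb N=\{0,1,2,\dots\}$, $\tilde E:=E\times E\times\mathbb N$, $\tilde U:=U\times U\times\mathbb N$. Let $\bm q=(q_{ij}(k))_{(i,j,k)\in\tilde E}$ be nonnegative numbers with $q_{ij}(0)=0$ for all $i,j\in E$ and $\sum_{j\in E}\sum_{k\in\mathbb N}q_{ij}(k)=1$ for all $i\in E$. Markov renewal chain: for each $i_0\in E$, under the probability $\mathbb P_{i_0}$ (expectation $\mathbb E_{i_0}$), $(J_n,S_n)_{n\ge0}$ is an $E\times\mathbb N$-valued process with $J_0=i_0$, $S_0=X_0=0$, $X_n:=S_n-S_{n-1}$ for $n\ge1$, such that $(J_n,X_n)_{n\ge 0}$ is a Markov chain with $\mathbb P_{i_0}(J_{n+1}=j,\,X_{n+1}=k\mid J_n=i,\,X_n)=q_{ij}(k)$. Let $\tau_j=\inf\{n\ge1:J_n=j\}$. Conditions: (A1) the embedded Markov chain $J$ is irreducible: $\mathbb P_i(\tau_j<\infty)>0$ for all $i,j\in E$. (A2) aperiodicity: for all $i\in E$, the greatest common divisor of $\{k\in\mathbb N:\mathbb P_i(S_{\tau_i}=k)>0\}$ is one. (A3) positive recurrence: $\mu_{ii}:=\mathbb E_i S_{\tau_i}<\infty$ for all $i\in E$. Estimator of $\bm q$: for $M\in\mathbb N$, $N(M):=\max\{n\in\mathbb N:S_n\le M\}$, $N_i(M):=\sum_{n=1}^{N(M)}1_{\{J_{n-1}=i\}}$, and $\hat{\bm q}(M)=(\hat q_{ij}(k,M))_{(i,j,k)\in\tilde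 E}$ with $\hat q_{ij}(k,M):=\frac1{N_i(M)}\sum_{n=1}^{N(M)}1_{\{J_{n-1}=i,\,J_n=j,\,X_n=k\}}$ (interpreted as $0$ when $N_i(M)=0$). Convolution: for matrix sequences $\bm A,\bm B$ indexed by $\tilde U$, $(\bm A*\bm B)_{ij}(k):=\sum_{l=0}^k\sum_{u\in U}A_{iu}(l)B_{uj}(k-l)$; for a vector sequence $\bm r=(r_i(k))_{(i,k)\in U\times\mathbb N}$, $(\bm A*\bm r)_i(k):=\sum_{l=0}^k\sum_{u\in U}A_{iu}(l)r_u(k-l)$. $\bm{\delta I}$ is the identity for $*$ (identity matrix at $k=0$, zero matrix for $k\ge1$); $\bm A^{(0)}=\bm{\delta I}$, $\bm A^{(n)}=\bm A*\bm A^{(n-1)}$ for $n\ge 1$; if $\bm A(0)=\bm0$, $(\bm{\delta I}-\bm A)^{(-1)}:=\sum_{n\ge0}\bm A^{(n)}$. For a matrix sequence $\bm A$ indexed by $\tilde E$: $\bm A_{UU}$ is its restriction to $\tilde U$, and $\bm A_U:=(A_{ii}(k))_{(i,k)\in U\times\mathbb N}$. The exceptions are $\bm\psi_{UU}:=(\bm{\delta I}-\bm q_{UU})^{(-1)}$ and $\hat{\bm\psi}_{UU}(M):=(\bm{\delta I}-\hat{\bm q}_{UU}(M))^{(-1)}$, which are convolution inverses computed over $U$ (not restrictions of the inverses over $E$). Operator $\mathcal S$: for a (possibly random) matrix sequence $\bm A$ indexed by $\tilde E$ such that $\lim_{K\to\infty}\sum_{j\in E}\sum_{k\le K}A_{ij}(k)$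 exists in $L^2$ for all $i\in E$, $(\mathcal S\bm A)_{ij}(k):=1_{\{i=j\}}\lim_{K\to\infty}\sum_{j'\in E}\sum_{k<k'\le K}A_{ij'}(k')$ in $L^2$. Reliability: the semi-Markov chain is $Z_k:=J_{N(k)}$, $T_D:=\inf\{k\in\mathbb N:Z_k\in D\}$, and the reliability vector sequence is $\bm R=(R_i(k))_{(i,k)\in U\times\mathbb N}$ with $R_i(k):=\mathbb P_i(T_D>k)$ (one has $\bm R=\bm\psi_{UU}*(\mathcal S\bm q)_U$). Its estimator is $\hat{\bm R}(M):=\hat{\bm\psi}_{UU}(M)*(\mathcal S\hat{\bm q}(M))_U$. Further notation: $\bar q_{(i,j,k)}:=\mu_{ii}q_{ij}(k)$; $\bm q^{\tilde i}$ is the matrix sequence (indexed by $\tilde E$) $q^{\tilde i}_{ij}(k)=1_{\{i=\tilde i\}}q_{ij}(k)$; $\bm\delta^{\tilde e}$ is the matrix sequence (indexed by $\tilde E$) with $\delta^{\tilde e}_e=1_{\{e=\tilde e\}}$; for a vector sequence $\bm r=(r_e)_{e\in U\times\mathbb N}$, $\bm r^{\otimes2}:=(r_er_{e'})_{e,e'\in U\times\mathbb N}$. For a nonnegative definite matrix $V=(V_{ee'})_{e,e'\in U\times\mathbb N}$, $\mathcal N(\bm0,V)$ is the law on $\mathbb R^{U\times\mathbb N}$ of a centered Gaussian system $(Y_e)$ with $\mathbb E\,Y_eY_{e'}=V_{ee'}$. *)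

theory Defs
  imports "HOL-Probability.Probability"
begin

text \<open>The finite state space is the type \<open>'e\<close>. A matrix sequence is a function
  \<open>A i j k\<close>, a vector sequence a function \<open>r (i, k)\<close>. Both are total functions; the
  restrictions to a subset \<open>U\<close> of the states are implicit, because the operations below that carry
  the parameter \<open>U\<close> sum over \<open>U\<close> only and their results are used at indices in \<open>U\<close> only.\<close>

type_synonym 'e mseq = "'e \<Rightarrow> 'e \<Rightarrow> nat \<Rightarrow> real"
type_synonym 'e vseq = "'e \<times> nat \<Rightarrow> real"


section \<open>Markov renewal chains\<close>

definition semi_markov_kernel :: "('e::finite) mseq \<Rightarrow> bool" where
  "semi_markov_kernel q \<longleftrightarrow>
     (\<forall>i j k. q i j k \<ge> 0) \<and> (\<forall>i j. q i j 0 = 0) \<and>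
     (\<forall>i j. summable (q i j)) \<and> (\<forall>i. (\<Sum>j\<in>UNIV. \<Sum>k. q i j k) = 1)"

text \<open>At \<open>n = 0\<close> this is \<open>0\<close>. The subtraction on \<open>nat\<close> cannot hide a decrease of \<open>S\<close> on a set of
  positive probability: in a Markov renewal chain with \<open>q i j 0 = 0\<close> the truncated
  difference is almost surely positive, hence equal to the true one.\<close>

definition sojourn :: "(nat \<Rightarrow> 'w \<Rightarrow> nat) \<Rightarrow> nat \<Rightarrow> 'w \<Rightarrow> nat" where
  "sojourn S n \<omega> = S n \<omega> - S (n - 1) \<omega>"

locale markov_renewal_chain =
  fixes q :: "('e::finite) mseq"
    and P :: "'e \<Rightarrow> 'w measure"
    and J :: "nat \<Rightarrow> 'w \<Rightarrow> 'e"
    and S :: "nat \<Rightarrow> 'w \<Rightarrow> nat"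
  assumes kernel: "semi_markov_kernel q"
    and prob_space_P: "\<And>i. prob_space (P i)"
    and measurable_J: "\<And>i n. J n \<in> measurable (P i) (count_space UNIV)"
    and measurable_S: "\<And>i n. S n \<in> measurable (P i) (count_space UNIV)"
    and initial: "\<And>i. AE \<omega> in P i. J 0 \<omega> = i \<and> S 0 \<omega> = 0"
    and markov: "\<And>i0 n (a :: nat \<Rightarrow> 'e) (x :: nat \<Rightarrow> nat) j k.
       measure (P i0) {\<omega> \<in> space (P i0). \<forall>m\<le>n. J m \<omega> = a m \<and> sojourn S m \<omega> = x m} > 0 \<Longrightarrow>
       cond_prob (P i0) (\<lambda>\<omega>. J (Suc n) \<omega> = j \<and> sojourn S (Suc n) \<omega> = k)
                        (\<lambda>\<omega>. \<forall>m\<le>n. J m \<omega> = a m \<and> sojourn S m \<omega> = x m)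
         = q (a n) j k"

definition hit_time :: "(nat \<Rightarrow> 'w \<Rightarrow> 'e) \<Rightarrow> 'e \<Rightarrow> 'w \<Rightarrow> enat" where
  "hit_time J j \<omega> = Inf {enat n | n. n \<ge> 1 \<and> J n \<omega> = j}"

definition at_time :: "(nat \<Rightarrow> 'w \<Rightarrow> nat) \<Rightarrow> ('w \<Rightarrow> enat) \<Rightarrow> 'w \<Rightarrow> enat" where
  "at_time S T \<omega> = (case T \<omega> of enat n \<Rightarrow> enat (S n \<omega>) | \<infinity> \<Rightarrow> \<infinity>)"

definition irreducible_chain ::
    "('e \<Rightarrow> 'w measure) \<Rightarrow> (nat \<Rightarrow> 'w \<Rightarrow> 'e) \<Rightarrow> bool" where
  "irreducible_chain P J \<longleftrightarrow>
     (\<forall>i j. measure (P i) {\<omega> \<in> space (P i). hit_time J j \<omega> < \<infinity>} > 0)"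

definition aperiodic_chain ::
    "('e \<Rightarrow> 'w measure) \<Rightarrow> (nat \<Rightarrow> 'w \<Rightarrow> 'e) \<Rightarrow> (nat \<Rightarrow> 'w \<Rightarrow> nat) \<Rightarrow> bool" where
  "aperiodic_chain P J S \<longleftrightarrow>
     (\<forall>i. Gcd {k. measure (P i) {\<omega> \<in> space (P i). at_time S (hit_time J i) \<omega> = enat k} > 0} = 1)"

definition mean_recurrence ::
    "('e \<Rightarrow> 'w measure) \<Rightarrow> (nat \<Rightarrow> 'w \<Rightarrow> 'e) \<Rightarrow> (nat \<Rightarrow> 'w \<Rightarrow> nat) \<Rightarrow> 'e \<Rightarrow> ennreal" where
  "mean_recurrence P J S i = (\<integral>\<^sup>+ \<omega>. ennreal_of_enat (at_time S (hit_time J i) \<omega>) \<partial>(P i))"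

definition positive_recurrent_chain ::
    "('e \<Rightarrow> 'w measure) \<Rightarrow> (nat \<Rightarrow> 'w \<Rightarrow> 'e) \<Rightarrow> (nat \<Rightarrow> 'w \<Rightarrow> nat) \<Rightarrow> bool" where
  "positive_recurrent_chain P J S \<longleftrightarrow> (\<forall>i. mean_recurrence P J S i < \<infinity>)"


section \<open>The semi-Markov chain and its reliability\<close>

text \<open>Almost surely \<open>S n \<ge> n\<close>, so the set is almost surely finite and nonempty.\<close>

definition jumps :: "(nat \<Rightarrow> 'w \<Rightarrow> nat) \<Rightarrow> nat \<Rightarrow> 'w \<Rightarrow> nat" where
  "jumps S M \<omega> = Max {n. S n \<omega> \<le> M}"

definition semi_markov ::
    "(nat \<Rightarrow> 'w \<Rightarrow> 'e) \<Rightarrow> (nat \<Rightarrow> 'w \<Rightarrow> nat) \<Rightarrow> nat \<Rightarrow> 'w \<Rightarrow> 'e" where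
  "semi_markov J S k \<omega> = J (jumps S k \<omega>) \<omega>"

definition down_time ::
    "'e set \<Rightarrow> (nat \<Rightarrow> 'w \<Rightarrow> 'e) \<Rightarrow> (nat \<Rightarrow> 'w \<Rightarrow> nat) \<Rightarrow> 'w \<Rightarrow> enat" where
  "down_time D J S \<omega> = Inf {enat k | k. semi_markov J S k \<omega> \<in> D}"

definition reliability ::
    "'e set \<Rightarrow> ('e \<Rightarrow> 'w measure) \<Rightarrow> (nat \<Rightarrow> 'w \<Rightarrow> 'e) \<Rightarrow> (nat \<Rightarrow> 'w \<Rightarrow> nat) \<Rightarrow> 'e vseq" where
  "reliability D P J S =
     (\<lambda>(i, k). measure (P i) {\<omega> \<in> space (P i). down_time D J S \<omega> > enat k})"


section \<open>Convolution\<close>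

definition conv_mat :: "'e set \<Rightarrow> 'e mseq \<Rightarrow> 'e mseq \<Rightarrow> 'e mseq" where
  "conv_mat U A B i j k = (\<Sum>l\<le>k. \<Sum>u\<in>U. A i u l * B u j (k - l))"

definition conv_vec :: "'e set \<Rightarrow> 'e mseq \<Rightarrow> 'e vseq \<Rightarrow> 'e vseq" where
  "conv_vec U A r = (\<lambda>(i, k). \<Sum>l\<le>k. \<Sum>u\<in>U. A i u l * r (u, k - l))"

definition conv_one :: "'e mseq" where
  "conv_one i j k = (if i = j \<and> k = 0 then 1 else 0)"

primrec conv_pow :: "'e set \<Rightarrow> 'e mseq \<Rightarrow> nat \<Rightarrow> 'e mseq" where
  "conv_pow U A 0 = conv_one"
| "conv_pow U A (Suc n) = conv_mat U A (conv_pow U A n)"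

text \<open>The convolution inverse of \<open>conv_one - A\<close> over \<open>U\<close>. If \<open>A\<close> vanishes at time \<open>0\<close>, only the terms
  with \<open>n \<le> k\<close> are nonzero.\<close>

definition conv_inv :: "'e set \<Rightarrow> 'e mseq \<Rightarrow> 'e mseq" where
  "conv_inv U A i j k = (\<Sum>n. conv_pow U A n i j k)"

definition diag_seq :: "'e mseq \<Rightarrow> 'e vseq" where
  "diag_seq A = (\<lambda>(i, k). A i i k)"


section \<open>The tail-sum operator\<close>

definition L2_limit :: "'w measure \<Rightarrow> (nat \<Rightarrow> 'w \<Rightarrow> real) \<Rightarrow> ('w \<Rightarrow> real) \<Rightarrow> bool" where
  "L2_limit M X Y \<longleftrightarrow>
     (\<forall>n. X n \<in> borel_measurable M \<and> integrable M (\<lambda>\<omega>. (X n \<omega>)\<^sup>2)) \<and>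
     Y \<in> borel_measurable M \<and> integrable M (\<lambda>\<omega>. (Y \<omega>)\<^sup>2) \<and>
     (\<lambda>n. \<integral>\<omega>. (X n \<omega> - Y \<omega>)\<^sup>2 \<partial>M) \<longlonglongrightarrow> 0"

text \<open>Random matrix sequences take the sample point as last argument. The limit in \<open>L\<^sup>2\<close> is an
  equivalence class of random variables; the choice operator picks a version.\<close>

definition tail_op_rand ::
    "'w measure \<Rightarrow> (('e::finite) \<Rightarrow> 'e \<Rightarrow> nat \<Rightarrow> 'w \<Rightarrow> real) \<Rightarrow> 'e \<Rightarrow> 'e \<Rightarrow> nat \<Rightarrow> 'w \<Rightarrow> real" where
  "tail_op_rand M A i j k \<omega> =
     (if i = j
      then (SOME Y. L2_limit M (\<lambda>K \<omega>. \<Sum>j'\<in>UNIV. \<Sum>k'\<in>{k<..K}. A i j' k' \<omega>) Y) \<omega>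
      else 0)"

text \<open>For deterministic matrix sequences the limit in \<open>L\<^sup>2\<close> is the limit of real numbers.\<close>

definition tail_op :: "('e::finite) mseq \<Rightarrow> 'e mseq" where
  "tail_op A i j k = (if i = j then lim (\<lambda>K. \<Sum>j'\<in>UNIV. \<Sum>k'\<in>{k<..K}. A i j' k') else 0)"


section \<open>Estimators\<close>

definition visits ::
    "(nat \<Rightarrow> 'w \<Rightarrow> 'e) \<Rightarrow> (nat \<Rightarrow> 'w \<Rightarrow> nat) \<Rightarrow> nat \<Rightarrow> 'e \<Rightarrow> 'w \<Rightarrow> nat" where
  "visits J S M i \<omega> = (\<Sum>n = 1..jumps S M \<omega>. if J (n - 1) \<omega> = i then 1 else 0)"

text \<open>The convention \<open>x / 0 = 0\<close> gives the value \<open>0\<close> if \<open>i\<close> has not been visited.\<close>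

definition q_hat :: "(nat \<Rightarrow> 'w \<Rightarrow> 'e) \<Rightarrow> (nat \<Rightarrow> 'w \<Rightarrow> nat) \<Rightarrow> nat \<Rightarrow>
    'e \<Rightarrow> 'e \<Rightarrow> nat \<Rightarrow> 'w \<Rightarrow> real" where
  "q_hat J S M i j k \<omega> =
     (1 / real (visits J S M i \<omega>)) *
     (\<Sum>n = 1..jumps S M \<omega>. if J (n - 1) \<omega> = i \<and> J n \<omega> = j \<and> sojourn S n \<omega> = k then 1 else 0)"

definition reliability_hat :: "('e::finite) set \<Rightarrow> 'w measure \<Rightarrow> (nat \<Rightarrow> 'w \<Rightarrow> 'e) \<Rightarrow>
    (nat \<Rightarrow> 'w \<Rightarrow> nat) \<Rightarrow> nat \<Rightarrow> 'w \<Rightarrow> 'e vseq" where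
  "reliability_hat U Q J S M \<omega> =
     conv_vec U (conv_inv U (\<lambda>i j k. q_hat J S M i j k \<omega>))
       (diag_seq (\<lambda>i j k. tail_op_rand Q (q_hat J S M) i j k \<omega>))"


section \<open>The asymptotic variance\<close>

definition q_bar :: "('e \<Rightarrow> real) \<Rightarrow> 'e mseq \<Rightarrow> 'e \<times> 'e \<times> nat \<Rightarrow> real" where
  "q_bar \<mu> q = (\<lambda>(i, j, k). \<mu> i * q i j k)"

definition q_row :: "'e mseq \<Rightarrow> 'e \<Rightarrow> 'e mseq" where
  "q_row q i' i j k = (if i = i' then q i j k else 0)"

definition delta_seq :: "'e \<times> 'e \<times> nat \<Rightarrow> 'e mseq" where
  "delta_seq e i j k = (if (i, j, k) = e then 1 else 0)"

definition tail_term :: "('e::finite) set \<Rightarrow> 'e mseq \<Rightarrow> 'e mseq \<Rightarrow> 'e vseq" where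
  "tail_term U q B = conv_vec U (conv_inv U q) (diag_seq (tail_op B))"

definition full_term :: "('e::finite) set \<Rightarrow> 'e mseq \<Rightarrow> 'e mseq \<Rightarrow> 'e vseq" where
  "full_term U q B = (\<lambda>e.
     conv_vec U (conv_mat U (conv_mat U (conv_inv U q) B) (conv_inv U q)) (diag_seq (tail_op q)) e
     + tail_term U q B e)"

definition outer_square :: "'e vseq \<Rightarrow> 'e \<times> nat \<Rightarrow> 'e \<times> nat \<Rightarrow> real" where
  "outer_square r e e' = r e * r e'"

definition var_summand_UU :: "('e::finite) set \<Rightarrow> ('e \<Rightarrow> real) \<Rightarrow> 'e mseq \<Rightarrow>
    'e \<times> nat \<Rightarrow> 'e \<times> nat \<Rightarrow> 'e \<times> 'e \<times> nat \<Rightarrow> real" where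
  "var_summand_UU U \<mu> q e e' t = q_bar \<mu> q t * outer_square (full_term U q (delta_seq t)) e e'"

definition var_summand_UD :: "('e::finite) set \<Rightarrow> ('e \<Rightarrow> real) \<Rightarrow> 'e mseq \<Rightarrow>
    'e \<times> nat \<Rightarrow> 'e \<times> nat \<Rightarrow> 'e \<times> 'e \<times> nat \<Rightarrow> real" where
  "var_summand_UD U \<mu> q e e' t = q_bar \<mu> q t * outer_square (tail_term U q (delta_seq t)) e e'"

definition reliability_variance :: "('e::finite) set \<Rightarrow> 'e set \<Rightarrow> ('e \<Rightarrow> real) \<Rightarrow> 'e mseq \<Rightarrow>
    'e \<times> nat \<Rightarrow> 'e \<times> nat \<Rightarrow> real" where
  "reliability_variance U D \<mu> q e e' =
     (\<Sum>\<^sub>\<infinity>t \<in> U \<times> U \<times> UNIV. var_summand_UU U \<mu> q e e' t)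
     - (\<Sum>i\<in>U. \<mu> i * outer_square (full_term U q (q_row q i)) e e')
     + (\<Sum>\<^sub>\<infinity>t \<in> U \<times> D \<times> UNIV. var_summand_UD U \<mu> q e e' t)"


section \<open>Gaussian laws and convergence in distribution on a product of real lines\<close>

text \<open>The space of real families over \<open>I\<close> consists of the extensional functions
  \<open>I \<rightarrow>\<^sub>E UNIV\<close>.\<close>

definition centered_normal :: "real \<Rightarrow> real measure" where
  "centered_normal \<sigma> =
     (if \<sigma> = 0 then return borel 0 else density lborel (\<lambda>x. ennreal (normal_density 0 \<sigma> x)))"

text \<open>The law of a centered Gaussian system with covariance \<open>V\<close>: all finite linear combinations
  of the coordinates are centered normal, possibly degenerate.
  For a given \<open>V\<close> there is at most one such law.\<close>

definition centered_gaussian_law :: "'i set \<Rightarrow> ('i \<Rightarrow> 'i \<Rightarrow> real) \<Rightarrow> ('i \<Rightarrow> real) measure \<Rightarrow> bool" where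
  "centered_gaussian_law I V \<nu> \<longleftrightarrow>
     prob_space \<nu> \<and> sets \<nu> = sets (\<Pi>\<^sub>M i\<in>I. (borel :: real measure)) \<and>
     (\<forall>F c. finite F \<and> F \<subseteq> I \<longrightarrow>
        (\<exists>\<sigma>\<ge>0. distr \<nu> borel (\<lambda>y. \<Sum>i\<in>F. c i * y i) = centered_normal \<sigma>)) \<and>
     (\<forall>i\<in>I. \<forall>j\<in>I. integrable \<nu> (\<lambda>y. y i * y j) \<and> (\<integral>y. y i * y j \<partial>\<nu>) = V i j)"

text \<open>For countable \<open>I\<close> the product sigma-algebra is the Borel sigma-algebra of the product topology.\<close>

definition converges_in_distribution ::
    "'w measure \<Rightarrow> 'i set \<Rightarrow> (nat \<Rightarrow> 'w \<Rightarrow> 'i \<Rightarrow> real) \<Rightarrow> ('i \<Rightarrow> real) measure \<Rightarrow> bool" where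
  "converges_in_distribution Q I X \<nu> \<longleftrightarrow>
     (\<forall>n. X n \<in> measurable Q (\<Pi>\<^sub>M i\<in>I. (borel :: real measure))) \<and>
     sets \<nu> = sets (\<Pi>\<^sub>M i\<in>I. (borel :: real measure)) \<and>
     (\<forall>f. continuous_map (product_topology (\<lambda>_. euclideanreal) I) euclideanreal f \<and>
          bounded (f ` (I \<rightarrow>\<^sub>E UNIV)) \<longrightarrow>
        (\<lambda>n. \<integral>\<omega>. f (X n \<omega>) \<partial>Q) \<longlonglongrightarrow> (\<integral>y. f y \<partial>\<nu>))"

end

theory Submission
  imports Defs
begin

text \<open>
  Write \<open>\<psi>\<close> for the convolution inverse over \<open>U\<close>. Both \<open>R\<close> and its estimator solve a renewal equation
  \<open>x = S A + A * x\<close> over \<open>U\<close>, with \<open>A = q\<close> and \<open>A = q_hat\<close>. Subtracting the equations shows that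
  \<open>R_hat - R\<close> is \<open>\<psi>_hat\<close> convolved with the vector whose entry \<open>(i, k)\<close> is the deviation from its mean of
  the empirical average, over the visits to \<open>i\<close>, of the survival probability beyond \<open>k\<close> given the
  next transition. Since \<open>\<psi>_hat\<close> converges to \<open>\<psi>\<close> and the number of visits to \<open>i\<close> is asymptotic to
  \<open>M / \<mu> i\<close>, every finite linear combination of the coordinates of \<open>sqrt M * (R_hat - R)\<close> is, up to a term
  that vanishes in probability, \<open>1 / sqrt M\<close> times a martingale with bounded increments, observed at the
  first jump after time \<open>M\<close>. Multiply its characteristic exponential by the exponential of half the
  conditional variance. Each step changes the expectation of the product by \<open>O (M powr (- 3 / 2))\<close>, and
  there are at most \<open>M + 1\<close> steps because \<open>S n \<ge> n\<close>, so the expectation tends to \<open>1\<close>. The conditional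
  variance is a combination of visit counts, hence asymptotically deterministic.

  The law of large numbers for the visits to \<open>i\<close> comes from a second martingale: if \<open>g j\<close> is the mean time
  to reach \<open>i\<close> from \<open>j \<noteq> i\<close> and \<open>g i = 0\<close>, then \<open>S n + g (J n)\<close> minus \<open>\<mu> i\<close> times the number of visits to
  \<open>i\<close> is a martingale.

  On the product space, convergence of the characteristic functions of finite linear combinations
  gives tightness of each coordinate, hence concentration on a compact box, where trigonometric
  polynomials are uniformly dense. The Gaussian limit is a linear image of white noise under the
  (row-finite) Cholesky factor of the covariance.
\<close>

section \<open>Weak convergence on products of real lines\<close>

text \<open>The number of transitions completed by time \<open>M\<close> is not a stopping time for
  the histories, so the sums in the estimators are not stopped martingales. Counting the transition
  that straddles \<open>M\<close> as well repairs this, at the price of one bounded term that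
  vanishes after division by \<open>sqrt M\<close>. The second point is boundedness: the kernel has
  infinitely many entries and sojourn times are controlled only in mean, but the estimator enters
  only through empirical averages of \<open>one_step\<close>, which is bounded at each fixed time.
  Unbounded sojourn times occur only in the law of large numbers, where they are truncated. The
  identity for the estimation error carries the estimated inverse and is exact, so no quadratic
  remainder arises. The three sums of the variance are one object: each state \<open>i\<close> of
  \<open>U\<close> contributes \<open>\<mu> i\<close> times the conditional covariance, given
  departure from \<open>i\<close>, of the formal derivative at \<open>q\<close> of the map from
  kernels to reliabilities, in the direction of the observed transition. For a transition into
  \<open>D\<close> this derivative reduces to its tail part, whence the separate sum.\<close>

definition lin_comb :: "'i set \<Rightarrow> ('i \<Rightarrow> real) \<Rightarrow> ('i \<Rightarrow> real) \<Rightarrow> real" where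
  "lin_comb F c x = (\<Sum>i\<in>F. c i * x i)"

text \<open>Real waves with a free phase replace complex exponentials: constants and sines are
  included, and the integral of a wave is the real part of a rotated value of a characteristic
  function.\<close>

inductive trig_poly :: "'i set \<Rightarrow> (('i \<Rightarrow> real) \<Rightarrow> real) \<Rightarrow> bool" for I where
  wave: "finite F \<Longrightarrow> F \<subseteq> I \<Longrightarrow> trig_poly I (\<lambda>x. a * cos (lin_comb F c x + \<theta>))"
| add: "trig_poly I f \<Longrightarrow> trig_poly I g \<Longrightarrow> trig_poly I (\<lambda>x. f x + g x)"

lemma trig_poly_const: "trig_poly I (\<lambda>x. a)"
  using trig_poly.wave[of "{}" I a "\<lambda>_. 0" 0] by (simp add: lin_comb_def)

lemma lin_comb_combine:
  assumes "finite F" "finite G"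
  shows "lin_comb F c x + s * lin_comb G d x =
    lin_comb (F \<union> G) (\<lambda>i. (if i \<in> F then c i else 0) + s * (if i \<in> G then d i else 0)) x"
proof -
  have "lin_comb F c x = (\<Sum>i\<in>F \<union> G. (if i \<in> F then c i else 0) * x i)"
    unfolding lin_comb_def using assms by (intro sum.mono_neutral_cong_left) auto
  moreover have "lin_comb G d x = (\<Sum>i\<in>F \<union> G. (if i \<in> G then d i else 0) * x i)"
    unfolding lin_comb_def using assms by (intro sum.mono_neutral_cong_left) auto
  ultimately show ?thesis
    unfolding lin_comb_def by (simp add: sum.distrib sum_distrib_left algebra_simps)
qed

text \<open>Product-to-sum formula: \<open>s = -1\<close> and \<open>s = 1\<close> give the waves at
  the difference and at the sum of the two frequencies. Closure under products makes the
  trigonometric polynomials an algebra, as Stone--Weierstrass requires.\<close>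

lemma trig_poly_wave_mult_wave:
  assumes "finite F" "F \<subseteq> I" "finite G" "G \<subseteq> I"
  shows "trig_poly I (\<lambda>x. (a * cos (lin_comb F c x + \<theta>)) * (b * cos (lin_comb G d x + \<eta>)))"
proof -
  have aux: "a * b / 2 * cos (A - B) + a * b / 2 * cos (A + B) = (a * cos A) * (b * cos B)" for A B
    by (simp add: cos_add cos_diff field_simps)
  let ?w = "\<lambda>s x. (a * b / 2) * cos (lin_comb (F \<union> G)
      (\<lambda>i. (if i \<in> F then c i else 0) + s * (if i \<in> G then d i else 0)) x + (\<theta> + s * \<eta>))"
  have "trig_poly I (\<lambda>x. ?w (-1) x + ?w 1 x)"
    using assms by (intro trig_poly.intros) auto
  moreover have "?w (-1) x + ?w 1 x =
      (a * cos (lin_comb F c x + \<theta>)) * (b * cos (lin_comb G d x + \<eta>))" for x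
    unfolding lin_comb_combine[OF assms(1,3), symmetric] 
    using aux[of "lin_comb F c x + \<theta>" "lin_comb G d x + \<eta>"] by (simp add: algebra_simps)
  ultimately show ?thesis by simp
qed

lemma trig_poly_mult:
  assumes f: "trig_poly I f" and g: "trig_poly I g"
  shows "trig_poly I (\<lambda>x. f x * g x)"
  using f
proof (induction rule: trig_poly.induct)
  case (wave F a c \<theta>)
  note F = wave
  show ?case using g
  proof (induction rule: trig_poly.induct)
    case (wave F' b d \<eta>)
    then show ?case using F by (intro trig_poly_wave_mult_wave)
  next
    case (add f1 f2)
    from trig_poly.add[OF add.IH] show ?case by (simp add: algebra_simps)
  qed
next
  case (add f1 f2)
  from trig_poly.add[OF add.IH] show ?case by (simp add: algebra_simps)
qed

lemma trig_poly_compose_polynomial: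
  assumes "real_polynomial_function p" "trig_poly I (g :: ('i \<Rightarrow> real) \<Rightarrow> real)"
  shows "trig_poly I (\<lambda>x. p (g x))"
  using assms
proof (induction rule: real_polynomial_function.induct)
  case (linear f)
  then obtain c where "f = (\<lambda>x. x * c)"
    by (auto simp: real_bounded_linear)
  then show ?case using trig_poly_mult[OF linear.prems trig_poly_const[of I c]] by simp
qed (auto intro: trig_poly_const trig_poly.add trig_poly_mult)

lemma continuous_on_lin_comb [continuous_intros]: "continuous_on A (lin_comb F c)"
  unfolding lin_comb_def[abs_def]
  by (intro continuous_intros continuous_on_product_then_coordinatewise continuous_on_id)

lemma trig_poly_continuous:
  fixes g :: "('i::countable \<Rightarrow> real) \<Rightarrow> real"
  shows "trig_poly I g \<Longrightarrow> continuous_on A g"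
  by (induction rule: trig_poly.induct) (auto intro!: continuous_intros)

lemma trig_poly_bounded: "trig_poly I g \<Longrightarrow> \<exists>b. \<forall>x. \<bar>g x\<bar> \<le> b"
proof (induction rule: trig_poly.induct)
  case (wave F a c \<theta>)
  show ?case
    by (intro exI[of _ "\<bar>a\<bar>"]) (auto simp: abs_mult intro!: mult_left_le)
next
  case (add f g)
  then obtain b b' where *: "\<And>x. \<bar>f x\<bar> \<le> b" "\<And>x. \<bar>g x\<bar> \<le> b'" by auto
  have "\<bar>f x + g x\<bar> \<le> b + b'" for x
    using *(1)[of x] *(2)[of x] by linarith
  then show ?case by blast
qed

lemma trig_poly_separates:
  assumes "i \<in> I" "x i \<noteq> y i"
  shows "\<exists>f. trig_poly I f \<and> f x \<noteq> f y"
proof -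
  \<comment> \<open>Frequency and phase are chosen so that the wave has its crest at
    \<open>x\<close> and its trough at \<open>y\<close>.\<close>
  define c where "c = pi / (y i - x i)"
  let ?f = "\<lambda>z. 1 * cos (lin_comb {i} (\<lambda>_. c) z + (- c * x i))"
  have "trig_poly I ?f" using assms by (intro trig_poly.wave) auto
  moreover have "?f x = 1" by (simp add: lin_comb_def)
  moreover have "?f y = -1"
  proof -
    have "c * (y i - x i) = pi" using assms(2) by (simp add: c_def)
    then have "c * y i - c * x i = pi" by (simp add: right_diff_distrib)
    then show ?thesis by (simp add: lin_comb_def)
  qed
  ultimately have "trig_poly I ?f \<and> ?f x \<noteq> ?f y" by simp
  then show ?thesis by blast
qed

lemma compact_box: "compact (PiE UNIV (\<lambda>i::'i. {- a i..a i::real}))"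
proof -
  have "compactin (product_topology (\<lambda>i::'i. euclidean) UNIV) (PiE UNIV (\<lambda>i. {- a i..a i::real}))"
    by (subst compactin_PiE) (auto simp: compactin_euclidean_iff)
  then show ?thesis by (simp add: euclidean_product_topology compactin_euclidean_iff)
qed

text \<open>Composing a Stone--Weierstrass approximation with a polynomial close to a truncation keeps it
  under control off the compact set.\<close>

lemma trig_poly_approximation:
  fixes f :: "('i::countable \<Rightarrow> real) \<Rightarrow> real"
  assumes cont: "continuous_on UNIV f" and bd: "\<And>x. \<bar>f x\<bar> \<le> B" and e: "e > 0"
    and K: "compact K" and sep: "\<And>x y. x \<in> K \<Longrightarrow> y \<in> K \<Longrightarrow> x \<noteq> y \<Longrightarrow> \<exists>i\<in>I. x i \<noteq> y i"
  shows "\<exists>h. trig_poly I h \<and> (\<forall>x. \<bar>h x\<bar> \<le> B + e) \<and> (\<forall>x\<in>K. \<bar>f x - h x\<bar> \<le> 2 * e)"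
proof -
  have B0: "0 \<le> B" using bd[of undefined] by linarith
  have "\<exists>g. trig_poly I g \<and> (\<forall>x\<in>K. \<bar>f x - g x\<bar> < e)"
  proof (rule Stone_Weierstrass_HOL[where P = "trig_poly I"])
    show "\<exists>f. trig_poly I f \<and> f x \<noteq> f y" if "x \<in> K \<and> y \<in> K \<and> x \<noteq> y" for x y
      using sep[of x y] that trig_poly_separates by metis
  qed (use K e cont in \<open>auto intro: trig_poly_const trig_poly_continuous trig_poly.add trig_poly_mult
        continuous_on_subset\<close>)
  then obtain g where g: "trig_poly I g" "\<And>x. x \<in> K \<Longrightarrow> \<bar>f x - g x\<bar> < e" by auto
  obtain b where b: "\<And>x. \<bar>g x\<bar> \<le> b" using trig_poly_bounded[OF g(1)] by auto
  define cl where "cl t = max (- B) (min B t)" for t :: real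
  have "continuous_on {- b..b} cl" unfolding cl_def[abs_def] by (intro continuous_intros)
  then obtain p where p: "real_polynomial_function p" "\<And>t. t \<in> {- b..b} \<Longrightarrow> \<bar>cl t - p t\<bar> < e"
    using Stone_Weierstrass_real_polynomial_function[of "{- b..b}" cl e] e by auto
  have pe: "\<bar>cl (g x) - p (g x)\<bar> < e" for x using b[of x] by (intro p(2)) (auto simp: abs_le_iff)
  show ?thesis
  proof (intro exI conjI allI ballI)
    show "trig_poly I (\<lambda>x. p (g x))" by (rule trig_poly_compose_polynomial[OF p(1) g(1)])
    have "\<bar>cl t\<bar> \<le> B" for t using B0 by (auto simp: cl_def)
    then show "\<bar>p (g x)\<bar> \<le> B + e" for x using pe[of x] by (smt (verit))
    \<comment> \<open>The truncation \<open>cl\<close> is 1-Lipschitz and fixes \<open>f x\<close>,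
      so on \<open>K\<close> it does not enlarge the distance of \<open>g\<close> from
      \<open>f\<close>; the second \<open>e\<close> is the error of \<open>p\<close>.\<close>
    show "\<bar>f x - p (g x)\<bar> \<le> 2 * e" if "x \<in> K" for x
      using pe[of x] g(2)[OF that] bd[of x] unfolding cl_def by (smt (verit))
  qed
qed

section \<open>Tightness of single coordinates and of countable families\<close>

definition tight_rv :: "'w measure \<Rightarrow> (nat \<Rightarrow> 'w \<Rightarrow> real) \<Rightarrow> bool" where
  "tight_rv Q Y \<longleftrightarrow> (\<forall>e>0. \<exists>a. \<forall>n. measure Q {\<omega> \<in> space Q. \<bar>Y n \<omega>\<bar> > a} \<le> e)"

lemma (in prob_space) tail_small:
  fixes Y :: "'a \<Rightarrow> real"
  assumes [measurable]: "Y \<in> borel_measurable M" and "e > 0"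
  shows "\<exists>a. measure M {\<omega> \<in> space M. \<bar>Y \<omega>\<bar> > a} \<le> e"
proof -
  have "(\<lambda>n. measure M {\<omega> \<in> space M. \<bar>Y \<omega>\<bar> > real n}) \<longlonglongrightarrow>
      measure M (\<Inter>n. {\<omega> \<in> space M. \<bar>Y \<omega>\<bar> > real n})"
    by (rule finite_Lim_measure_decseq) (auto simp: decseq_def)
  moreover have "(\<Inter>n. {\<omega> \<in> space M. \<bar>Y \<omega>\<bar> > real n}) = {}"
  proof -
    have "\<exists>n. \<not> \<bar>Y \<omega>\<bar> > real n" for \<omega>
      using real_arch_simple[of "\<bar>Y \<omega>\<bar>"] by (auto simp: not_less)
    then show ?thesis by blast
  qed
  ultimately have "(\<lambda>n. measure M {\<omega> \<in> space M. \<bar>Y \<omega>\<bar> > real n}) \<longlonglongrightarrow> 0" by simp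
  then have "eventually (\<lambda>n. measure M {\<omega> \<in> space M. \<bar>Y \<omega>\<bar> > real n} < e) sequentially"
    using assms(2) by (rule order_tendstoD)
  then show ?thesis by (auto simp: eventually_sequentially intro: less_imp_le)
qed

text \<open>Each of the finitely many remaining variables is tight on its own; the maximum of all
  bounds serves the whole sequence.\<close>

lemma (in prob_space) tight_rv_if_eventually:
  assumes [measurable]: "\<And>n. Y n \<in> borel_measurable M"
    and ev: "\<And>e. e > 0 \<Longrightarrow> \<exists>a. eventually (\<lambda>n. measure M {\<omega> \<in> space M. \<bar>Y n \<omega>\<bar> > a} \<le> e) sequentially"
  shows "tight_rv M Y"
  unfolding tight_rv_def
proof (intro allI impI)
  fix e :: real assume e: "e > 0"
  obtain a N where a: "\<And>n. n \<ge> N \<Longrightarrow> measure M {\<omega> \<in> space M. \<bar>Y n \<omega>\<bar> > a} \<le> e"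
    using ev[OF e] by (auto simp: eventually_sequentially)
  obtain b where b: "\<And>n. measure M {\<omega> \<in> space M. \<bar>Y n \<omega>\<bar> > b n} \<le> e"
    using tail_small[OF assms(1) e] by metis
  define c where "c = Max (insert a (b ` {..<N}))"
  have mono: "measure M {\<omega> \<in> space M. \<bar>Y n \<omega>\<bar> > c} \<le> measure M {\<omega> \<in> space M. \<bar>Y n \<omega>\<bar> > d}" if "d \<le> c" for n d
    using that by (intro finite_measure_mono) auto
  have "measure M {\<omega> \<in> space M. \<bar>Y n \<omega>\<bar> > c} \<le> e" for n
  proof (cases "n < N")
    case True
    then have "b n \<le> c" unfolding c_def by (intro Max_ge) auto
    from mono[OF this, of n] b[of n] show ?thesis by linarith
  next
    case False
    have "a \<le> c" unfolding c_def by (intro Max_ge) auto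
    from mono[OF this, of n] a[of n] False show ?thesis by simp
  qed
  then show "\<exists>a. \<forall>n. measure M {\<omega> \<in> space M. \<bar>Y n \<omega>\<bar> > a} \<le> e" by blast
qed

text \<open>Levy's continuity theorem gives weak convergence, and a continuous test function then
  carries the tail bound of the limit over to all large indices.\<close>

lemma (in prob_space) tight_rv_if_char_conv:
  assumes [measurable]: "\<And>n. Y n \<in> borel_measurable M" and "real_distribution N"
    and char: "\<And>t. (\<lambda>n. char (distr M borel (Y n)) t) \<longlonglongrightarrow> char N t"
  shows "tight_rv M Y"
proof (rule tight_rv_if_eventually)
  fix e :: real assume e: "e > 0"
  interpret N: real_distribution N by fact
  have rd: "real_distribution (distr M borel (Y n))" for n
    by (rule real_distribution_distr) simp
  obtain a where a: "measure N {x \<in> space N. \<bar>x\<bar> > a} \<le> e / 2"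
    using N.tail_small[of "\<lambda>x. x" "e / 2"] e by auto
  \<comment> \<open>A ramp between the indicators of \<bar>x\<bar> > a + 1 and \<bar>x\<bar> >
    a.\<close>
  define \<phi> where "\<phi> x = max 0 (min 1 (\<bar>x\<bar> - a))" for x :: real
  have \<phi>m [measurable]: "\<phi> \<in> borel_measurable borel" unfolding \<phi>_def[abs_def] by simp
  have \<phi>b: "norm (\<phi> x) \<le> 1" for x by (auto simp: \<phi>_def)
  have conv: "(\<lambda>n. integral\<^sup>L (distr M borel (Y n)) \<phi>) \<longlonglongrightarrow> integral\<^sup>L N \<phi>"
    by (rule weak_conv_imp_integral_bdd_continuous_conv[OF rd assms(2) levy_continuity[OF rd assms(2) char] _ \<phi>b])
       (unfold \<phi>_def[abs_def], intro continuous_intros)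
  have "integral\<^sup>L N \<phi> \<le> (\<integral>x. indicator {x. \<bar>x\<bar> > a} x \<partial>N)"
  proof (rule integral_mono)
    show "integrable N \<phi>" using \<phi>b by (intro N.integrable_const_bound[where B = 1]) auto
    show "integrable N (indicat_real {x. a < \<bar>x\<bar>})"
      by (intro N.integrable_const_bound[where B = 1]) auto
    show "\<phi> x \<le> indicat_real {x. a < \<bar>x\<bar>} x" for x by (auto simp: \<phi>_def split: split_indicator)
  qed
  also have "\<dots> \<le> e / 2" using a by simp
  finally have "integral\<^sup>L N \<phi> < e" using e by simp
  then have ev: "eventually (\<lambda>n. integral\<^sup>L (distr M borel (Y n)) \<phi> < e) sequentially"
    by (intro order_tendstoD(2)[OF conv])
  have "measure M {\<omega> \<in> space M. \<bar>Y n \<omega>\<bar> > a + 1} \<le> integral\<^sup>L (distr M borel (Y n)) \<phi>" for n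
  proof -
    have "measure M {\<omega> \<in> space M. \<bar>Y n \<omega>\<bar> > a + 1} = (\<integral>\<omega>. indicator {\<omega> \<in> space M. \<bar>Y n \<omega>\<bar> > a + 1} \<omega> \<partial>M)"
      by (simp add: Int_def conj_commute)
    also have "\<dots> \<le> (\<integral>\<omega>. \<phi> (Y n \<omega>) \<partial>M)"
    proof (rule integral_mono)
      show "integrable M (\<lambda>\<omega>. \<phi> (Y n \<omega>))" using \<phi>b by (intro integrable_const_bound[where B = 1]) auto
      show "integrable M (indicat_real {\<omega> \<in> space M. a + 1 < \<bar>Y n \<omega>\<bar>})"
        by (intro integrable_const_bound[where B = 1]) auto
    qed (auto simp: \<phi>_def split: split_indicator)
    finally show ?thesis by (simp add: integral_distr)
  qed
  then have "eventually (\<lambda>n. measure M {\<omega> \<in> space M. \<bar>Y n \<omega>\<bar> > a + 1} \<le> e) sequentially"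
    by (intro eventually_mono[OF ev]) (meson less_imp_le order_trans)
  then show "\<exists>a. eventually (\<lambda>n. measure M {\<omega> \<in> space M. \<bar>Y n \<omega>\<bar> > a} \<le> e) sequentially" by blast
qed simp

lemma borel_measurable_lin_comb:
  assumes "F \<subseteq> I"
  shows "lin_comb F c \<in> borel_measurable (\<Pi>\<^sub>M i\<in>I. (borel :: real measure))"
  unfolding lin_comb_def[abs_def]
  using assms by (intro borel_measurable_sum borel_measurable_times measurable_component_singleton) auto

lemma trig_poly_measurable:
  "trig_poly I g \<Longrightarrow> g \<in> borel_measurable (\<Pi>\<^sub>M i\<in>I. (borel :: real measure))"
proof (induction rule: trig_poly.induct)
  case (wave F a c \<theta>)
  note [measurable] = borel_measurable_lin_comb[OF wave(2), of c]
  show ?case by simp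
qed simp

lemma trig_poly_cong:
  assumes "trig_poly I g" "\<And>i. i \<in> I \<Longrightarrow> x i = y i"
  shows "g x = g y"
  using assms
proof (induction rule: trig_poly.induct)
  case (wave F a c \<theta>)
  then have "lin_comb F c x = lin_comb F c y" unfolding lin_comb_def by (intro sum.cong) auto
  then show ?case by simp
qed simp

text \<open>A union bound that allots the error e / 2^(m + 1) to the coordinate with number m. It
  holds for every larger box too, so that boxes belonging to two different laws can be
  merged.\<close>

lemma tight_box:
  fixes X :: "nat \<Rightarrow> 'w \<Rightarrow> 'i::countable \<Rightarrow> real"
  assumes "prob_space Q" and [measurable]: "\<And>n i. i \<in> I \<Longrightarrow> (\<lambda>\<omega>. X n \<omega> i) \<in> borel_measurable Q"
    and tight: "\<And>i. i \<in> I \<Longrightarrow> tight_rv Q (\<lambda>n \<omega>. X n \<omega> i)" and "e > 0"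
  shows "\<exists>a. \<forall>b n. (\<forall>i. a i \<le> b i) \<longrightarrow>
    {\<omega> \<in> space Q. \<exists>i\<in>I. \<bar>X n \<omega> i\<bar> > b i} \<in> sets Q \<and>
    measure Q {\<omega> \<in> space Q. \<exists>i\<in>I. \<bar>X n \<omega> i\<bar> > b i} \<le> e"
proof -
  interpret prob_space Q by fact
  have "\<exists>a. \<forall>n. measure Q {\<omega> \<in> space Q. \<bar>X n \<omega> i\<bar> > a} \<le> e * (1 / 2) ^ Suc (to_nat i)" if "i \<in> I" for i
  proof -
    have "0 < e * (1 / 2) ^ Suc (to_nat i)" using \<open>e > 0\<close> by simp
    then show ?thesis using tight[OF that] unfolding tight_rv_def by blast
  qed
  then obtain a where a: "\<And>i n. i \<in> I \<Longrightarrow>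
      measure Q {\<omega> \<in> space Q. \<bar>X n \<omega> i\<bar> > a i} \<le> e * (1 / 2) ^ Suc (to_nat i)"
    by metis
  show ?thesis
  proof (intro exI[of _ a] allI impI)
    fix b n assume "\<forall>i. a i \<le> b i"
    then have ab: "a i \<le> b i" for i by blast
    \<comment> \<open>Countable subadditivity is applied to a sequence, so the coordinates are
      listed by \<open>to_nat\<close>; numbers that belong to no coordinate get the empty
      set.\<close>
    define A where "A m = {\<omega> \<in> space Q. \<exists>i\<in>I. to_nat i = m \<and> \<bar>X n \<omega> i\<bar> > b i}" for m
    have A_eq: "A m = (if m \<in> to_nat ` I then {\<omega> \<in> space Q. \<bar>X n \<omega> (from_nat m)\<bar> > b (from_nat m)} else {})" for m
      unfolding A_def by auto
    have A_sets: "A m \<in> sets Q" for m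
      unfolding A_eq by (auto intro!: borel_measurable_less)
    have A_le: "measure Q (A m) \<le> e * (1 / 2) ^ Suc m" for m
    proof (cases "m \<in> to_nat ` I")
      case True
      then obtain i where i: "i \<in> I" "m = to_nat i" by auto
      have "measure Q (A m) \<le> measure Q {\<omega> \<in> space Q. \<bar>X n \<omega> i\<bar> > a i}"
        unfolding A_eq using i ab[of i] by (intro finite_measure_mono) auto
      also have "\<dots> \<le> e * (1 / 2) ^ Suc m" using a[OF i(1)] i by simp
      finally show ?thesis .
    qed (use \<open>e > 0\<close> in \<open>auto simp: A_eq\<close>)
    have Un: "{\<omega> \<in> space Q. \<exists>i\<in>I. \<bar>X n \<omega> i\<bar> > b i} = (\<Union>m. A m)" unfolding A_def by auto
    have sm: "(\<lambda>m. e * (1 / 2) ^ Suc m) sums (e * 1)"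
      using power_half_series by (intro sums_mult) simp
    have "summable (\<lambda>m. measure Q (A m))"
      using A_le by (intro summable_comparison_test[OF _ sums_summable[OF sm]]) auto
    then have "measure Q (\<Union>m. A m) \<le> (\<Sum>m. measure Q (A m))"
      using A_sets by (intro finite_measure_subadditive_countably) auto
    also have "\<dots> \<le> (\<Sum>m. e * (1 / 2) ^ Suc m)"
      using \<open>summable (\<lambda>m. measure Q (A m))\<close> sums_summable[OF sm] A_le by (intro suminf_le) auto
    also have "\<dots> = e" using sums_unique[OF sm] by simp
    finally show "{\<omega> \<in> space Q. \<exists>i\<in>I. \<bar>X n \<omega> i\<bar> > b i} \<in> sets Q \<and>
        measure Q {\<omega> \<in> space Q. \<exists>i\<in>I. \<bar>X n \<omega> i\<bar> > b i} \<le> e"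
      using A_sets unfolding Un by auto
  qed
qed

section \<open>From trigonometric polynomials to bounded continuous test functions\<close>

lemma (in prob_space) expectation_close:
  fixes f h :: "'a \<Rightarrow> real"
  assumes [measurable]: "f \<in> borel_measurable M" "h \<in> borel_measurable M" "N \<in> sets M"
    and f: "\<And>x. x \<in> space M \<Longrightarrow> \<bar>f x\<bar> \<le> B" and h: "\<And>x. x \<in> space M \<Longrightarrow> \<bar>h x\<bar> \<le> B'"
    and close: "\<And>x. x \<in> space M \<Longrightarrow> x \<notin> N \<Longrightarrow> \<bar>f x - h x\<bar> \<le> e"
    and N: "measure M N \<le> d" and e: "e \<ge> 0"
  shows "\<bar>(\<integral>x. f x \<partial>M) - (\<integral>x. h x \<partial>M)\<bar> \<le> e + (B + B') * d"
proof -
  obtain x0 where "x0 \<in> space M" using not_empty by auto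
  then have B: "0 \<le> B + B'" using f[of x0] h[of x0] by linarith
  have if': "integrable M f" "integrable M h"
    using integrable_const_bound[OF AE_I2, of f B] integrable_const_bound[OF AE_I2, of h B'] f h by simp_all
  have "\<bar>(\<integral>x. f x \<partial>M) - (\<integral>x. h x \<partial>M)\<bar> = \<bar>\<integral>x. f x - h x \<partial>M\<bar>" using if' by simp
  also have "\<dots> \<le> (\<integral>x. \<bar>f x - h x\<bar> \<partial>M)" by (rule integral_abs_bound)
  also have "\<dots> \<le> (\<integral>x. e + (B + B') * indicator N x \<partial>M)"
  proof (rule integral_mono)
    show "integrable M (\<lambda>x. \<bar>f x - h x\<bar>)" using if' by auto
    show "integrable M (\<lambda>x. e + (B + B') * indicat_real N x)"
      by (intro integrable_const_bound[where B = "e + (B + B')"])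
         (use B e in \<open>auto split: split_indicator\<close>)
    show "\<bar>f x - h x\<bar> \<le> e + (B + B') * indicat_real N x" if "x \<in> space M" for x
      using f[OF that] h[OF that] close[OF that] e by (cases "x \<in> N") auto
  qed
  also have "\<dots> = e + (B + B') * measure M N"
    by (subst Bochner_Integration.integral_add)
       (auto simp: prob_space intro!: integrable_const_bound[where B = 1])
  also have "\<dots> \<le> e + (B + B') * d" using N B by (intro add_left_mono mult_left_mono) auto
  finally show ?thesis .
qed

lemma integral_wave:
  assumes "prob_space Q" and [measurable]: "Y \<in> borel_measurable Q"
  shows "(\<integral>\<omega>. a * cos (Y \<omega> + \<theta>) \<partial>Q) = a * Re (iexp \<theta> * (\<integral>\<omega>. iexp (Y \<omega>) \<partial>Q))"
proof -
  interpret prob_space Q by fact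
  have int: "integrable Q (\<lambda>\<omega>. iexp (Y \<omega>))"
    by (intro integrable_const_bound[where B = 1]) auto
  have "(\<integral>\<omega>. a * cos (Y \<omega> + \<theta>) \<partial>Q) = a * (\<integral>\<omega>. Re (iexp \<theta> * iexp (Y \<omega>)) \<partial>Q)"
    by (simp add: cos_add cis_conv_exp[symmetric] mult.commute)
  also have "\<dots> = a * Re (\<integral>\<omega>. iexp \<theta> * iexp (Y \<omega>) \<partial>Q)"
    using int by (subst integral_Re) auto
  finally show ?thesis by simp
qed

text \<open>Compactness and Stone--Weierstrass are used on the full function type, whereas the laws
  live on extensional functions over \<open>I\<close>. Hence the test function is precomposed with
  restriction to \<open>I\<close>, and \<open>T\<close> represents an extensional function by its
  extension by 0.\<close>

theorem converges_in_distribution_if_char_conv: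
  fixes X :: "nat \<Rightarrow> 'w \<Rightarrow> 'i::countable \<Rightarrow> real"
  assumes Q: "prob_space Q" and \<nu>: "prob_space \<nu>"
    and sets_\<nu>: "sets \<nu> = sets (\<Pi>\<^sub>M i\<in>I. (borel :: real measure))"
    and X [measurable]: "\<And>n. X n \<in> measurable Q (\<Pi>\<^sub>M i\<in>I. (borel :: real measure))"
    and char: "\<And>F c. finite F \<Longrightarrow> F \<subseteq> I \<Longrightarrow>
      (\<lambda>n. \<integral>\<omega>. iexp (lin_comb F c (X n \<omega>)) \<partial>Q) \<longlonglongrightarrow> (\<integral>y. iexp (lin_comb F c y) \<partial>\<nu>)"
  shows "converges_in_distribution Q I X \<nu>"
proof -
  interpret Q: prob_space Q by fact
  interpret \<nu>: prob_space \<nu> by fact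
  note [measurable_cong] = sets_\<nu>
  have comp [measurable]: "(\<lambda>\<omega>. X n \<omega> i) \<in> borel_measurable Q" if "i \<in> I" for n i
    using that by measurable
  have comp_\<nu> [measurable]: "(\<lambda>y. y i) \<in> borel_measurable \<nu>" if "i \<in> I" for i
    using that by measurable
  have trig: "(\<lambda>n. \<integral>\<omega>. g (X n \<omega>) \<partial>Q) \<longlonglongrightarrow> (\<integral>y. g y \<partial>\<nu>)" if "trig_poly I g" for g
    using that
  proof (induction rule: trig_poly.induct)
    case (wave F a c \<theta>)
    note [measurable] = borel_measurable_lin_comb[OF wave(2), of c]
    show ?case
      by (subst (1 2) integral_wave) (auto intro!: tendsto_intros char wave Q \<nu>)
  next
    case (add f g)
    note [measurable] = trig_poly_measurable[OF add.hyps(1)] trig_poly_measurable[OF add.hyps(2)]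
    obtain b b' where b: "\<And>x. \<bar>f x\<bar> \<le> b" "\<And>x. \<bar>g x\<bar> \<le> b'"
      using trig_poly_bounded add.hyps by metis
    have "integrable Q (\<lambda>\<omega>. f (X n \<omega>))" for n
      by (rule Q.integrable_const_bound[of _ b]) (simp_all add: b)
    moreover have "integrable Q (\<lambda>\<omega>. g (X n \<omega>))" for n
      by (rule Q.integrable_const_bound[of _ b']) (simp_all add: b)
    moreover have "integrable \<nu> f"
      by (rule \<nu>.integrable_const_bound[of _ b]) (simp_all add: b)
    moreover have "integrable \<nu> g"
      by (rule \<nu>.integrable_const_bound[of _ b']) (simp_all add: b)
    ultimately show ?case using add.IH by (simp add: tendsto_add)
  qed
  have tight: "tight_rv Q (\<lambda>n \<omega>. X n \<omega> i)" if i: "i \<in> I" for i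
  proof (rule Q.tight_rv_if_char_conv)
    show "real_distribution (distr \<nu> borel (\<lambda>y. y i))"
      using i by (intro \<nu>.real_distribution_distr) measurable
    show "(\<lambda>n. char (distr Q borel (\<lambda>\<omega>. X n \<omega> i)) t) \<longlonglongrightarrow> char (distr \<nu> borel (\<lambda>y. y i)) t" for t
      using char[of "{i}" "\<lambda>_. t"] i comp comp_\<nu> unfolding char_def lin_comb_def
      by (subst (1 2) integral_distr) auto
  qed (use i in measurable)
  have tight_\<nu>: "tight_rv \<nu> (\<lambda>n y. y i)" if i: "i \<in> I" for i
    using \<nu>.tail_small[of "\<lambda>y. y i"] i unfolding tight_rv_def by auto
  show ?thesis
    unfolding converges_in_distribution_def
  proof (intro conjI allI impI X sets_\<nu>)
    fix f :: "('i \<Rightarrow> real) \<Rightarrow> real"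
    assume "continuous_map (product_topology (\<lambda>_. euclideanreal) I) euclideanreal f \<and> bounded (f ` (I \<rightarrow>\<^sub>E UNIV))"
    then have f_cont: "continuous_map (product_topology (\<lambda>_. euclideanreal) I) euclideanreal f"
      and "bounded (f ` (I \<rightarrow>\<^sub>E UNIV))" by auto
    then obtain B where B: "\<And>x. x \<in> I \<rightarrow>\<^sub>E UNIV \<Longrightarrow> \<bar>f x\<bar> \<le> B" unfolding bounded_iff by auto
    define f' where "f' x = f (restrict x I)" for x
    have res: "restrict x I \<in> I \<rightarrow>\<^sub>E UNIV" for x by auto
    have f'B: "\<bar>f' x\<bar> \<le> B" for x unfolding f'_def by (rule B[OF res])
    have "continuous_map (product_topology (\<lambda>_. euclideanreal) UNIV) (product_topology (\<lambda>_. euclideanreal) I)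
        (\<lambda>x. restrict x I)"
      by (subst continuous_map_componentwise) (auto intro!: continuous_map_product_projection)
    from continuous_map_compose[OF this f_cont]
    have f'_cont: "continuous_on UNIV f'"
      unfolding f'_def[abs_def] by (simp add: euclidean_product_topology comp_def)
    define T where "T x = (\<lambda>i. if i \<in> I then x i else (0::real))" for x :: "'i \<Rightarrow> real"
    have f_T: "f x = f' (T x)" if "x \<in> I \<rightarrow>\<^sub>E UNIV" for x
    proof -
      have "restrict (T x) I = x" using that by (auto simp: T_def PiE_def extensional_def restrict_def)
      then show ?thesis by (simp add: f'_def)
    qed
    have "T \<in> measurable (\<Pi>\<^sub>M i\<in>I. (borel :: real measure)) (\<Pi>\<^sub>M i\<in>UNIV. borel)"
    proof (rule measurable_PiM_single')
      show "(\<lambda>x. T x i) \<in> borel_measurable (\<Pi>\<^sub>M i\<in>I. borel)" for i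
        by (cases "i \<in> I") (simp_all add: T_def)
    qed (auto simp: space_PiM)
    moreover have "f' \<in> measurable (\<Pi>\<^sub>M i\<in>UNIV. borel) borel"
      using borel_measurable_continuous_onI[OF f'_cont] measurable_cong_sets[OF sets_PiM_equal_borel refl] by blast
    ultimately have "(\<lambda>x. f' (T x)) \<in> borel_measurable (\<Pi>\<^sub>M i\<in>I. (borel :: real measure))"
      by (rule measurable_compose)
    then have fm [measurable]: "f \<in> borel_measurable (\<Pi>\<^sub>M i\<in>I. (borel :: real measure))"
      by (subst measurable_cong[where g = "\<lambda>x. f' (T x)"]) (auto simp: space_PiM f_T)
    have X_ext: "X n \<omega> \<in> I \<rightarrow>\<^sub>E UNIV" if "\<omega> \<in> space Q" for n \<omega>
      using measurable_space[OF X that] by (simp add: space_PiM)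
    have \<nu>_ext: "y \<in> I \<rightarrow>\<^sub>E UNIV" if "y \<in> space \<nu>" for y
      using that sets_eq_imp_space_eq[OF sets_\<nu>] by (simp add: space_PiM)
    have B0: "0 \<le> B" using f'B[of undefined] by linarith
    show "(\<lambda>n. \<integral>\<omega>. f (X n \<omega>) \<partial>Q) \<longlonglongrightarrow> (\<integral>y. f y \<partial>\<nu>)"
    proof (rule LIMSEQ_I)
      fix r :: real assume r: "r > 0"
      \<comment> \<open>Chosen so that the two replacement errors \<open>d\<close> and the error
        \<open>e\<close> of the convergence stay below \<open>r\<close>: with e \<le> 1, the sum 2 d
        + e = e (5 + 4 B + 2 e) is less than e (10 + 4 B).\<close>
      define e where "e = min 1 (r / (6 + 4 * B + 4))"
      have e: "e > 0" "e \<le> 1" using r B0 by (auto simp: e_def)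
      have "e \<le> r / (6 + 4 * B + 4)" by (simp add: e_def)
      then have "e * (6 + 4 * B + 4) \<le> r" using B0 by (subst (asm) pos_le_divide_eq) auto
      define d where "d = 2 * e + (B + (B + e)) * e"
      have "2 * d + e \<le> e * (5 + 4 * B + 2 * e)" by (simp add: d_def algebra_simps)
      also have "\<dots> \<le> e * (5 + 4 * B + 2)" using e by (intro mult_left_mono) auto
      also have "\<dots> < e * (6 + 4 * B + 4)" using e by (intro mult_strict_left_mono) auto
      finally have de: "2 * d + e < r" using \<open>e * (6 + 4 * B + 4) \<le> r\<close> by linarith
      obtain a1 where a1: "\<forall>b n. (\<forall>i. a1 i \<le> b i) \<longrightarrow>
          {\<omega> \<in> space Q. \<exists>i\<in>I. \<bar>X n \<omega> i\<bar> > b i} \<in> sets Q \<and>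
          measure Q {\<omega> \<in> space Q. \<exists>i\<in>I. \<bar>X n \<omega> i\<bar> > b i} \<le> e"
        using tight_box[where X = X, OF Q comp tight e(1)] by (rule exE)
      obtain a2 where a2: "\<forall>b (n::nat). (\<forall>i. a2 i \<le> b i) \<longrightarrow>
          {y \<in> space \<nu>. \<exists>i\<in>I. \<bar>y i\<bar> > b i} \<in> sets \<nu> \<and>
          measure \<nu> {y \<in> space \<nu>. \<exists>i\<in>I. \<bar>y i\<bar> > b i} \<le> e"
        using tight_box[where X = "\<lambda>_ y. y", OF \<nu> comp_\<nu> tight_\<nu> e(1)] by (rule exE)
      define a where "a i = max (a1 i) (a2 i)" for i
      define N where "N n = {\<omega> \<in> space Q. \<exists>i\<in>I. \<bar>X n \<omega> i\<bar> > a i}" for n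
      define N' where "N' = {y \<in> space \<nu>. \<exists>i\<in>I. \<bar>y i\<bar> > a i}"
      have N: "N n \<in> sets Q" "measure Q (N n) \<le> e" for n
        using a1[rule_format, of a n] by (auto simp: N_def a_def)
      have N': "N' \<in> sets \<nu>" "measure \<nu> N' \<le> e"
        using a2[rule_format, of a] by (auto simp: N'_def a_def)
      \<comment> \<open>Outside \<open>I\<close> the box is reduced to 0, so two distinct points of
        the box differ at a coordinate in \<open>I\<close>, where trigonometric polynomials over
        \<open>I\<close> can separate them.\<close>
      define a' where "a' i = (if i \<in> I then a i else 0)" for i
      have "\<exists>h. trig_poly I h \<and> (\<forall>x. \<bar>h x\<bar> \<le> B + e) \<and>
        (\<forall>x \<in> PiE UNIV (\<lambda>i. {- a' i..a' i}). \<bar>f' x - h x\<bar> \<le> 2 * e)"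
      proof (rule trig_poly_approximation[OF f'_cont f'B e(1) compact_box])
        fix x y :: "'i \<Rightarrow> real"
        assume "x \<in> PiE UNIV (\<lambda>i. {- a' i..a' i})" "y \<in> PiE UNIV (\<lambda>i. {- a' i..a' i})" "x \<noteq> y"
        then have box: "x i \<in> {- a' i..a' i}" "y i \<in> {- a' i..a' i}" for i
          by (auto simp: PiE_iff)
        have eq: "x i = y i" if "i \<notin> I" for i
          using box(1)[of i] box(2)[of i] that by (simp add: a'_def)
        from \<open>x \<noteq> y\<close> obtain i where "x i \<noteq> y i" by auto
        with eq show "\<exists>i\<in>I. x i \<noteq> y i" by auto
      qed
      then obtain h where h: "trig_poly I h" "\<And>x. \<bar>h x\<bar> \<le> B + e"
        "\<And>x. x \<in> PiE UNIV (\<lambda>i. {- a' i..a' i}) \<Longrightarrow> \<bar>f' x - h x\<bar> \<le> 2 * e"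
        by blast
      note [measurable] = trig_poly_measurable[OF h(1)]
      have h_T: "h (T x) = h x" for x by (rule trig_poly_cong[OF h(1)]) (simp add: T_def)
      have close: "\<bar>f x - h x\<bar> \<le> 2 * e" if "x \<in> I \<rightarrow>\<^sub>E UNIV" "\<not> (\<exists>i\<in>I. \<bar>x i\<bar> > a i)" for x
      proof -
        have "T x \<in> PiE UNIV (\<lambda>i. {- a' i..a' i})"
          using that(2) by (auto simp: T_def a'_def not_less abs_le_iff minus_le_iff)
        from h(3)[OF this] show ?thesis by (simp add: f_T[OF that(1)] h_T)
      qed
      have 1: "\<bar>(\<integral>\<omega>. f (X n \<omega>) \<partial>Q) - (\<integral>\<omega>. h (X n \<omega>) \<partial>Q)\<bar> \<le> d" for n
        unfolding d_def
      proof (rule Q.expectation_close[where N = "N n"])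
        show "\<bar>f (X n \<omega>) - h (X n \<omega>)\<bar> \<le> 2 * e" if "\<omega> \<in> space Q" "\<omega> \<notin> N n" for \<omega>
          using that by (intro close X_ext) (auto simp: N_def)
      qed (use e in \<open>simp_all add: N B X_ext h(2)\<close>)
      have 2: "\<bar>(\<integral>y. f y \<partial>\<nu>) - (\<integral>y. h y \<partial>\<nu>)\<bar> \<le> d"
        unfolding d_def
      proof (rule \<nu>.expectation_close[where N = N'])
        show "\<bar>f y - h y\<bar> \<le> 2 * e" if "y \<in> space \<nu>" "y \<notin> N'" for y
          using that by (intro close \<nu>_ext) (auto simp: N'_def)
      qed (use e in \<open>simp_all add: N' B \<nu>_ext h(2)\<close>)
      obtain n0 where n0: "\<And>n. n \<ge> n0 \<Longrightarrow> norm ((\<integral>\<omega>. h (X n \<omega>) \<partial>Q) - (\<integral>y. h y \<partial>\<nu>)) < e"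
        using LIMSEQ_D[OF trig[OF h(1)] e(1)] by auto
      have "norm ((\<integral>\<omega>. f (X n \<omega>) \<partial>Q) - (\<integral>y. f y \<partial>\<nu>)) < r" if "n \<ge> n0" for n
        using 1[of n] 2 n0[OF that] de unfolding real_norm_def by linarith
      then show "\<exists>no. \<forall>n\<ge>no. norm ((\<integral>\<omega>. f (X n \<omega>) \<partial>Q) - (\<integral>y. f y \<partial>\<nu>)) < r" by blast
    qed
  qed
qed

section \<open>Gaussian laws with a given covariance\<close>

definition psd :: "('i \<Rightarrow> 'i \<Rightarrow> real) \<Rightarrow> bool" where
  "psd V \<longleftrightarrow> (\<forall>i j. V i j = V j i) \<and>
     (\<forall>F c. finite F \<longrightarrow> 0 \<le> (\<Sum>i\<in>F. \<Sum>j\<in>F. c i * c j * V i j))"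

lemma psd_sym: "psd V \<Longrightarrow> V i j = V j i"
  and psd_nonneg: "psd V \<Longrightarrow> finite F \<Longrightarrow> 0 \<le> (\<Sum>i\<in>F. \<Sum>j\<in>F. c i * c j * V i j)"
  by (auto simp: psd_def)

lemma psd_diag: "psd V \<Longrightarrow> 0 \<le> V i i"
  using psd_nonneg[of V "{i}" "\<lambda>_. 1"] by simp

text \<open>With weights 1 at \<open>i\<close> and \<open>t\<close> at \<open>p\<close> the
  quadratic form is \<open>V i i + 2 * t * V i p\<close>, affine in \<open>t\<close>; being
  nonnegative for all \<open>t\<close>, it has slope 0.\<close>

lemma psd_null_diag:
  assumes "psd V" "V p p = 0"
  shows "V i p = 0"
proof (cases "i = p")
  case False
  have *: "0 \<le> V i i + 2 * t * V i p" for t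
    using psd_nonneg[OF assms(1), of "{i, p}" "\<lambda>k. if k = i then 1 else t"] False assms(2)
      psd_sym[OF assms(1), of p i] by (simp add: algebra_simps)
  show ?thesis
  proof (rule ccontr)
    assume nz: "V i p \<noteq> 0"
    have "2 * (- (V i i + 1) / (2 * V i p)) * V i p = - (V i i + 1)" using nz by simp
    with *[of "- (V i i + 1) / (2 * V i p)"] show False by linarith
  qed
qed (use assms in simp)

text \<open>One elimination step; a zero pivot leaves the matrix unchanged because \<open>x / 0 = 0\<close>.\<close>

definition schur_step :: "'i \<Rightarrow> ('i \<Rightarrow> 'i \<Rightarrow> real) \<Rightarrow> 'i \<Rightarrow> 'i \<Rightarrow> real" where
  "schur_step p V i j = V i j - V i p * V p j / V p p"

text \<open>The reduced form at \<open>d\<close> is the form of \<open>V\<close> at \<open>d\<close>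
  plus \<open>t\<close> times the unit vector at \<open>p\<close>, with the minimising
  \<open>t\<close>. For a zero pivot the convention x / 0 = 0 gives t = 0, consistently with the
  unchanged matrix.\<close>

lemma psd_schur_step:
  assumes V: "psd V"
  shows "psd (schur_step p V)"
  unfolding psd_def
proof (intro conjI allI impI)
  show "schur_step p V i j = schur_step p V j i" for i j
    using psd_sym[OF V, of i j] psd_sym[OF V, of i p] psd_sym[OF V, of j p] by (simp add: schur_step_def)
next
  fix F :: "'a set" and c :: "'a \<Rightarrow> real"
  assume F: "finite F"
  define G where "G = insert p F"
  have G: "finite G" "p \<in> G" "F \<subseteq> G" using F by (auto simp: G_def)
  define d where "d i = (if i \<in> F then c i else 0)" for i
  define t where "t = - (\<Sum>i\<in>G. d i * V i p) / V p p"
  have ext: "(\<Sum>i\<in>F. \<Sum>j\<in>F. c i * c j * X i j) = (\<Sum>i\<in>G. \<Sum>j\<in>G. d i * d j * X i j)" for X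
  proof -
    have "(\<Sum>j\<in>F. c i * c j * X i j) = (\<Sum>j\<in>G. c i * d j * X i j)" for i
      using G by (intro sum.mono_neutral_cong_left) (auto simp: d_def)
    then have "(\<Sum>i\<in>F. \<Sum>j\<in>F. c i * c j * X i j) = (\<Sum>i\<in>F. \<Sum>j\<in>G. c i * d j * X i j)" by simp
    also have "\<dots> = (\<Sum>i\<in>G. \<Sum>j\<in>G. d i * d j * X i j)"
      using G by (intro sum.mono_neutral_cong_left) (auto simp: d_def)
    finally show ?thesis .
  qed
  let ?B = "\<Sum>i\<in>G. d i * V i p"
  have B': "(\<Sum>j\<in>G. d j * V p j) = ?B" using psd_sym[OF V] by (metis (no_types))
  have "0 \<le> (\<Sum>i\<in>G. \<Sum>j\<in>G. (d i + (if i = p then t else 0)) * (d j + (if j = p then t else 0)) * V i j)"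
    using psd_nonneg[OF V G(1)] .
  also have "\<dots> = (\<Sum>i\<in>G. \<Sum>j\<in>G. d i * d j * V i j) + t * ?B + t * (\<Sum>j\<in>G. d j * V p j) + t * t * V p p"
  proof -
    have "(\<Sum>j\<in>G. (d i + (if i = p then t else 0)) * (d j + (if j = p then t else 0)) * V i j) =
        (\<Sum>j\<in>G. d i * d j * V i j) + t * (d i * V i p)
        + (if i = p then t * (\<Sum>j\<in>G. d j * V p j) + t * t * V p p else 0)" for i
    proof -
      have "(d i + (if i = p then t else 0)) * (d j + (if j = p then t else 0)) * V i j =
          d i * d j * V i j + (if j = p then t * (d i * V i p) else 0) +
          (if i = p then t * (d j * V p j) else 0) + (if j = p then if i = p then t * t * V p p else 0 else 0)" for j
        by (simp add: algebra_simps)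
      then show ?thesis using G by (simp add: sum.distrib sum_distrib_left)
    qed
    then show ?thesis using G by (simp add: sum.distrib sum_distrib_left)
  qed
  also have "\<dots> = (\<Sum>i\<in>G. \<Sum>j\<in>G. d i * d j * V i j) - ?B * ?B / V p p"
    unfolding B' t_def by (cases "V p p = 0") (simp_all add: field_simps)
  also have "\<dots> = (\<Sum>i\<in>G. \<Sum>j\<in>G. d i * d j * schur_step p V i j)"
  proof -
    have "?B * ?B / V p p = (\<Sum>i\<in>G. \<Sum>j\<in>G. d i * d j * (V i p * V p j / V p p))"
      by (subst (2) B'[symmetric]) (simp add: sum_product sum_divide_distrib mult_ac)
    then show ?thesis by (simp add: schur_step_def right_diff_distrib sum_subtractf)
  qed
  finally show "0 \<le> (\<Sum>i\<in>F. \<Sum>j\<in>F. c i * c j * schur_step p V i j)" unfolding ext .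
qed

primrec schur_iter :: "('i::countable \<Rightarrow> 'i \<Rightarrow> real) \<Rightarrow> nat \<Rightarrow> 'i \<Rightarrow> 'i \<Rightarrow> real" where
  "schur_iter V 0 = V"
| "schur_iter V (Suc m) = schur_step (from_nat m) (schur_iter V m)"

lemma psd_schur_iter: "psd V \<Longrightarrow> psd (schur_iter V m)"
  by (induction m) (auto intro: psd_schur_step)

text \<open>At its own step row \<open>i\<close> is cancelled by a nonzero pivot, while a zero pivot
  of a positive semidefinite matrix means that the row vanishes already. Later steps keep a zero
  row.\<close>

lemma schur_iter_eliminated:
  assumes V: "psd V" and "to_nat i < m"
  shows "schur_iter V m i j = 0"
  using assms(2)
proof (induction m arbitrary: j)
  case (Suc m)
  let ?W = "schur_iter V m"
  have W: "psd ?W" by (rule psd_schur_iter[OF V])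
  show ?case
  proof (cases "to_nat i = m")
    case True
    then have p: "from_nat m = i" by (metis from_nat_to_nat)
    show ?thesis
      using psd_null_diag[OF W, of i j] psd_sym[OF W, of i j]
      by (cases "?W i i = 0") (simp_all add: p schur_step_def)
  next
    case False
    with Suc.prems have "to_nat i < m" by simp
    then have "?W i k = 0" for k by (rule Suc.IH)
    then show ?thesis by (simp add: schur_step_def)
  qed
qed simp

text \<open>Column \<open>m\<close> is the pivot column of step \<open>m\<close> divided by the root
  of the pivot, and zero for a zero pivot. Numbers outside the range of \<open>to_nat\<close> yield
  some pivot as well, which is harmless: an elimination step is valid at every index.\<close>

definition cholesky :: "('i::countable \<Rightarrow> 'i \<Rightarrow> real) \<Rightarrow> 'i \<Rightarrow> nat \<Rightarrow> real" where
  "cholesky V i m = schur_iter V m i (from_nat m) / sqrt (schur_iter V m (from_nat m) (from_nat m))"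

lemma cholesky_eq_0: "psd V \<Longrightarrow> to_nat i < m \<Longrightarrow> cholesky V i m = 0"
  by (simp add: cholesky_def schur_iter_eliminated)

text \<open>Each elimination step subtracts the product of two entries of one column; the sum
  telescopes and ends once row \<open>i\<close> is eliminated.\<close>

lemma cholesky_product:
  assumes V: "psd V" and "to_nat i < N"
  shows "(\<Sum>m<N. cholesky V i m * cholesky V j m) = V i j"
proof -
  have "V i j = (\<Sum>m<n. cholesky V i m * cholesky V j m) + schur_iter V n i j" for n
  proof (induction n)
    case (Suc n)
    let ?W = "schur_iter V n" and ?p = "from_nat n"
    have W: "psd ?W" by (rule psd_schur_iter[OF V])
    have "cholesky V i n * cholesky V j n = ?W i ?p * ?W ?p j / ?W ?p ?p"
      using psd_diag[OF W, of ?p] psd_sym[OF W, of j ?p] by (simp add: cholesky_def)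
    then show ?case using Suc by (simp add: schur_step_def)
  qed simp
  from this[of N] schur_iter_eliminated[OF V assms(2), of j] show ?thesis by simp
qed

text \<open>This form covers \<sigma> = 0, so characteristic functions and second moments need no
  case distinction.\<close>

lemma centered_normal_eq_distr:
  assumes "\<sigma> \<ge> 0"
  shows "centered_normal \<sigma> = distr std_normal_distribution borel (\<lambda>x. \<sigma> * x)"
proof (cases "\<sigma> = 0")
  case True
  interpret prob_space std_normal_distribution by (rule real_distribution.axioms(1)[OF real_dist_normal_dist])
  show ?thesis using True by (simp add: centered_normal_def)
next
  case False
  interpret prob_space std_normal_distribution by (rule real_distribution.axioms(1)[OF real_dist_normal_dist])
  have "distributed std_normal_distribution lborel (\<lambda>x. x) std_normal_density"
    by (auto simp: distributed_def intro!: measure_eqI simp: emeasure_distr)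
  from normal_density_affine[OF this, of \<sigma> 0] False assms
  have "distributed std_normal_distribution lborel (\<lambda>x. \<sigma> * x) (normal_density 0 \<sigma>)" by simp
  then have "distr std_normal_distribution lborel (\<lambda>x. \<sigma> * x) = density lborel (normal_density 0 \<sigma>)"
    by (simp add: distributed_def)
  moreover have "distr std_normal_distribution lborel (\<lambda>x. \<sigma> * x) = distr std_normal_distribution borel (\<lambda>x. \<sigma> * x)"
    by (intro distr_cong) auto
  ultimately show ?thesis using False by (simp add: centered_normal_def)
qed

lemma real_distribution_centered_normal:
  assumes "\<sigma> \<ge> 0"
  shows "real_distribution (centered_normal \<sigma>)"
proof -
  interpret prob_space std_normal_distribution by (rule real_distribution.axioms(1)[OF real_dist_normal_dist])
  show ?thesis unfolding centered_normal_eq_distr[OF assms] by (rule real_distribution_distr) simp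
qed

lemma char_scaled_std_normal:
  "char (distr std_normal_distribution borel (\<lambda>x. \<sigma> * x)) t = exp (- (\<sigma> * t)\<^sup>2 / 2)"
proof -
  have "char (distr std_normal_distribution borel (\<lambda>x. \<sigma> * x)) t = char std_normal_distribution (\<sigma> * t)"
    unfolding char_def by (subst integral_distr) (auto simp: mult_ac)
  also have "\<dots> = exp (- (\<sigma> * t)\<^sup>2 / 2)" by (simp add: char_std_normal_distribution)
  finally show ?thesis .
qed

lemma centered_normal_second_moment:
  assumes "\<sigma> \<ge> 0"
  shows "integrable (centered_normal \<sigma>) (\<lambda>x. x\<^sup>2)" "(\<integral>x. x\<^sup>2 \<partial>centered_normal \<sigma>) = \<sigma>\<^sup>2"
proof -
  have i: "integrable std_normal_distribution (\<lambda>x. x ^ 2)"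
    using std_normal_distribution_even_moments(2)[of 1] by simp
  have e: "(\<integral>x. x ^ 2 \<partial>std_normal_distribution) = 1"
    using std_normal_distribution_even_moments(1)[of 1] by (simp add: fact_numeral)
  show "integrable (centered_normal \<sigma>) (\<lambda>x. x\<^sup>2)"
    unfolding centered_normal_eq_distr[OF assms] using i
    by (subst integrable_distr_eq) (auto simp: power_mult_distrib)
  show "(\<integral>x. x\<^sup>2 \<partial>centered_normal \<sigma>) = \<sigma>\<^sup>2"
    unfolding centered_normal_eq_distr[OF assms] using e
    by (subst integral_distr) (auto simp: power_mult_distrib)
qed

section \<open>White noise and its linear images\<close>

abbreviation white_noise :: "(nat \<Rightarrow> real) measure" where
  "white_noise \<equiv> \<Pi>\<^sub>M m\<in>UNIV. std_normal_distribution"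

lemma product_prob_space_white_noise: "product_prob_space (\<lambda>_::nat. std_normal_distribution)"
proof -
  interpret N: prob_space std_normal_distribution by (rule real_distribution.axioms(1)[OF real_dist_normal_dist])
  show ?thesis by unfold_locales
qed

lemma sets_white_noise [measurable_cong]: "sets white_noise = sets (\<Pi>\<^sub>M m\<in>UNIV. borel)"
  by (intro sets_PiM_cong) auto

lemma prob_space_white_noise: "prob_space white_noise"
proof -
  interpret product_prob_space "\<lambda>_::nat. std_normal_distribution" UNIV
    by (rule product_prob_space_white_noise)
  show ?thesis by (rule P.prob_space_axioms)
qed

lemma indep_white_noise: "prob_space.indep_vars white_noise (\<lambda>_. borel) (\<lambda>m z. z m) UNIV"
proof -
  interpret product_prob_space "\<lambda>_::nat. std_normal_distribution" UNIV
    by (rule product_prob_space_white_noise)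
  have "distr white_noise (\<Pi>\<^sub>M m\<in>UNIV. borel) (\<lambda>x. \<lambda>i\<in>UNIV. x i) = white_noise"
    using distr_id2[OF sets_white_noise[symmetric]] by (simp only: restrict_UNIV)
  moreover have "distr white_noise borel (\<lambda>z. z m) = std_normal_distribution" for m
    using PiM_component[of m] by (simp cong: distr_cong)
  ultimately show ?thesis
    by (subst indep_vars_iff_distr_eq_PiM) auto
qed

text \<open>By independence the characteristic function is a product of Gaussian factors, whose
  exponents add up to that of the right-hand side; Levy's uniqueness theorem concludes.\<close>

lemma distr_white_noise_comb:
  "distr white_noise borel (\<lambda>z. \<Sum>m<N. b m * z m) = centered_normal (sqrt (\<Sum>m<N. (b m)\<^sup>2))"
proof -
  interpret P: prob_space white_noise by (rule prob_space_white_noise)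
  interpret product_prob_space "\<lambda>_::nat. std_normal_distribution" UNIV
    by (rule product_prob_space_white_noise)
  let ?\<sigma> = "sqrt (\<Sum>m<N. (b m)\<^sup>2)"
  have s0: "0 \<le> ?\<sigma>" by (simp add: sum_nonneg)
  have ind: "P.indep_vars (\<lambda>_. borel) (\<lambda>m z. b m * z m) {..<N}"
    by (rule P.indep_vars_compose2[OF P.indep_vars_subset[OF indep_white_noise], where Y = "\<lambda>m x. b m * x"]) auto
  have single: "char (distr white_noise borel (\<lambda>z. b m * z m)) t = exp (- (b m * t)\<^sup>2 / 2)" for m t
  proof -
    have "distr white_noise borel (\<lambda>z. b m * z m) =
        distr (distr white_noise std_normal_distribution (\<lambda>z. z m)) borel (\<lambda>x. b m * x)"
      by (subst distr_distr) (auto simp: comp_def)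
    also have "distr white_noise std_normal_distribution (\<lambda>z. z m) = std_normal_distribution"
      using PiM_component[of m] by simp
    finally show ?thesis by (simp add: char_scaled_std_normal)
  qed
  show ?thesis
  proof (rule Levy_uniqueness)
    show "real_distribution (distr white_noise borel (\<lambda>z. \<Sum>m<N. b m * z m))"
      by (rule P.real_distribution_distr) measurable
    show "real_distribution (centered_normal ?\<sigma>)" by (rule real_distribution_centered_normal[OF s0])
    show "char (distr white_noise borel (\<lambda>z. \<Sum>m<N. b m * z m)) = char (centered_normal ?\<sigma>)"
    proof
      fix t
      have "char (distr white_noise borel (\<lambda>z. \<Sum>m<N. b m * z m)) t = (\<Prod>m<N. complex_of_real (exp (- (b m * t)\<^sup>2 / 2)))"
        by (subst P.char_distr_sum[OF ind]) (simp only: single)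
      also have "\<dots> = complex_of_real (exp (\<Sum>m<N. - (b m * t)\<^sup>2 / 2))"
        by (simp only: exp_sum finite_lessThan of_real_prod)
      also have "(\<Sum>m<N. - (b m * t)\<^sup>2 / 2) = - (?\<sigma> * t)\<^sup>2 / 2"
        by (simp add: power_mult_distrib sum_nonneg sum_distrib_right sum_negf sum_divide_distrib)
      finally show "char (distr white_noise borel (\<lambda>z. \<Sum>m<N. b m * z m)) t = char (centered_normal ?\<sigma>) t"
        by (simp only: centered_normal_eq_distr[OF s0] char_scaled_std_normal)
    qed
  qed
qed

theorem centered_gaussian_law_exists:
  fixes V :: "'i::countable \<Rightarrow> 'i \<Rightarrow> real"
  assumes sym: "\<And>i j. i \<in> I \<Longrightarrow> j \<in> I \<Longrightarrow> V i j = V j i"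
    and pos: "\<And>F c. finite F \<Longrightarrow> F \<subseteq> I \<Longrightarrow> 0 \<le> (\<Sum>i\<in>F. \<Sum>j\<in>F. c i * c j * V i j)"
  obtains \<nu> where "centered_gaussian_law I V \<nu>"
    "\<And>F c. finite F \<Longrightarrow> F \<subseteq> I \<Longrightarrow>
      (\<integral>y. iexp (lin_comb F c y) \<partial>\<nu>) = complex_of_real (exp (- (\<Sum>i\<in>F. \<Sum>j\<in>F. c i * c j * V i j) / 2))"
proof -
  \<comment> \<open>The elimination runs through the whole type, so \<open>V\<close> is extended by
    0 outside \<open>I\<close>; this preserves positive semidefiniteness.\<close>
  define V' where "V' i j = (if i \<in> I \<and> j \<in> I then V i j else 0)" for i j
  have psd: "psd V'"
    unfolding psd_def
  proof (intro conjI allI impI)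
    fix F :: "'i set" and c :: "'i \<Rightarrow> real"
    assume F: "finite F"
    have "(\<Sum>i\<in>F. \<Sum>j\<in>F. c i * c j * V' i j) = (\<Sum>i\<in>F \<inter> I. \<Sum>j\<in>F \<inter> I. c i * c j * V i j)"
      using F by (intro sum.mono_neutral_cong_right sum.neutral) (auto simp: V'_def)
    then show "0 \<le> (\<Sum>i\<in>F. \<Sum>j\<in>F. c i * c j * V' i j)" using pos[of "F \<inter> I" c] F by simp
  qed (use sym in \<open>auto simp: V'_def\<close>)
  let ?L = "cholesky V'"
  define Y where "Y z = (\<lambda>i\<in>I. \<Sum>m<Suc (to_nat i). ?L i m * z m)" for z :: "nat \<Rightarrow> real"
  have Y [measurable]: "Y \<in> measurable white_noise (\<Pi>\<^sub>M i\<in>I. borel)"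
    unfolding Y_def by measurable
  interpret P: prob_space white_noise by (rule prob_space_white_noise)
  define \<nu> where "\<nu> = distr white_noise (\<Pi>\<^sub>M i\<in>I. borel) Y"
  interpret \<nu>: prob_space \<nu> unfolding \<nu>_def by (rule P.prob_space_distr) simp
  have distr: "distr \<nu> borel (lin_comb F c) = centered_normal (sqrt (\<Sum>i\<in>F. \<Sum>j\<in>F. c i * c j * V i j))"
    if F: "finite F" "F \<subseteq> I" for F c
  proof -
    obtain N where N: "\<And>i. i \<in> F \<Longrightarrow> to_nat i < N"
      using finite_nat_set_iff_bounded[of "to_nat ` F"] F by auto
    \<comment> \<open>The coefficients of the combination of \<open>Y\<close> in terms of the white
      noise. Their squares add up to the quadratic form of \<open>V\<close> because the factor times
      its transpose is \<open>V'\<close>.\<close>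
    define b where "b m = (\<Sum>i\<in>F. c i * ?L i m)" for m
    have Y_eq: "Y z i = (\<Sum>m<N. ?L i m * z m)" if "i \<in> F" for z i
    proof -
      have "(\<Sum>m<Suc (to_nat i). ?L i m * z m) = (\<Sum>m<N. ?L i m * z m)"
        using N[OF that] by (intro sum.mono_neutral_left) (auto simp: not_less Suc_le_eq cholesky_eq_0[OF psd])
      then show ?thesis using that F by (auto simp: Y_def)
    qed
    have "lin_comb F c (Y z) = (\<Sum>m<N. b m * z m)" for z
      unfolding lin_comb_def b_def sum_distrib_right
      by (subst sum.swap) (simp add: Y_eq sum_distrib_left mult_ac)
    moreover have "(\<Sum>m<N. (b m)\<^sup>2) = (\<Sum>i\<in>F. \<Sum>j\<in>F. c i * c j * V i j)"
    proof -
      have "(\<Sum>m<N. (b m)\<^sup>2) = (\<Sum>m<N. \<Sum>i\<in>F. \<Sum>j\<in>F. c i * c j * (?L i m * ?L j m))"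
        by (simp add: b_def power2_eq_square sum_product mult_ac)
      also have "\<dots> = (\<Sum>i\<in>F. \<Sum>j\<in>F. c i * c j * (\<Sum>m<N. ?L i m * ?L j m))"
        by (subst sum.swap, rule sum.cong[OF refl], subst sum.swap) (simp add: sum_distrib_left)
      also have "\<dots> = (\<Sum>i\<in>F. \<Sum>j\<in>F. c i * c j * V i j)"
        using F by (intro sum.cong refl) (auto simp: cholesky_product[OF psd N] V'_def)
      finally show ?thesis .
    qed
    moreover have "distr \<nu> borel (lin_comb F c) = distr white_noise borel (\<lambda>z. lin_comb F c (Y z))"
      unfolding \<nu>_def using borel_measurable_lin_comb[OF F(2)] by (subst distr_distr) (auto simp: comp_def)
    ultimately show ?thesis using distr_white_noise_comb[of b N] by simp
  qed
  have sets_\<nu>: "sets \<nu> = sets (\<Pi>\<^sub>M i\<in>I. (borel :: real measure))" by (simp add: \<nu>_def)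
  have lm: "lin_comb F c \<in> borel_measurable \<nu>" if "F \<subseteq> I" for F c
    by (subst measurable_cong_sets[OF sets_\<nu> refl]) (rule borel_measurable_lin_comb[OF that])
  have mom: "integrable \<nu> (\<lambda>y. (lin_comb F c y)\<^sup>2)"
    "(\<integral>y. (lin_comb F c y)\<^sup>2 \<partial>\<nu>) = (\<Sum>i\<in>F. \<Sum>j\<in>F. c i * c j * V i j)"
    if F: "finite F" "F \<subseteq> I" for F c
  proof -
    have s: "0 \<le> sqrt (\<Sum>i\<in>F. \<Sum>j\<in>F. c i * c j * V i j)" using pos[OF F] by simp
    have "integrable (distr \<nu> borel (lin_comb F c)) (\<lambda>x. x\<^sup>2)"
      unfolding distr[OF F] by (rule centered_normal_second_moment[OF s])
    then show "integrable \<nu> (\<lambda>y. (lin_comb F c y)\<^sup>2)"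
      by (subst (asm) integrable_distr_eq) (use lm[OF F(2)] in simp_all)
    have "(\<integral>x. x\<^sup>2 \<partial>distr \<nu> borel (lin_comb F c)) = (\<Sum>i\<in>F. \<Sum>j\<in>F. c i * c j * V i j)"
      unfolding distr[OF F] using centered_normal_second_moment[OF s] pos[OF F] by simp
    then show "(\<integral>y. (lin_comb F c y)\<^sup>2 \<partial>\<nu>) = (\<Sum>i\<in>F. \<Sum>j\<in>F. c i * c j * V i j)"
      by (subst (asm) integral_distr) (use lm[OF F(2)] in simp_all)
  qed
  show ?thesis
  proof (rule that)
    show "(\<integral>y. iexp (lin_comb F c y) \<partial>\<nu>) = complex_of_real (exp (- (\<Sum>i\<in>F. \<Sum>j\<in>F. c i * c j * V i j) / 2))"
      if F: "finite F" "F \<subseteq> I" for F c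
    proof -
      have s: "0 \<le> sqrt (\<Sum>i\<in>F. \<Sum>j\<in>F. c i * c j * V i j)" using pos[OF F] by simp
      have "(\<integral>y. iexp (lin_comb F c y) \<partial>\<nu>) = char (distr \<nu> borel (lin_comb F c)) 1"
        unfolding char_def by (subst integral_distr) (use lm[OF F(2)] in simp_all)
      also have "\<dots> = complex_of_real (exp (- (\<Sum>i\<in>F. \<Sum>j\<in>F. c i * c j * V i j) / 2))"
        unfolding distr[OF F] centered_normal_eq_distr[OF s] char_scaled_std_normal using pos[OF F, of c]
        by simp
      finally show ?thesis .
    qed
    show "centered_gaussian_law I V \<nu>"
      unfolding centered_gaussian_law_def
    proof (intro conjI allI impI ballI)
      show "prob_space \<nu>" by unfold_locales
      show "sets \<nu> = sets (\<Pi>\<^sub>M i\<in>I. (borel :: real measure))" by (rule sets_\<nu>)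
      show "\<exists>\<sigma>\<ge>0. distr \<nu> borel (\<lambda>y. \<Sum>i\<in>F. c i * y i) = centered_normal \<sigma>"
        if "finite F \<and> F \<subseteq> I" for F c
        using distr[of F c] that pos[of F c]
        by (intro exI[of _ "sqrt (\<Sum>i\<in>F. \<Sum>j\<in>F. c i * c j * V i j)"]) (simp add: lin_comb_def[abs_def])
    next
      fix i j assume ij: "i \<in> I" "j \<in> I"
      have *: "integrable \<nu> (\<lambda>y. y i * y j) \<and> (\<integral>y. y i * y j \<partial>\<nu>) = V i j"
      proof (cases "i = j")
        case True
        then show ?thesis using mom[of "{i}" "\<lambda>_. 1"] ij by (simp add: lin_comb_def power2_eq_square)
      next
        case False
        let ?p = "\<lambda>s y. (lin_comb {i, j} (\<lambda>k. if k = i then 1 else s) y)\<^sup>2"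
        \<comment> \<open>Polarization: a mixed moment comes from the second moments of the sum and
          of the difference. The set \<open>{i, j}\<close> has two elements here, which is why i = j
          is treated apart.\<close>
        have eq: "y i * y j = (?p 1 y - ?p (-1) y) / 4" for y
          using False by (simp add: lin_comb_def power2_eq_square algebra_simps)
        have m: "integrable \<nu> (?p s)" "(\<integral>y. ?p s y \<partial>\<nu>) = V i i + s * V i j + s * V j i + s * s * V j j" for s
          using mom[of "{i, j}" "\<lambda>k. if k = i then 1 else s"] ij False by simp_all
        have d: "integrable \<nu> (\<lambda>y. (?p s y - ?p t y) / 4)"
          "(\<integral>y. (?p s y - ?p t y) / 4 \<partial>\<nu>) = ((\<integral>y. ?p s y \<partial>\<nu>) - (\<integral>y. ?p t y \<partial>\<nu>)) / 4" for s t
          using m(1)[of s] m(1)[of t] by simp_all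
        show ?thesis unfolding eq d(2) m(2) using d(1)[of 1 "-1"] by (simp add: sym[OF ij])
      qed
      show "integrable \<nu> (\<lambda>y. y i * y j)" "(\<integral>y. y i * y j \<partial>\<nu>) = V i j" using * by auto
    qed
  qed
qed

section \<open>Convergence in probability\<close>

text \<open>Measurability is included because \<open>measure\<close> is 0 on nonmeasurable sets,
  which would make the second condition hold for the wrong reason.\<close>

definition tendsto_prob :: "'w measure \<Rightarrow> (nat \<Rightarrow> 'w \<Rightarrow> real) \<Rightarrow> real \<Rightarrow> bool" where
  "tendsto_prob Q X c \<longleftrightarrow> (\<forall>n. X n \<in> borel_measurable Q) \<and>
     (\<forall>e>0. (\<lambda>n. measure Q {\<omega> \<in> space Q. \<bar>X n \<omega> - c\<bar> > e}) \<longlonglongrightarrow> 0)"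

lemma tendsto_prob_measurable: "tendsto_prob Q X c \<Longrightarrow> X n \<in> borel_measurable Q"
  by (simp add: tendsto_prob_def)

lemma tendsto_probD:
  "tendsto_prob Q X c \<Longrightarrow> e > 0 \<Longrightarrow> (\<lambda>n. measure Q {\<omega> \<in> space Q. \<bar>X n \<omega> - c\<bar> > e}) \<longlonglongrightarrow> 0"
  by (simp add: tendsto_prob_def)

context prob_space
begin

lemma tendsto_prob_const: "tendsto_prob M (\<lambda>n \<omega>. c) c"
  by (simp add: tendsto_prob_def)

text \<open>The continuous mapping theorem with continuity at the limit point only. Hence it applies
  to functions such as \<open>inverse\<close>, whose composites are measurable but which are not
  continuous everywhere.\<close>

lemma tendsto_prob_cont2:
  assumes X: "tendsto_prob M X c" and Y: "tendsto_prob M Y d"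
    and meas: "\<And>n. (\<lambda>\<omega>. g (X n \<omega>, Y n \<omega>)) \<in> borel_measurable M"
    and cont: "isCont g (c, d)"
  shows "tendsto_prob M (\<lambda>n \<omega>. g (X n \<omega>, Y n \<omega>)) (g (c, d))"
  unfolding tendsto_prob_def
proof (intro conjI allI impI meas)
  fix e :: real assume e: "e > 0"
  note [measurable] = tendsto_prob_measurable[OF X] tendsto_prob_measurable[OF Y] meas
  obtain r where r: "r > 0" "\<And>z. dist z (c, d) < r \<Longrightarrow> dist (g z) (g (c, d)) < e"
    using cont e unfolding continuous_at_eps_delta by metis
  let ?A = "\<lambda>n. {\<omega> \<in> space M. \<bar>X n \<omega> - c\<bar> > r / 3}"
  let ?B = "\<lambda>n. {\<omega> \<in> space M. \<bar>Y n \<omega> - d\<bar> > r / 3}"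
  have lim: "(\<lambda>n. measure M (?A n) + measure M (?B n)) \<longlonglongrightarrow> 0 + 0"
    using r(1) by (intro tendsto_add tendsto_probD[OF X] tendsto_probD[OF Y]) auto
  show "(\<lambda>n. measure M {\<omega> \<in> space M. \<bar>g (X n \<omega>, Y n \<omega>) - g (c, d)\<bar> > e}) \<longlonglongrightarrow> 0"
  proof (rule tendsto_sandwich[OF _ _ tendsto_const lim[unfolded add_0_right]])
    have "measure M {\<omega> \<in> space M. \<bar>g (X n \<omega>, Y n \<omega>) - g (c, d)\<bar> > e} \<le> measure M (?A n \<union> ?B n)" for n
    proof (rule finite_measure_mono)
      show "{\<omega> \<in> space M. e < \<bar>g (X n \<omega>, Y n \<omega>) - g (c, d)\<bar>} \<subseteq> ?A n \<union> ?B n"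
      proof (rule subsetI, rule ccontr)
        fix \<omega> assume 1: "\<omega> \<in> {\<omega> \<in> space M. e < \<bar>g (X n \<omega>, Y n \<omega>) - g (c, d)\<bar>}"
          and "\<omega> \<notin> ?A n \<union> ?B n"
        then have 2: "\<bar>X n \<omega> - c\<bar> \<le> r / 3" "\<bar>Y n \<omega> - d\<bar> \<le> r / 3" by auto
        have "dist (X n \<omega>, Y n \<omega>) (c, d) < r"
        proof -
          have "dist (X n \<omega>, Y n \<omega>) (c, d) \<le> \<bar>X n \<omega> - c\<bar> + \<bar>Y n \<omega> - d\<bar>"
            using sqrt_sum_squares_le_sum_abs[of "X n \<omega> - c" "Y n \<omega> - d"] by (simp add: dist_Pair_Pair dist_real_def)
          with 2 r(1) show ?thesis by linarith
        qed
        from r(2)[OF this] 1 show False by (simp add: dist_real_def)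
      qed
    qed measurable
    moreover have "measure M (?A n \<union> ?B n) \<le> measure M (?A n) + measure M (?B n)" for n
      by (rule measure_Un_le) measurable
    ultimately show "\<forall>\<^sub>F n in sequentially. measure M {\<omega> \<in> space M. \<bar>g (X n \<omega>, Y n \<omega>) - g (c, d)\<bar> > e}
        \<le> measure M (?A n) + measure M (?B n)" by (intro always_eventually allI) (rule order_trans)
  qed simp
qed

lemma tendsto_prob_add:
  assumes "tendsto_prob M X c" "tendsto_prob M Y d"
  shows "tendsto_prob M (\<lambda>n \<omega>. X n \<omega> + Y n \<omega>) (c + d)"
  using tendsto_prob_cont2[OF assms, of "\<lambda>z. fst z + snd z"]
    tendsto_prob_measurable[OF assms(1)] tendsto_prob_measurable[OF assms(2)] by simp

lemma tendsto_prob_mult: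
  assumes "tendsto_prob M X c" "tendsto_prob M Y d"
  shows "tendsto_prob M (\<lambda>n \<omega>. X n \<omega> * Y n \<omega>) (c * d)"
  using tendsto_prob_cont2[OF assms, of "\<lambda>z. fst z * snd z"]
    tendsto_prob_measurable[OF assms(1)] tendsto_prob_measurable[OF assms(2)] by simp

lemma tendsto_prob_cont1:
  assumes "tendsto_prob M X c" "isCont g c" "g \<in> borel_measurable borel"
  shows "tendsto_prob M (\<lambda>n \<omega>. g (X n \<omega>)) (g c)"
  using tendsto_prob_cont2[OF assms(1,1), of "\<lambda>z. g (fst z)"]
    isCont_o2[of "(c, c)" fst g] assms(2)
    measurable_compose[OF tendsto_prob_measurable[OF assms(1)] assms(3)]
  by simp

lemma tendsto_prob_cmult: "tendsto_prob M X c \<Longrightarrow> tendsto_prob M (\<lambda>n \<omega>. a * X n \<omega>) (a * c)"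
  using tendsto_prob_mult[OF tendsto_prob_const] .

lemma tendsto_prob_diff:
  assumes "tendsto_prob M X c" "tendsto_prob M Y d"
  shows "tendsto_prob M (\<lambda>n \<omega>. X n \<omega> - Y n \<omega>) (c - d)"
  using tendsto_prob_add[OF assms(1) tendsto_prob_cmult[OF assms(2), of "-1"]] by simp

lemma tendsto_prob_sum:
  "(\<And>i. i \<in> A \<Longrightarrow> tendsto_prob M (X i) (c i)) \<Longrightarrow>
    tendsto_prob M (\<lambda>n \<omega>. \<Sum>i\<in>A. X i n \<omega>) (\<Sum>i\<in>A. c i)"
  by (induction A rule: infinite_finite_induct) (auto intro: tendsto_prob_const tendsto_prob_add)

lemma tendsto_prob_lim:
  assumes "(\<lambda>n. x n) \<longlonglongrightarrow> c"
  shows "tendsto_prob M (\<lambda>n \<omega>. x n) c"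
  unfolding tendsto_prob_def
proof (intro conjI allI impI)
  fix e :: real assume "e > 0"
  then have "eventually (\<lambda>n. \<not> \<bar>x n - c\<bar> > e) sequentially"
    by (intro eventually_mono[OF tendstoD[OF assms]]) (auto simp: dist_real_def)
  then show "(\<lambda>n. measure M {\<omega> \<in> space M. \<bar>x n - c\<bar> > e}) \<longlonglongrightarrow> 0"
    by (intro tendsto_eventually) (elim eventually_mono, simp)
qed simp

lemma tendsto_prob_cong:
  assumes Y: "tendsto_prob M Y c" and [measurable]: "\<And>n. X n \<in> borel_measurable M"
    and eq: "(\<lambda>n. measure M {\<omega> \<in> space M. X n \<omega> \<noteq> Y n \<omega>}) \<longlonglongrightarrow> 0"
  shows "tendsto_prob M X c"
  unfolding tendsto_prob_def
proof (intro conjI allI impI)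
  fix e :: real assume e: "e > 0"
  note [measurable] = tendsto_prob_measurable[OF Y]
  let ?A = "\<lambda>n. {\<omega> \<in> space M. X n \<omega> \<noteq> Y n \<omega>}"
  let ?B = "\<lambda>n. {\<omega> \<in> space M. \<bar>Y n \<omega> - c\<bar> > e}"
  have lim: "(\<lambda>n. measure M (?A n) + measure M (?B n)) \<longlonglongrightarrow> 0 + 0"
    using e by (intro tendsto_add tendsto_probD[OF Y] eq)
  have "measure M {\<omega> \<in> space M. \<bar>X n \<omega> - c\<bar> > e} \<le> measure M (?A n \<union> ?B n)" for n
    by (rule finite_measure_mono) auto
  moreover have "measure M (?A n \<union> ?B n) \<le> measure M (?A n) + measure M (?B n)" for n
    by (rule measure_Un_le) measurable
  ultimately have "measure M {\<omega> \<in> space M. \<bar>X n \<omega> - c\<bar> > e} \<le> measure M (?A n) + measure M (?B n)" for n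
    by (rule order_trans)
  then show "(\<lambda>n. measure M {\<omega> \<in> space M. \<bar>X n \<omega> - c\<bar> > e}) \<longlonglongrightarrow> 0"
    by (intro tendsto_sandwich[OF _ _ tendsto_const lim[unfolded add_0_right]]) auto
qed simp

lemma tendsto_prob_cong_AE:
  assumes Y: "tendsto_prob M Y c" and X: "\<And>n. X n \<in> borel_measurable M"
    and eq: "\<And>n. AE \<omega> in M. X n \<omega> = Y n \<omega>"
  shows "tendsto_prob M X c"
proof (rule tendsto_prob_cong[OF Y X])
  note [measurable] = tendsto_prob_measurable[OF Y] X
  have "measure M {\<omega> \<in> space M. X n \<omega> \<noteq> Y n \<omega>} = 0" for n
    using eq[of n] by (subst prob_eq_0) auto
  then show "(\<lambda>n. measure M {\<omega> \<in> space M. X n \<omega> \<noteq> Y n \<omega>}) \<longlonglongrightarrow> 0" by simp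
qed

text \<open>Markov's inequality. The integral with values in \<open>ennreal\<close> avoids a
  separate proof of integrability.\<close>

lemma tendsto_prob_if_nn_integral:
  assumes [measurable]: "\<And>n. X n \<in> borel_measurable M"
    and ev: "\<And>r. r > 0 \<Longrightarrow>
      eventually (\<lambda>n. (\<integral>\<^sup>+\<omega>. ennreal \<bar>X n \<omega> - c\<bar> \<partial>M) \<le> ennreal r) sequentially"
  shows "tendsto_prob M X c"
  unfolding tendsto_prob_def
proof (intro conjI allI impI)
  fix e :: real assume e: "e > 0"
  have le: "measure M {\<omega> \<in> space M. \<bar>X n \<omega> - c\<bar> > e} \<le> b / e"
    if b: "(\<integral>\<^sup>+\<omega>. ennreal \<bar>X n \<omega> - c\<bar> \<partial>M) \<le> ennreal b" "b \<ge> 0" for n b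
  proof -
    have 1: "emeasure M {\<omega> \<in> space M. \<bar>X n \<omega> - c\<bar> > e} \<le>
        emeasure M {\<omega> \<in> space M. 1 \<le> ennreal (1 / e) * ennreal \<bar>X n \<omega> - c\<bar>}"
    proof (rule emeasure_mono)
      show "{\<omega> \<in> space M. \<bar>X n \<omega> - c\<bar> > e} \<subseteq> {\<omega> \<in> space M. 1 \<le> ennreal (1 / e) * ennreal \<bar>X n \<omega> - c\<bar>}"
      proof safe
        fix \<omega> assume "e < \<bar>X n \<omega> - c\<bar>"
        then have "1 \<le> 1 / e * \<bar>X n \<omega> - c\<bar>" using e by simp
        then have "ennreal 1 \<le> ennreal (1 / e * \<bar>X n \<omega> - c\<bar>)" by (rule ennreal_leI)
        also have "\<dots> = ennreal (1 / e) * ennreal \<bar>X n \<omega> - c\<bar>" using e by (intro ennreal_mult) auto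
        finally show "1 \<le> ennreal (1 / e) * ennreal \<bar>X n \<omega> - c\<bar>" by simp
      qed
    qed measurable
    have 2: "(\<integral>\<^sup>+\<omega>. ennreal \<bar>X n \<omega> - c\<bar> * indicator (space M) \<omega> \<partial>M) \<le> ennreal b"
      by (rule order_trans[OF eq_refl b(1)]) (rule nn_integral_cong, simp)
    have 3: "emeasure M {\<omega> \<in> space M. 1 \<le> ennreal (1 / e) * ennreal \<bar>X n \<omega> - c\<bar>} \<le>
        ennreal (1 / e) * (\<integral>\<^sup>+\<omega>. ennreal \<bar>X n \<omega> - c\<bar> * indicator (space M) \<omega> \<partial>M)"
      by (rule nn_integral_Markov_inequality) auto
    have 4: "ennreal (1 / e) * ennreal b = ennreal (b / e)"
      using e b(2) by (subst ennreal_mult[symmetric]) auto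
    have "emeasure M {\<omega> \<in> space M. \<bar>X n \<omega> - c\<bar> > e} \<le> ennreal (b / e)"
      using order_trans[OF 1 order_trans[OF 3 mult_left_mono[OF 2]]] unfolding 4 by simp
    then have "ennreal (measure M {\<omega> \<in> space M. \<bar>X n \<omega> - c\<bar> > e}) \<le> ennreal (b / e)"
      unfolding emeasure_eq_measure .
    then show ?thesis by (rule ennreal_le_iff[THEN iffD1, rotated]) (use b(2) e in simp)
  qed
  show "(\<lambda>n. measure M {\<omega> \<in> space M. \<bar>X n \<omega> - c\<bar> > e}) \<longlonglongrightarrow> 0"
  proof (rule tendstoI)
    fix r :: real assume r: "r > 0"
    have "r * e / 2 > 0" using r e by simp
    from ev[OF this] show "\<forall>\<^sub>F n in sequentially. dist (measure M {\<omega> \<in> space M. \<bar>X n \<omega> - c\<bar> > e}) 0 < r"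
    proof (rule eventually_mono)
      fix n assume "(\<integral>\<^sup>+\<omega>. ennreal \<bar>X n \<omega> - c\<bar> \<partial>M) \<le> ennreal (r * e / 2)"
      from le[OF this] r e show "dist (measure M {\<omega> \<in> space M. \<bar>X n \<omega> - c\<bar> > e}) 0 < r" by simp
    qed
  qed
qed simp

lemma tight_rv_if_second_moment:
  assumes [measurable]: "\<And>n. Y n \<in> borel_measurable M"
    and int: "\<And>n. integrable M (\<lambda>\<omega>. (Y n \<omega>)\<^sup>2)" and bound: "\<And>n. (\<integral>\<omega>. (Y n \<omega>)\<^sup>2 \<partial>M) \<le> C"
  shows "tight_rv M Y"
  unfolding tight_rv_def
proof (intro allI impI)
  fix e :: real assume e: "e > 0"
  \<comment> \<open>The root makes C \<le> e a^2 for Chebyshev's inequality, and the summand 1 keeps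
    \<open>a\<close> positive when C = 0.\<close>
  define a where "a = sqrt (\<bar>C\<bar> / e) + 1"
  have a: "a > 0" by (simp add: a_def add_nonneg_pos e less_imp_le)
  have C: "C \<le> e * a\<^sup>2"
  proof -
    have "\<bar>C\<bar> / e = (sqrt (\<bar>C\<bar> / e))\<^sup>2" using e by simp
    also have "\<dots> \<le> a\<^sup>2" unfolding a_def using e by (intro power_mono) auto
    finally show ?thesis using e by (simp add: field_simps)
  qed
  have "measure M {\<omega> \<in> space M. \<bar>Y n \<omega>\<bar> > a} \<le> e" for n
  proof -
    have "measure M {\<omega> \<in> space M. \<bar>Y n \<omega>\<bar> > a} \<le> measure M {\<omega> \<in> space M. (Y n \<omega>)\<^sup>2 \<ge> a\<^sup>2}"
      using a by (intro finite_measure_mono) (auto simp: abs_le_square_iff[symmetric])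
    also have "\<dots> \<le> (\<integral>\<omega>. (Y n \<omega>)\<^sup>2 \<partial>M) / a\<^sup>2"
      using int a by (intro integral_Markov_inequality_measure[where A = "{}"]) auto
    also have "\<dots> \<le> e" using bound[of n] C a by (simp add: field_simps)
    finally show ?thesis .
  qed
  then show "\<exists>a. \<forall>n. measure M {\<omega> \<in> space M. \<bar>Y n \<omega>\<bar> > a} \<le> e" by blast
qed

text \<open>Slutsky's argument: a product larger than \<open>e\<close> needs \<bar>Y\<bar> > a,
  which is improbable uniformly in the index, or \<bar>X\<bar> > e / a, which is improbable
  eventually.\<close>

lemma tendsto_prob_mult_tight:
  assumes X: "tendsto_prob M X 0" and Y: "tight_rv M Y" and [measurable]: "\<And>n. Y n \<in> borel_measurable M"
  shows "tendsto_prob M (\<lambda>n \<omega>. X n \<omega> * Y n \<omega>) 0"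
  unfolding tendsto_prob_def
proof (intro conjI allI impI)
  note [measurable] = tendsto_prob_measurable[OF X]
  show "(\<lambda>\<omega>. X n \<omega> * Y n \<omega>) \<in> borel_measurable M" for n by simp
  fix e :: real assume e: "e > 0"
  show "(\<lambda>n. measure M {\<omega> \<in> space M. \<bar>X n \<omega> * Y n \<omega> - 0\<bar> > e}) \<longlonglongrightarrow> 0"
  proof (rule LIMSEQ_I)
    fix r :: real assume r: "r > 0"
    obtain a0 where a0: "\<And>n. measure M {\<omega> \<in> space M. \<bar>Y n \<omega>\<bar> > a0} \<le> r / 2"
      using Y r unfolding tight_rv_def by (meson half_gt_zero)
    define a where "a = max a0 1"
    have a: "a > 0" "a \<ge> a0" by (auto simp: a_def)
    let ?A = "\<lambda>n. {\<omega> \<in> space M. \<bar>X n \<omega> - 0\<bar> > e / a}"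
    let ?B = "\<lambda>n. {\<omega> \<in> space M. \<bar>Y n \<omega>\<bar> > a0}"
    have "(\<lambda>n. measure M (?A n)) \<longlonglongrightarrow> 0" using e a by (intro tendsto_probD[OF X]) simp
    from LIMSEQ_D[OF this, of "r / 2"] r obtain N where N: "\<And>n. n \<ge> N \<Longrightarrow> measure M (?A n) < r / 2"
      by auto
    have le: "measure M {\<omega> \<in> space M. \<bar>X n \<omega> * Y n \<omega> - 0\<bar> > e} \<le> measure M (?A n) + measure M (?B n)" for n
    proof -
      have "measure M {\<omega> \<in> space M. \<bar>X n \<omega> * Y n \<omega> - 0\<bar> > e} \<le> measure M (?A n \<union> ?B n)"
      proof (rule finite_measure_mono)
        show "{\<omega> \<in> space M. \<bar>X n \<omega> * Y n \<omega> - 0\<bar> > e} \<subseteq> ?A n \<union> ?B n"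
        proof (rule subsetI, rule ccontr)
          fix \<omega> assume 1: "\<omega> \<in> {\<omega> \<in> space M. \<bar>X n \<omega> * Y n \<omega> - 0\<bar> > e}" and "\<omega> \<notin> ?A n \<union> ?B n"
          then have "\<bar>X n \<omega>\<bar> \<le> e / a" "\<bar>Y n \<omega>\<bar> \<le> a" using a by auto
          then have "\<bar>X n \<omega>\<bar> * \<bar>Y n \<omega>\<bar> \<le> e / a * a" using e a by (intro mult_mono) auto
          with 1 a show False by (simp add: abs_mult)
        qed
      qed measurable
      also have "\<dots> \<le> measure M (?A n) + measure M (?B n)" by (rule measure_Un_le) measurable
      finally show ?thesis .
    qed
    have "norm (measure M {\<omega> \<in> space M. \<bar>X n \<omega> * Y n \<omega> - 0\<bar> > e} - 0) < r" if "n \<ge> N" for n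
      using le[of n] N[OF that] a0[of n] by simp
    then show "\<exists>no. \<forall>n\<ge>no. norm (measure M {\<omega> \<in> space M. \<bar>X n \<omega> * Y n \<omega> - 0\<bar> > e} - 0) < r" by blast
  qed
qed

lemma tendsto_prob_bounded_integral:
  assumes X: "tendsto_prob M X c" and bound: "\<And>n \<omega>. \<omega> \<in> space M \<Longrightarrow> \<bar>X n \<omega>\<bar> \<le> B"
  shows "(\<lambda>n. \<integral>\<omega>. \<bar>X n \<omega> - c\<bar> \<partial>M) \<longlonglongrightarrow> 0"
proof (rule LIMSEQ_I)
  fix r :: real assume r: "r > 0"
  note [measurable] = tendsto_prob_measurable[OF X]
  obtain \<omega>0 where "\<omega>0 \<in> space M" using not_empty by auto
  then have B: "0 \<le> B" using bound[of \<omega>0 0] by simp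
  define K where "K = B + \<bar>c\<bar>"
  have K: "\<bar>X n \<omega> - c\<bar> \<le> K" if "\<omega> \<in> space M" for n \<omega>
    using bound[OF that, of n] by (simp add: K_def)
  have K0: "K \<ge> 0" using B by (simp add: K_def)
  let ?A = "\<lambda>n. {\<omega> \<in> space M. \<bar>X n \<omega> - c\<bar> > r / 2}"
  have "(\<lambda>n. K * measure M (?A n)) \<longlonglongrightarrow> K * 0"
    using r by (intro tendsto_mult tendsto_const tendsto_probD[OF X]) auto
  from LIMSEQ_D[OF this, of "r / 2"] r K0 obtain N where N: "\<And>n. n \<ge> N \<Longrightarrow> K * measure M (?A n) < r / 2"
    by auto
  have le: "(\<integral>\<omega>. \<bar>X n \<omega> - c\<bar> \<partial>M) \<le> r / 2 + K * measure M (?A n)" for n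
  proof -
    have "(\<integral>\<omega>. \<bar>X n \<omega> - c\<bar> \<partial>M) \<le> (\<integral>\<omega>. r / 2 + K * indicator (?A n) \<omega> \<partial>M)"
    proof (rule integral_mono)
      show "integrable M (\<lambda>\<omega>. \<bar>X n \<omega> - c\<bar>)"
        by (rule integrable_const_bound[where B = K]) (auto simp: K)
      show "integrable M (\<lambda>\<omega>. r / 2 + K * indicator (?A n) \<omega>)"
        by (rule integrable_const_bound[where B = "r / 2 + K"]) (use r K0 in \<open>auto split: split_indicator\<close>)
      show "\<bar>X n \<omega> - c\<bar> \<le> r / 2 + K * indicator (?A n) \<omega>" if "\<omega> \<in> space M" for \<omega>
        using K[OF that, of n] r K0 that by (auto split: split_indicator)
    qed
    also have "\<dots> = r / 2 + K * measure M (?A n)"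
      by (subst Bochner_Integration.integral_add)
         (auto simp: prob_space intro!: integrable_const_bound[where B = 1])
    finally show ?thesis .
  qed
  have "norm ((\<integral>\<omega>. \<bar>X n \<omega> - c\<bar> \<partial>M) - 0) < r" if "n \<ge> N" for n
    using le[of n] N[OF that] by simp
  then show "\<exists>no. \<forall>n\<ge>no. norm ((\<integral>\<omega>. \<bar>X n \<omega> - c\<bar> \<partial>M) - 0) < r" by blast
qed

text \<open>The exponentials differ by at most the minimum of 2 and \<bar>X - Y\<bar>, a bounded
  continuous function of the difference, so its mean tends to 0.\<close>

lemma char_tendsto_prob_cong:
  assumes [measurable]: "\<And>n. X n \<in> borel_measurable M" "\<And>n. Y n \<in> borel_measurable M"
    and diff: "tendsto_prob M (\<lambda>n \<omega>. X n \<omega> - Y n \<omega>) 0"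
    and lim: "(\<lambda>n. \<integral>\<omega>. iexp (Y n \<omega>) \<partial>M) \<longlonglongrightarrow> L"
  shows "(\<lambda>n. \<integral>\<omega>. iexp (X n \<omega>) \<partial>M) \<longlonglongrightarrow> L"
proof -
  have iexp1: "cmod (iexp x - 1) \<le> min 2 \<bar>x\<bar>" for x
  proof -
    have "cmod (iexp x - 1) \<le> \<bar>x\<bar>" using iexp_approx1[of x 0] by simp
    moreover have "cmod (iexp x - 1) \<le> 2"
      using norm_triangle_ineq4[of "iexp x" 1] by simp
    ultimately show ?thesis by simp
  qed
  let ?g = "\<lambda>x::real. min 2 \<bar>x\<bar>"
  have "tendsto_prob M (\<lambda>n \<omega>. ?g (X n \<omega> - Y n \<omega>)) (?g 0)"
    by (rule tendsto_prob_cont1[OF diff]) (auto intro!: continuous_intros)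
  from tendsto_prob_bounded_integral[OF this, of 2]
  have g0: "(\<lambda>n. \<integral>\<omega>. ?g (X n \<omega> - Y n \<omega>) \<partial>M) \<longlonglongrightarrow> 0" by simp
  have le: "cmod ((\<integral>\<omega>. iexp (X n \<omega>) \<partial>M) - (\<integral>\<omega>. iexp (Y n \<omega>) \<partial>M)) \<le> (\<integral>\<omega>. ?g (X n \<omega> - Y n \<omega>) \<partial>M)" for n
  proof -
    have i: "integrable M (\<lambda>\<omega>. iexp (X n \<omega>))" "integrable M (\<lambda>\<omega>. iexp (Y n \<omega>))"
      by (auto intro!: integrable_const_bound[where B = 1])
    have "cmod ((\<integral>\<omega>. iexp (X n \<omega>) \<partial>M) - (\<integral>\<omega>. iexp (Y n \<omega>) \<partial>M)) = cmod (\<integral>\<omega>. iexp (X n \<omega>) - iexp (Y n \<omega>) \<partial>M)"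
      using i by simp
    also have "\<dots> \<le> (\<integral>\<omega>. cmod (iexp (X n \<omega>) - iexp (Y n \<omega>)) \<partial>M)" by (rule integral_norm_bound)
    also have "\<dots> \<le> (\<integral>\<omega>. ?g (X n \<omega> - Y n \<omega>) \<partial>M)"
    proof (rule integral_mono)
      show "integrable M (\<lambda>\<omega>. cmod (iexp (X n \<omega>) - iexp (Y n \<omega>)))" using i by auto
      show "integrable M (\<lambda>\<omega>. ?g (X n \<omega> - Y n \<omega>))"
        by (rule integrable_const_bound[where B = 2]) auto
      fix \<omega>
      have "iexp (X n \<omega>) - iexp (Y n \<omega>) = iexp (Y n \<omega>) * (iexp (X n \<omega> - Y n \<omega>) - 1)"
        by (simp add: right_diff_distrib exp_add[symmetric] algebra_simps)
      then have "cmod (iexp (X n \<omega>) - iexp (Y n \<omega>)) = cmod (iexp (X n \<omega> - Y n \<omega>) - 1)"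
        by (simp add: norm_mult)
      then show "cmod (iexp (X n \<omega>) - iexp (Y n \<omega>)) \<le> ?g (X n \<omega> - Y n \<omega>)"
        using iexp1[of "X n \<omega> - Y n \<omega>"] by metis
    qed
    finally show ?thesis .
  qed
  have "(\<lambda>n. (\<integral>\<omega>. iexp (X n \<omega>) \<partial>M) - (\<integral>\<omega>. iexp (Y n \<omega>) \<partial>M)) \<longlonglongrightarrow> 0"
    by (rule Lim_null_comparison[OF _ g0]) (use le in auto)
  from tendsto_add[OF this lim] show ?thesis by simp
qed

end

section \<open>Martingale sums along the paths of a Markov renewal chain\<close>

lemma integrable_pmf_bounded:
  fixes f :: "'b \<Rightarrow> 'c :: {banach, second_countable_topology}"
  assumes "\<And>x. x \<in> set_pmf p \<Longrightarrow> norm (f x) \<le> B"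
  shows "integrable (measure_pmf p) f"
  using assms by (intro measure_pmf.integrable_const_bound[where B = B]) (auto simp: AE_measure_pmf_iff)

lemma expectation_pmf_le:
  fixes f :: "'b \<Rightarrow> real"
  assumes "integrable (measure_pmf p) f" "\<And>x. x \<in> set_pmf p \<Longrightarrow> f x \<le> B"
  shows "(\<integral>x. f x \<partial>measure_pmf p) \<le> B"
  using assms by (intro measure_pmf.integral_le_const) (auto simp: AE_measure_pmf_iff)

lemma power2_le_if_abs_le: "\<bar>x\<bar> \<le> C \<Longrightarrow> x\<^sup>2 \<le> C\<^sup>2" for x C :: real
  by (intro abs_le_square_iff[THEN iffD1]) auto

lemma expectation_bind_pmf:
  fixes F :: "'b \<Rightarrow> real"
  assumes bound: "\<And>x. x \<in> set_pmf (bind_pmf p f) \<Longrightarrow> \<bar>F x\<bar> \<le> B"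
  shows "(\<integral>x. F x \<partial>measure_pmf (bind_pmf p f)) = (\<integral>a. (\<integral>x. F x \<partial>measure_pmf (f a)) \<partial>measure_pmf p)"
proof -
  \<comment> \<open>The bound is known on the support only, but the iterated integral theorem is
    applied to a globally bounded function; \<open>G\<close> changes \<open>F\<close> on a null set
    to get one.\<close>
  define G where "G x = (if x \<in> set_pmf (bind_pmf p f) then F x else 0)" for x
  have "0 \<le> B" using bound set_pmf_not_empty[of "bind_pmf p f"] by (metis abs_ge_zero all_not_in_conv order_trans)
  then have GB: "\<bar>G x\<bar> \<le> B" for x using bound by (simp add: G_def)
  have "(\<integral>x. F x \<partial>measure_pmf (bind_pmf p f)) = (\<integral>x. G x \<partial>measure_pmf (bind_pmf p f))"
    by (intro integral_cong_AE) (simp_all add: AE_measure_pmf_iff G_def)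
  also have "\<dots> = (\<integral>a. (\<integral>x. G x \<partial>measure_pmf (f a)) \<partial>measure_pmf p)"
    unfolding measure_pmf_bind
    by (rule integral_bind[where K = "count_space UNIV" and B' = 1 and B = B])
       (auto simp: GB measure_pmf.emeasure_space_1 measure_pmf_in_subprob_space intro!: measure_pmf.finite_measure_axioms)
  also have "\<dots> = (\<integral>a. (\<integral>x. F x \<partial>measure_pmf (f a)) \<partial>measure_pmf p)"
    by (intro integral_cong_AE) (auto simp: AE_measure_pmf_iff G_def intro!: integral_cong_AE)
  finally show ?thesis .
qed

lemma expectation_bind_pmf_complex:
  fixes F :: "'b \<Rightarrow> complex"
  assumes bound: "\<And>x. x \<in> set_pmf (bind_pmf p f) \<Longrightarrow> cmod (F x) \<le> B"
  shows "(\<integral>x. F x \<partial>measure_pmf (bind_pmf p f)) = (\<integral>a. (\<integral>x. F x \<partial>measure_pmf (f a)) \<partial>measure_pmf p)"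
proof -
  have i: "integrable (measure_pmf (bind_pmf p f)) F"
    by (rule measure_pmf.integrable_const_bound[where B = B]) (auto simp: AE_measure_pmf_iff bound)
  have ia: "integrable (measure_pmf (f a)) F" if "a \<in> set_pmf p" for a
    by (rule measure_pmf.integrable_const_bound[where B = B]) (use that in \<open>auto simp: AE_measure_pmf_iff intro!: bound\<close>)
  have nb: "cmod (\<integral>x. F x \<partial>measure_pmf (f a)) \<le> B" if "a \<in> set_pmf p" for a
  proof -
    have "cmod (\<integral>x. F x \<partial>measure_pmf (f a)) \<le> (\<integral>x. cmod (F x) \<partial>measure_pmf (f a))" by (rule integral_norm_bound)
    also have "\<dots> \<le> B"
      using ia[OF that] that by (intro measure_pmf.integral_le_const) (auto simp: AE_measure_pmf_iff intro!: bound)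
    finally show ?thesis .
  qed
  have io: "integrable (measure_pmf p) (\<lambda>a. \<integral>x. F x \<partial>measure_pmf (f a))"
    by (rule measure_pmf.integrable_const_bound[where B = B]) (auto simp: AE_measure_pmf_iff nb)
  have Re: "\<bar>Re (F x)\<bar> \<le> B" and Im: "\<bar>Im (F x)\<bar> \<le> B" if "x \<in> set_pmf (bind_pmf p f)" for x
    using abs_Re_le_cmod[of "F x"] abs_Im_le_cmod[of "F x"] bound[OF that] by linarith+
  show ?thesis
  proof (rule complex_eqI)
    have "Re (\<integral>x. F x \<partial>measure_pmf (bind_pmf p f)) = (\<integral>a. (\<integral>x. Re (F x) \<partial>measure_pmf (f a)) \<partial>measure_pmf p)"
      using integral_Re[OF i] expectation_bind_pmf[of p f "\<lambda>x. Re (F x)" B] Re by simp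
    also have "\<dots> = (\<integral>a. Re (\<integral>x. F x \<partial>measure_pmf (f a)) \<partial>measure_pmf p)"
      by (intro integral_cong_AE) (auto simp: AE_measure_pmf_iff ia)
    also have "\<dots> = Re (\<integral>a. (\<integral>x. F x \<partial>measure_pmf (f a)) \<partial>measure_pmf p)" using io by (rule integral_Re)
    finally show "Re (\<integral>x. F x \<partial>measure_pmf (bind_pmf p f)) = Re (\<integral>a. (\<integral>x. F x \<partial>measure_pmf (f a)) \<partial>measure_pmf p)" .
    have "Im (\<integral>x. F x \<partial>measure_pmf (bind_pmf p f)) = (\<integral>a. (\<integral>x. Im (F x) \<partial>measure_pmf (f a)) \<partial>measure_pmf p)"
      using integral_Im[OF i] expectation_bind_pmf[of p f "\<lambda>x. Im (F x)" B] Im by simp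
    also have "\<dots> = (\<integral>a. Im (\<integral>x. F x \<partial>measure_pmf (f a)) \<partial>measure_pmf p)"
      by (intro integral_cong_AE) (auto simp: AE_measure_pmf_iff ia)
    also have "\<dots> = Im (\<integral>a. (\<integral>x. F x \<partial>measure_pmf (f a)) \<partial>measure_pmf p)" using io by (rule integral_Im)
    finally show "Im (\<integral>x. F x \<partial>measure_pmf (bind_pmf p f)) = Im (\<integral>a. (\<integral>x. F x \<partial>measure_pmf (f a)) \<partial>measure_pmf p)" .
  qed
qed

text \<open>Histories are stored in reverse order: the head is the current state with its last sojourn time.\<close>

type_synonym 'e history = "('e \<times> nat) list"

abbreviation cur :: "'e history \<Rightarrow> 'e" where
  "cur h \<equiv> fst (hd h)"

abbreviation elapsed :: "'e history \<Rightarrow> nat" where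
  "elapsed h \<equiv> sum_list (map snd h)"

text \<open>The initial entry \<open>(i, 0)\<close> matches S 0 = 0 and the zero sojourn time at
  step 0, so \<open>elapsed\<close> is the time of the last jump recorded.\<close>

primrec path_pmf :: "('e \<Rightarrow> ('e \<times> nat) pmf) \<Rightarrow> 'e \<Rightarrow> nat \<Rightarrow> 'e history pmf" where
  "path_pmf K i 0 = return_pmf [(i, 0)]"
| "path_pmf K i (Suc n) = bind_pmf (path_pmf K i n) (\<lambda>h. map_pmf (\<lambda>y. y # h) (K (cur h)))"

lemma length_path: "h \<in> set_pmf (path_pmf K i n) \<Longrightarrow> length h = Suc n"
  by (induction n arbitrary: h) auto

lemma path_nonempty: "h \<in> set_pmf (path_pmf K i n) \<Longrightarrow> h \<noteq> []"
  using length_path by fastforce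

lemma last_path: "h \<in> set_pmf (path_pmf K i n) \<Longrightarrow> last h = (i, 0)"
  by (induction n arbitrary: h) (auto dest: path_nonempty)

text \<open>Only transitions that start at a time \<open>\<le> M\<close> count. The estimators also require the transition to
  end by time \<open>M\<close>, which removes exactly one term, but only the present sum is a stopped martingale
  for centred \<open>\<phi>\<close>.\<close>

primrec stop_sum :: "nat \<Rightarrow> ('e \<Rightarrow> 'e \<Rightarrow> nat \<Rightarrow> real) \<Rightarrow> 'e history \<Rightarrow> real" where
  "stop_sum M \<phi> [] = 0"
| "stop_sum M \<phi> (y # h) =
     (if h \<noteq> [] \<and> elapsed h \<le> M then \<phi> (cur h) (fst y) (snd y) else 0) + stop_sum M \<phi> h"

lemma stop_sum_cmult: "stop_sum M (\<lambda>i j k. c * \<phi> i j k) h = c * stop_sum M \<phi> h"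
  by (induction h) (auto simp: algebra_simps)

lemma stop_sum_add: "stop_sum M (\<lambda>i j k. \<phi> i j k + \<psi> i j k) h = stop_sum M \<phi> h + stop_sum M \<psi> h"
  by (induction h) auto

lemma stop_sum_diff: "stop_sum M (\<lambda>i j k. \<phi> i j k - \<psi> i j k) h = stop_sum M \<phi> h - stop_sum M \<psi> h"
  by (induction h) auto

lemma stop_sum_zero: "stop_sum M (\<lambda>i j k. 0) h = 0"
  by (induction h) auto

lemma stop_sum_sum: "stop_sum M (\<lambda>i j k. \<Sum>a\<in>A. \<phi> a i j k) h = (\<Sum>a\<in>A. stop_sum M (\<phi> a) h)"
  by (induction A rule: infinite_finite_induct) (auto simp: stop_sum_add stop_sum_zero)

lemma stop_sum_nonneg: "(\<And>i j k. 0 \<le> \<phi> i j k) \<Longrightarrow> 0 \<le> stop_sum M \<phi> h"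
  by (induction h) auto

lemma stop_sum_abs_le:
  assumes "\<And>i j k. \<bar>\<phi> i j k\<bar> \<le> C" "C \<ge> 0"
  shows "\<bar>stop_sum M \<phi> h\<bar> \<le> C * (length h - 1)"
proof (induction h)
  case (Cons y h)
  show ?case
  proof (cases "h = []")
    case False
    then have "length h \<ge> 1" by (cases h) auto
    have "\<bar>stop_sum M \<phi> (y # h)\<bar> \<le> C + C * (length h - 1)"
      using Cons assms(1)[of "cur h" "fst y" "snd y"] assms(2) by auto
    also have "\<dots> = C * (length (y # h) - 1)" using \<open>length h \<ge> 1\<close> by (simp add: of_nat_diff algebra_simps)
    finally show ?thesis .
  qed simp
qed simp

context
  fixes K :: "'e \<Rightarrow> ('e \<times> nat) pmf"
begin

lemma expectation_path_Suc:
  fixes F :: "'e history \<Rightarrow> real"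
  assumes "\<And>h. h \<in> set_pmf (path_pmf K i (Suc n)) \<Longrightarrow> \<bar>F h\<bar> \<le> B"
  shows "(\<integral>h. F h \<partial>path_pmf K i (Suc n)) = (\<integral>h. (\<integral>y. F (y # h) \<partial>K (cur h)) \<partial>path_pmf K i n)"
proof -
  have "(\<integral>h. F h \<partial>path_pmf K i (Suc n)) =
      (\<integral>h. (\<integral>x. F x \<partial>map_pmf (\<lambda>y. y # h) (K (cur h))) \<partial>path_pmf K i n)"
    unfolding path_pmf.simps by (rule expectation_bind_pmf[where B = B]) (use assms in simp)
  then show ?thesis by simp
qed

lemma expectation_path_Suc_complex:
  fixes F :: "'e history \<Rightarrow> complex"
  assumes "\<And>h. h \<in> set_pmf (path_pmf K i (Suc n)) \<Longrightarrow> cmod (F h) \<le> B"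
  shows "(\<integral>h. F h \<partial>path_pmf K i (Suc n)) = (\<integral>h. (\<integral>y. F (y # h) \<partial>K (cur h)) \<partial>path_pmf K i n)"
proof -
  have "(\<integral>h. F h \<partial>path_pmf K i (Suc n)) =
      (\<integral>h. (\<integral>x. F x \<partial>map_pmf (\<lambda>y. y # h) (K (cur h))) \<partial>path_pmf K i n)"
    unfolding path_pmf.simps by (rule expectation_bind_pmf_complex[where B = B]) (use assms in simp)
  then show ?thesis by simp
qed

lemma nn_integral_path_Suc:
  "(\<integral>\<^sup>+h. F h \<partial>path_pmf K i (Suc n)) = (\<integral>\<^sup>+h. (\<integral>\<^sup>+y. F (y # h) \<partial>K (cur h)) \<partial>path_pmf K i n)"
  by simp

text \<open>One step adds at most \<open>c\<close> in mean. Integrals in \<open>ennreal\<close>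
  admit unbounded terms, here the sojourn times above the truncation level.\<close>

lemma nn_integral_stop_sum_le:
  assumes nonneg: "\<And>i j k. 0 \<le> \<phi> i j k"
    and c: "\<And>i. (\<integral>\<^sup>+y. ennreal (\<phi> i (fst y) (snd y)) \<partial>K i) \<le> ennreal c"
  shows "(\<integral>\<^sup>+h. ennreal (stop_sum M \<phi> h) \<partial>path_pmf K i n) \<le> of_nat n * ennreal c"
proof (induction n)
  case (Suc n)
  have "(\<integral>\<^sup>+h. ennreal (stop_sum M \<phi> h) \<partial>path_pmf K i (Suc n)) =
      (\<integral>\<^sup>+h. (\<integral>\<^sup>+y. ennreal (stop_sum M \<phi> (y # h)) \<partial>K (cur h)) \<partial>path_pmf K i n)"
    by (rule nn_integral_path_Suc)
  also have "\<dots> \<le> (\<integral>\<^sup>+h. ennreal c + ennreal (stop_sum M \<phi> h) \<partial>path_pmf K i n)"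
  proof (rule nn_integral_mono)
    fix h
    have "(\<integral>\<^sup>+y. ennreal (stop_sum M \<phi> (y # h)) \<partial>K (cur h)) \<le>
        (\<integral>\<^sup>+y. ennreal (\<phi> (cur h) (fst y) (snd y)) + ennreal (stop_sum M \<phi> h) \<partial>K (cur h))"
      using nonneg stop_sum_nonneg[of \<phi> M h]
      by (intro nn_integral_mono) (auto simp: ennreal_plus[symmetric] simp del: ennreal_plus intro!: ennreal_leI)
    also have "\<dots> = (\<integral>\<^sup>+y. ennreal (\<phi> (cur h) (fst y) (snd y)) \<partial>K (cur h)) + ennreal (stop_sum M \<phi> h)"
      by (subst nn_integral_add) (auto simp: measure_pmf.emeasure_space_1)
    also have "\<dots> \<le> ennreal c + ennreal (stop_sum M \<phi> h)" by (intro add_right_mono c)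
    finally show "(\<integral>\<^sup>+y. ennreal (stop_sum M \<phi> (y # h)) \<partial>K (cur h)) \<le> ennreal c + ennreal (stop_sum M \<phi> h)" .
  qed
  also have "\<dots> = ennreal c + (\<integral>\<^sup>+h. ennreal (stop_sum M \<phi> h) \<partial>path_pmf K i n)"
    by (subst nn_integral_add) (auto simp: measure_pmf.emeasure_space_1)
  also have "\<dots> \<le> ennreal c + of_nat n * ennreal c" by (intro add_left_mono Suc.IH)
  also have "\<dots> = of_nat (Suc n) * ennreal c" by (simp add: algebra_simps)
  finally show ?case .
qed simp

text \<open>Orthogonality of martingale increments: whether a step counts is decided by the history
  before it, so the cross term vanishes for centred increments and a step adds at most
  \<open>C\<^sup>2\<close>.\<close>

lemma stop_sum_second_moment:
  assumes bound: "\<And>i j k. \<bar>\<phi> i j k\<bar> \<le> C"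
    and centred: "\<And>i. (\<integral>y. \<phi> i (fst y) (snd y) \<partial>K i) = 0"
  shows "(\<integral>h. (stop_sum M \<phi> h)\<^sup>2 \<partial>path_pmf K i n) \<le> real n * C\<^sup>2"
proof (induction n)
  case (Suc n)
  have C: "0 \<le> C" using bound[of undefined undefined undefined] by linarith
  have b: "(stop_sum M \<phi> h)\<^sup>2 \<le> (C * real n)\<^sup>2" if "h \<in> set_pmf (path_pmf K i n)" for h n
    using stop_sum_abs_le[of \<phi> C M h, OF bound C] length_path[OF that]
    by (intro power2_le_if_abs_le) simp
  have "(\<integral>h. (stop_sum M \<phi> h)\<^sup>2 \<partial>path_pmf K i (Suc n)) =
      (\<integral>h. (\<integral>y. (stop_sum M \<phi> (y # h))\<^sup>2 \<partial>K (cur h)) \<partial>path_pmf K i n)"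
    by (rule expectation_path_Suc[where B = "(C * real (Suc n))\<^sup>2"]) (use b[of _ "Suc n"] in simp)
  also have "\<dots> \<le> (\<integral>h. C\<^sup>2 + (stop_sum M \<phi> h)\<^sup>2 \<partial>path_pmf K i n)"
  proof -
    have *: "(\<integral>y. (stop_sum M \<phi> (y # h))\<^sup>2 \<partial>K (cur h)) \<le> C\<^sup>2 + (stop_sum M \<phi> h)\<^sup>2" for h
    proof (cases "h \<noteq> [] \<and> elapsed h \<le> M")
      case True
      let ?f = "\<lambda>y. \<phi> (cur h) (fst y) (snd y)" and ?a = "stop_sum M \<phi> h"
      have i: "integrable (K (cur h)) ?f" "integrable (K (cur h)) (\<lambda>y. (?f y)\<^sup>2)"
        using bound by (intro integrable_pmf_bounded[where B = C], simp)
          (intro integrable_pmf_bounded[where B = "C\<^sup>2"], simp add: power2_le_if_abs_le bound)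
      have "(\<integral>y. (stop_sum M \<phi> (y # h))\<^sup>2 \<partial>K (cur h)) = (\<integral>y. (?f y)\<^sup>2 + 2 * ?a * ?f y + ?a\<^sup>2 \<partial>K (cur h))"
        using True by (intro Bochner_Integration.integral_cong refl) (simp add: power2_eq_square algebra_simps)
      also have "\<dots> = (\<integral>y. (?f y)\<^sup>2 \<partial>K (cur h)) + 2 * ?a * (\<integral>y. ?f y \<partial>K (cur h)) + ?a\<^sup>2"
        using i by simp
      also have "\<dots> \<le> C\<^sup>2 + ?a\<^sup>2"
        unfolding centred by (simp, intro expectation_pmf_le i(2) power2_le_if_abs_le bound)
      finally show ?thesis .
    next
      case False
      then have "stop_sum M \<phi> (y # h) = stop_sum M \<phi> h" for y by auto
      then show ?thesis by simp
    qed
    have i: "integrable (path_pmf K i n) (\<lambda>h. (stop_sum M \<phi> h)\<^sup>2)"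
      by (rule measure_pmf.integrable_const_bound[where B = "(C * real n)\<^sup>2"]) (auto simp: AE_measure_pmf_iff b)
    show ?thesis
    proof (rule integral_mono)
      show "integrable (path_pmf K i n) (\<lambda>h. \<integral>y. (stop_sum M \<phi> (y # h))\<^sup>2 \<partial>K (cur h))"
      proof (rule measure_pmf.integrable_const_bound[where B = "C\<^sup>2 + (C * real n)\<^sup>2"])
        show "AE h in path_pmf K i n. norm (\<integral>y. (stop_sum M \<phi> (y # h))\<^sup>2 \<partial>K (cur h)) \<le> C\<^sup>2 + (C * real n)\<^sup>2"
          unfolding AE_measure_pmf_iff
        proof
          fix h assume h: "h \<in> set_pmf (path_pmf K i n)"
          have "0 \<le> (\<integral>y. (stop_sum M \<phi> (y # h))\<^sup>2 \<partial>K (cur h))" by (intro integral_nonneg_AE) auto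
          then show "norm (\<integral>y. (stop_sum M \<phi> (y # h))\<^sup>2 \<partial>K (cur h)) \<le> C\<^sup>2 + (C * real n)\<^sup>2"
            using *[of h] b[OF h] by (simp del: stop_sum.simps)
        qed
      qed simp
    qed (use i * in simp_all)
  qed
  also have "\<dots> = C\<^sup>2 + (\<integral>h. (stop_sum M \<phi> h)\<^sup>2 \<partial>path_pmf K i n)"
    by (subst Bochner_Integration.integral_add)
       (auto intro!: measure_pmf.integrable_const_bound[where B = "(C * real n)\<^sup>2"] simp: AE_measure_pmf_iff b)
  also have "\<dots> \<le> real (Suc n) * C\<^sup>2" using Suc by (simp add: algebra_simps)
  finally show ?case .
qed simp

text \<open>With a = s^2 v / 2, a second-order Taylor expansion gives the mean of the exponential as
  1 - a up to (s C)^3. The constant 6 is 2 + 4: the first error is multiplied by exp a \<le> 2, the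
  second comes from the product (1 - a) exp a.\<close>

lemma char_step_error:
  assumes bound: "\<And>y. \<bar>f y\<bar> \<le> C" and centred: "(\<integral>y. f y \<partial>measure_pmf p) = 0"
    and var: "(\<integral>y. (f y)\<^sup>2 \<partial>measure_pmf p) = v" and s: "0 \<le> s" "s * C \<le> 1"
  shows "cmod ((\<integral>y. iexp (s * f y) \<partial>measure_pmf p) * exp (complex_of_real (s\<^sup>2 * v / 2)) - 1) \<le> 6 * (s * C) ^ 3"
proof -
  have C: "0 \<le> C" using bound[of undefined] by linarith
  have i: "integrable p f" "integrable p (\<lambda>y. (f y)\<^sup>2)" "integrable p (\<lambda>y. iexp (s * f y))"
    by (rule integrable_pmf_bounded[where B = C], simp add: bound)
      (rule integrable_pmf_bounded[where B = "C\<^sup>2"], simp add: power2_le_if_abs_le bound,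
       rule integrable_pmf_bounded[where B = 1], simp)
  have v: "0 \<le> v" "v \<le> C\<^sup>2"
    unfolding var[symmetric]
    by (intro integral_nonneg_AE, simp, intro expectation_pmf_le i(2) power2_le_if_abs_le bound)
  define a where "a = s\<^sup>2 * v / 2"
  have a: "0 \<le> a" "2 * a \<le> (s * C)\<^sup>2"
    using v by (auto simp: a_def power_mult_distrib mult_left_mono)
  have sC: "0 \<le> s * C" using s C by simp
  have sC2: "(s * C)\<^sup>2 \<le> 1" using s sC by (simp add: power_le_one)
  have a1: "a \<le> 1 / 2" using a sC2 by linarith
  define E where "E = (\<integral>y. iexp (s * f y) \<partial>measure_pmf p)"
  have pt: "cmod (iexp (s * f y) - (1 + \<i> * (s * f y) - (s * f y)\<^sup>2 / 2)) \<le> (s * C) ^ 3" for y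
  proof -
    have "cmod (iexp (s * f y) - (\<Sum>k\<le>2. (\<i> * (s * f y)) ^ k / fact k)) \<le> \<bar>s * f y\<bar> ^ 3 / fact 3"
      using iexp_approx1[of "s * f y" 2] by (simp add: numeral_3_eq_3 numeral_2_eq_2)
    also have "(\<Sum>k\<le>2. (\<i> * complex_of_real (s * f y)) ^ k / fact k) = 1 + \<i> * (s * f y) - (s * f y)\<^sup>2 / 2"
      by (simp add: numeral_2_eq_2 power2_eq_square algebra_simps)
    also have "\<bar>s * f y\<bar> ^ 3 / fact 3 \<le> \<bar>s * f y\<bar> ^ 3"
      by (simp add: fact_numeral)
    also have "\<dots> \<le> (s * C) ^ 3"
      using bound[of y] s by (intro power_mono) (auto simp: abs_mult intro!: mult_left_mono)
    finally show ?thesis by simp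
  qed
  have "E - (1 - a) = (\<integral>y. iexp (s * f y) - (1 + \<i> * (s * f y) - (s * f y)\<^sup>2 / 2) \<partial>measure_pmf p)"
  proof -
    have "(\<integral>y. \<i> * complex_of_real (s * f y) \<partial>measure_pmf p) = 0"
      using i(1) centred by simp
    moreover have "(\<integral>y. complex_of_real ((s * f y)\<^sup>2 / 2) \<partial>measure_pmf p) = complex_of_real a"
      using i(2) var by (subst integral_complex_of_real) (simp add: power_mult_distrib a_def)
    moreover have "integrable p (\<lambda>y. \<i> * complex_of_real (s * f y))"
      "integrable p (\<lambda>y. complex_of_real ((s * f y)\<^sup>2 / 2))"
      using i(1,2) by (simp_all add: power_mult_distrib del: of_real_power of_real_divide)
    ultimately show ?thesis
      using i(3) by (simp add: E_def)
  qed
  then have "cmod (E - (1 - a)) \<le> (\<integral>y. cmod (iexp (s * f y) - (1 + \<i> * (s * f y) - (s * f y)\<^sup>2 / 2)) \<partial>measure_pmf p)"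
    by (simp only: integral_norm_bound)
  also have "\<dots> \<le> (s * C) ^ 3"
    by (intro expectation_pmf_le integrable_pmf_bounded[where B = "(s * C) ^ 3"])
       (simp_all only: real_norm_def abs_norm_cancel pt)
  finally have E: "cmod (E - (1 - a)) \<le> (s * C) ^ 3" .
  have ea: "exp a \<le> 2"
  proof -
    have "exp a \<le> exp (1 / 2)" using a1 by simp
    also have "\<dots> \<le> 1 + 1 / 2 + (1 / 2)\<^sup>2" by (rule exp_bound) auto
    finally show ?thesis by (simp add: power2_eq_square)
  qed
  \<comment> \<open>The inequality 1 + x \<le> exp x at -a and at a yields 1 - a^2 \<le> (1 - a) exp
    a \<le> 1, and 2 a is at most (s C)^2.\<close>
  have r: "\<bar>(1 - a) * exp a - 1\<bar> \<le> 4 * (s * C) ^ 3"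
  proof -
    have "(1 - a) * exp a \<le> exp (- a) * exp a" using exp_ge_add_one_self[of "- a"] by (intro mult_right_mono) auto
    then have 1: "(1 - a) * exp a \<le> 1" by (simp add: exp_minus)
    have "(1 - a) * (1 + a) \<le> (1 - a) * exp a" using a1 exp_ge_add_one_self[of a] by (intro mult_left_mono) auto
    then have 2: "1 - a * a \<le> (1 - a) * exp a" by (simp add: algebra_simps)
    have "a * a \<le> (s * C)\<^sup>2 * (s * C)\<^sup>2" using a by (intro mult_mono) auto
    also have "\<dots> = (s * C) ^ 3 * (s * C)" by (simp add: power2_eq_square power3_eq_cube)
    also have "\<dots> \<le> (s * C) ^ 3" using sC s by (intro mult_left_le) auto
    finally show ?thesis using 1 2 sC by (smt (verit) zero_le_power)
  qed
  have "E * exp (complex_of_real a) - 1 = (E - (1 - a)) * exp (complex_of_real a) + complex_of_real ((1 - a) * exp a - 1)"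
    by (simp add: algebra_simps exp_of_real)
  then have "cmod (E * exp (complex_of_real a) - 1) \<le>
      cmod ((E - (1 - a)) * exp (complex_of_real a)) + cmod (complex_of_real ((1 - a) * exp a - 1))"
    by (metis norm_triangle_ineq)
  also have "\<dots> = cmod (E - (1 - a)) * exp a + \<bar>(1 - a) * exp a - 1\<bar>"
    by (simp only: norm_mult norm_exp_eq_Re norm_of_real Re_complex_of_real)
  also have "\<dots> \<le> (s * C) ^ 3 * 2 + 4 * (s * C) ^ 3"
    using E ea r sC by (intro add_mono mult_mono) auto
  finally show ?thesis by (simp add: E_def a_def)
qed

text \<open>Given the history \<open>h\<close>, the compensated exponential is multiplied in mean by
  1 + \<open>e h\<close>, with the one-step error \<open>e h\<close> of
  \<open>char_step_error\<close>. Since the modulus of the product stays below the exponential in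
  the bound, the errors simply add up.\<close>

lemma stop_sum_char:
  assumes bound: "\<And>i j k. \<bar>\<phi> i j k\<bar> \<le> C"
    and centred: "\<And>i. (\<integral>y. \<phi> i (fst y) (snd y) \<partial>K i) = 0"
    and var: "\<And>i. (\<integral>y. (\<phi> i (fst y) (snd y))\<^sup>2 \<partial>K i) = v i"
    and s: "0 \<le> s" "s * C \<le> 1"
  shows "cmod ((\<integral>h. iexp (s * stop_sum M \<phi> h) *
      exp (complex_of_real (s\<^sup>2 * stop_sum M (\<lambda>i j k. v i) h / 2)) \<partial>path_pmf K i0 n) - 1)
    \<le> real n * (6 * (s * C) ^ 3 * exp (real n * (s * C)\<^sup>2))"
proof (induction n)
  case 0
  then show ?case by simp
next
  case (Suc n)
  let ?V = "\<lambda>h. stop_sum M (\<lambda>i j k. v i) h"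
  let ?G = "\<lambda>h. iexp (s * stop_sum M \<phi> h) * exp (complex_of_real (s\<^sup>2 * ?V h / 2))"
  have C: "0 \<le> C" using bound[of undefined undefined undefined] by linarith
  have i2: "integrable (K i) (\<lambda>y. (\<phi> i (fst y) (snd y))\<^sup>2)" for i
    by (rule integrable_pmf_bounded[where B = "C\<^sup>2"]) (simp add: power2_le_if_abs_le bound)
  have v: "0 \<le> v i" "v i \<le> C\<^sup>2" for i
    unfolding var[symmetric]
    by (intro integral_nonneg_AE, simp, intro expectation_pmf_le i2 power2_le_if_abs_le bound)
  have normG: "cmod (?G h) \<le> exp (real n * (s * C)\<^sup>2)" if h: "h \<in> set_pmf (path_pmf K i0 n)" for h n
  proof -
    have "\<bar>?V h\<bar> \<le> C\<^sup>2 * (length h - 1)" by (rule stop_sum_abs_le) (use v in auto)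
    then have "?V h \<le> C\<^sup>2 * real n" "0 \<le> ?V h"
      using length_path[OF h] v by (auto intro: stop_sum_nonneg)
    then have "s\<^sup>2 * ?V h / 2 \<le> s\<^sup>2 * (C\<^sup>2 * real n)"
      by (intro order_trans[OF _ mult_left_mono[of "?V h" "C\<^sup>2 * real n" "s\<^sup>2"]]) auto
    also have "\<dots> = real n * (s * C)\<^sup>2" by (simp add: power_mult_distrib)
    finally have "exp (s\<^sup>2 * ?V h / 2) \<le> exp (real n * (s * C)\<^sup>2)" by simp
    moreover have "cmod (?G h) = exp (s\<^sup>2 * ?V h / 2)"
      by (simp add: norm_mult)
    ultimately show ?thesis by simp
  qed
  have iG: "integrable (path_pmf K i0 n) ?G"
    by (rule integrable_pmf_bounded[where B = "exp (real n * (s * C)\<^sup>2)"]) (rule normG)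
  \<comment> \<open>Once time \<open>M\<close> has been passed, the sum and its conditional variance
    are frozen together, so the step is exact.\<close>
  define e where "e h = (if h \<noteq> [] \<and> elapsed h \<le> M
      then (\<integral>y. iexp (s * \<phi> (cur h) (fst y) (snd y)) \<partial>K (cur h)) * exp (complex_of_real (s\<^sup>2 * v (cur h) / 2)) - 1
      else 0)" for h
  have e: "cmod (e h) \<le> 6 * (s * C) ^ 3" for h
    unfolding e_def using char_step_error[OF bound centred var s, of "cur h"] s C by auto
  have step: "(\<integral>y. ?G (y # h) \<partial>K (cur h)) = ?G h + ?G h * e h" for h
  proof (cases "h \<noteq> [] \<and> elapsed h \<le> M")
    case True
    have "?G (y # h) = ?G h * exp (complex_of_real (s\<^sup>2 * v (cur h) / 2)) * iexp (s * \<phi> (cur h) (fst y) (snd y))" for y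
      using True by (simp add: exp_add[symmetric] algebra_simps add_divide_distrib)
    then have int: "(\<integral>y. ?G (y # h) \<partial>K (cur h)) =
        ?G h * exp (complex_of_real (s\<^sup>2 * v (cur h) / 2)) * (\<integral>y. iexp (s * \<phi> (cur h) (fst y) (snd y)) \<partial>K (cur h))"
      by (simp only: integral_mult_right_zero)
    have eh: "e h = (\<integral>y. iexp (s * \<phi> (cur h) (fst y) (snd y)) \<partial>K (cur h)) *
        exp (complex_of_real (s\<^sup>2 * v (cur h) / 2)) - 1"
      using True by (simp add: e_def)
    have alg: "a * x * z = a + a * (z * x - 1)" for a x z :: complex by (simp add: algebra_simps)
    show ?thesis unfolding int eh by (rule alg)
  next
    case False
    then have G: "?G (y # h) = ?G h" for y by auto
    have eh: "e h = 0" using False by (auto simp: e_def)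
    show ?thesis unfolding G eh by simp
  qed
  have ie: "integrable (path_pmf K i0 n) (\<lambda>h. ?G h * e h)"
    by (rule integrable_pmf_bounded[where B = "exp (real n * (s * C)\<^sup>2) * (6 * (s * C) ^ 3)"])
       (unfold norm_mult[of "?G _"], intro mult_mono normG e, auto)
  have "(\<integral>h. ?G h \<partial>path_pmf K i0 (Suc n)) = (\<integral>h. (\<integral>y. ?G (y # h) \<partial>K (cur h)) \<partial>path_pmf K i0 n)"
    by (rule expectation_path_Suc_complex[OF normG])
  also have "\<dots> = (\<integral>h. ?G h + ?G h * e h \<partial>path_pmf K i0 n)" by (simp only: step)
  also have "\<dots> = (\<integral>h. ?G h \<partial>path_pmf K i0 n) + (\<integral>h. ?G h * e h \<partial>path_pmf K i0 n)"
    by (rule Bochner_Integration.integral_add[OF iG ie])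
  finally have "(\<integral>h. ?G h \<partial>path_pmf K i0 (Suc n)) - 1 =
      ((\<integral>h. ?G h \<partial>path_pmf K i0 n) - 1) + (\<integral>h. ?G h * e h \<partial>path_pmf K i0 n)" by simp
  then have "cmod ((\<integral>h. ?G h \<partial>path_pmf K i0 (Suc n)) - 1) \<le>
      cmod ((\<integral>h. ?G h \<partial>path_pmf K i0 n) - 1) + cmod (\<integral>h. ?G h * e h \<partial>path_pmf K i0 n)"
    by (simp only: norm_triangle_ineq)
  also have "cmod (\<integral>h. ?G h * e h \<partial>path_pmf K i0 n) \<le> (\<integral>h. cmod (?G h * e h) \<partial>path_pmf K i0 n)"
    by (rule integral_norm_bound)
  also have "(\<integral>h. cmod (?G h * e h) \<partial>path_pmf K i0 n) \<le> exp (real n * (s * C)\<^sup>2) * (6 * (s * C) ^ 3)"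
    by (rule expectation_pmf_le[OF integrable_norm[OF ie]])
       (unfold norm_mult[of "?G _"], intro mult_mono normG e, auto)
  also have "cmod ((\<integral>h. ?G h \<partial>path_pmf K i0 n) - 1) + exp (real n * (s * C)\<^sup>2) * (6 * (s * C) ^ 3)
     \<le> real n * (6 * (s * C) ^ 3 * exp (real n * (s * C)\<^sup>2)) + exp (real n * (s * C)\<^sup>2) * (6 * (s * C) ^ 3)"
    by (rule add_right_mono[OF Suc])
  also have "\<dots> = real (Suc n) * (6 * (s * C) ^ 3 * exp (real n * (s * C)\<^sup>2))"
    by (simp add: algebra_simps)
  \<comment> \<open>The exponent is enlarged from \<open>n\<close> to \<open>Suc n\<close> to match
    the shape of the claim.\<close>
  also have "\<dots> \<le> real (Suc n) * (6 * (s * C) ^ 3 * exp (real (Suc n) * (s * C)\<^sup>2))"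
    using s C by (intro mult_left_mono) (auto simp: mult_right_mono)
  finally show ?case by simp
qed

end

section \<open>The law of large numbers for the visits\<close>

text \<open>The sum is \<open>g\<close> at the current state minus \<open>g\<close> at the initial
  one as long as time \<open>M\<close> has not been passed. The straddling transition keeps it of
  this form, and afterwards it is constant; hence the induction carries the exact value only up to
  \<open>M\<close>.\<close>

lemma stop_sum_telescope:
  assumes g: "\<And>j. \<bar>g j\<bar> \<le> G"
  shows "\<bar>stop_sum M (\<lambda>i j k. g j - g i) h\<bar> \<le> 2 * G"
proof -
  have "h \<noteq> [] \<longrightarrow> (elapsed h \<le> M \<longrightarrow> stop_sum M (\<lambda>i j k. g j - g i) h = g (cur h) - g (fst (last h)))
     \<and> \<bar>stop_sum M (\<lambda>i j k. g j - g i) h\<bar> \<le> 2 * G"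
  proof (induction h)
    case (Cons y h)
    have le: "\<bar>g a - g b\<bar> \<le> 2 * G" for a b using g[of a] g[of b] by linarith
    show ?case
    proof (cases "h = []")
      case True
      then show ?thesis using g[of "fst y"] by simp
    next
      case False
      with Cons.IH have IH: "elapsed h \<le> M \<Longrightarrow> stop_sum M (\<lambda>i j k. g j - g i) h = g (cur h) - g (fst (last h))"
        "\<bar>stop_sum M (\<lambda>i j k. g j - g i) h\<bar> \<le> 2 * G" by auto
      show ?thesis
      proof (cases "elapsed h \<le> M")
        case True
        with IH(1) have "stop_sum M (\<lambda>i j k. g j - g i) (y # h) = g (fst y) - g (fst (last h))"
          using False by simp
        then show ?thesis using False le by (simp del: stop_sum.simps)
      next
        case F: False
        then show ?thesis using IH(2) False by auto
      qed
    qed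
  qed simp
  then show ?thesis using g[of undefined] by (cases "h = []") auto
qed

text \<open>The stopped time overshoots \<open>M\<close> by at most the sojourn time that straddles
  it. That sojourn time is either at most \<open>b\<close> or one of the terms of the sum over
  sojourn times above \<open>b\<close>.\<close>

lemma stop_sum_time:
  assumes "h \<noteq> []" "snd (last h) = 0"
  shows "elapsed h \<le> M \<Longrightarrow> stop_sum M (\<lambda>i j k. real k) h = real (elapsed h)"
    and "elapsed h > M \<Longrightarrow> real M < stop_sum M (\<lambda>i j k. real k) h \<and>
      stop_sum M (\<lambda>i j k. real k) h \<le> real M + real b + stop_sum M (\<lambda>i j k. if k > b then real k else 0) h"
proof -
  let ?t = "stop_sum M (\<lambda>i j k. real k)" and ?u = "stop_sum M (\<lambda>i j k. if k > b then real k else 0)"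
  have "h \<noteq> [] \<longrightarrow> snd (last h) = 0 \<longrightarrow> (elapsed h \<le> M \<longrightarrow> ?t h = real (elapsed h)) \<and>
    (elapsed h > M \<longrightarrow> real M < ?t h \<and> ?t h \<le> real M + real b + ?u h)"
  proof (induction h)
    case (Cons y h)
    show ?case
    proof (cases "h = []")
      case False
      show ?thesis
      proof (cases "elapsed h \<le> M")
        case True
        have u: "0 \<le> ?u h" by (rule stop_sum_nonneg) auto
        show ?thesis
        proof (intro impI conjI)
          assume "snd (last (y # h)) = 0"
          then have t: "?t (y # h) = real (snd y + elapsed h)" using Cons.IH True False by simp
          then show "?t (y # h) = real (elapsed (y # h))" by simp
          assume "elapsed (y # h) > M"
          then show "real M < ?t (y # h)" using t by simp
          show "?t (y # h) \<le> real M + real b + ?u (y # h)"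
            unfolding t using True False u by simp
        qed
      qed (use Cons.IH False in auto)
    qed simp
  qed simp
  with assms show "elapsed h \<le> M \<Longrightarrow> ?t h = real (elapsed h)"
    "elapsed h > M \<Longrightarrow> real M < ?t h \<and> ?t h \<le> real M + real b + ?u h" by auto
qed

section \<open>Mean hitting times of a state\<close>

definition taboo :: "('e \<Rightarrow> ('e \<times> nat) pmf) \<Rightarrow> 'e \<Rightarrow> ('e \<Rightarrow> ennreal) \<Rightarrow> 'e \<Rightarrow> ennreal" where
  "taboo K i v j = (\<integral>\<^sup>+y. (if fst y = i then 0 else v (fst y)) \<partial>K j)"

definition mean_sojourn :: "('e \<Rightarrow> ('e \<times> nat) pmf) \<Rightarrow> 'e \<Rightarrow> ennreal" where
  "mean_sojourn K j = (\<integral>\<^sup>+y. of_nat (snd y) \<partial>K j)"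

text \<open>The sum over \<open>n\<close> of the expected \<open>(n + 1)\<close>-st sojourn time on the event that \<open>i\<close> has not been hit in
  the first \<open>n\<close> steps.\<close>

definition mean_hitting :: "('e \<Rightarrow> ('e \<times> nat) pmf) \<Rightarrow> 'e \<Rightarrow> 'e \<Rightarrow> ennreal" where
  "mean_hitting K i j = (\<Sum>n. (taboo K i ^^ n) (mean_sojourn K) j)"

lemma mean_hitting_first_step: "mean_hitting K i j = mean_sojourn K j + taboo K i (mean_hitting K i) j"
proof -
  let ?f = "\<lambda>n. (taboo K i ^^ n) (mean_sojourn K)"
  have "taboo K i (mean_hitting K i) j = (\<integral>\<^sup>+y. (\<Sum>n. if fst y = i then 0 else ?f n (fst y)) \<partial>K j)"
    unfolding taboo_def mean_hitting_def by (intro nn_integral_cong) auto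
  also have "\<dots> = (\<Sum>n. taboo K i (?f n) j)"
    unfolding taboo_def by (rule nn_integral_suminf) simp
  finally have "taboo K i (mean_hitting K i) j = (\<Sum>n. ?f (Suc n) j)" by simp
  moreover have "(\<Sum>n. ?f n j) = ?f 0 j + (\<Sum>n. ?f (Suc n) j)"
    by (subst suminf_offset[of "\<lambda>n. ?f n j" 1]) (auto intro: summableI)
  ultimately show ?thesis by (simp add: mean_hitting_def)
qed

text \<open>Histories are reversed, so \<open>butlast\<close> discards the initial state: only
  visits at step 1 or later count as hits. The function \<open>v\<close> is arbitrary because
  removing the last transition replaces it by \<open>taboo K i v\<close>.\<close>

lemma nn_integral_taboo_path:
  "(\<integral>\<^sup>+h. (if i \<in> fst ` set (butlast h) then 0 else v (cur h)) \<partial>path_pmf K j n) = (taboo K i ^^ n) v j"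
proof (induction n arbitrary: v)
  case (Suc n)
  have "(\<integral>\<^sup>+h. (if i \<in> fst ` set (butlast h) then 0 else v (cur h)) \<partial>path_pmf K j (Suc n)) =
      (\<integral>\<^sup>+h. (\<integral>\<^sup>+y. (if i \<in> fst ` set (butlast (y # h)) then 0 else v (cur (y # h))) \<partial>K (cur h)) \<partial>path_pmf K j n)"
    by (rule nn_integral_path_Suc)
  also have "\<dots> = (\<integral>\<^sup>+h. (if i \<in> fst ` set (butlast h) then 0 else taboo K i v (cur h)) \<partial>path_pmf K j n)"
  proof (rule nn_integral_cong_AE, unfold AE_measure_pmf_iff, rule ballI)
    fix h assume "h \<in> set_pmf (path_pmf K j n)"
    then have "h \<noteq> []" by (rule path_nonempty)
    then show "(\<integral>\<^sup>+y. (if i \<in> fst ` set (butlast (y # h)) then 0 else v (cur (y # h))) \<partial>K (cur h)) =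
        (if i \<in> fst ` set (butlast h) then 0 else taboo K i v (cur h))"
      by (auto simp: taboo_def intro!: nn_integral_cong)
  qed
  also have "\<dots> = (taboo K i ^^ n) (taboo K i v) j" by (rule Suc.IH)
  also have "\<dots> = (taboo K i ^^ Suc n) v j" by (simp add: funpow_swap1)
  finally show ?case .
qed (simp add: numeral_eq_Suc)

text \<open>By the first-step equation, a finite value at a state forces finite values at all its
  successors: a finite integral has an almost everywhere finite integrand, and for a discrete law
  this means at every point of the support. Irreducibility propagates finiteness from
  \<open>i\<close> to all states.\<close>

lemma mean_hitting_finite:
  assumes irr: "\<And>j. \<exists>n. \<exists>h\<in>set_pmf (path_pmf K i n). cur h = j"
    and fin: "mean_hitting K i i < \<infinity>"
  shows "mean_hitting K i j < \<infinity>"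
proof -
  have closed: "mean_hitting K i (fst y) < \<infinity>" if "mean_hitting K i j < \<infinity>" "y \<in> set_pmf (K j)" for j y
  proof (cases "fst y = i")
    case False
    have "taboo K i (mean_hitting K i) j < \<infinity>"
      using that(1) by (subst (asm) mean_hitting_first_step) (auto simp: top_unique less_top)
    then have "AE y in K j. (if fst y = i then 0 else mean_hitting K i (fst y)) \<noteq> \<infinity>"
      unfolding taboo_def by (intro nn_integral_PInf_AE) auto
    then show ?thesis using that(2) False by (auto simp: AE_measure_pmf_iff less_top)
  qed (use fin in simp)
  have "mean_hitting K i (cur h) < \<infinity>" if "h \<in> set_pmf (path_pmf K i n)" for h n
    using that
  proof (induction n arbitrary: h)
    case (Suc n)
    then obtain h' y where "h' \<in> set_pmf (path_pmf K i n)" "y \<in> set_pmf (K (cur h'))" "h = y # h'"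
      by auto
    then show ?case using closed[OF Suc.IH] by simp
  qed (use fin in simp)
  with irr[of j] show ?thesis by blast
qed

lemma elapsed_path_ge:
  assumes pos: "\<And>j y. y \<in> set_pmf (K j) \<Longrightarrow> snd y \<ge> 1"
  shows "h \<in> set_pmf (path_pmf K i n) \<Longrightarrow> elapsed h \<ge> n"
  by (induction n arbitrary: h) (fastforce dest: pos)+

lemma sojourn_integrable:
  assumes "mean_sojourn K j < \<infinity>"
  shows "integrable (K j) (\<lambda>y. real (snd y))" "(\<integral>y. real (snd y) \<partial>K j) = enn2real (mean_sojourn K j)"
proof -
  have eq: "(\<integral>\<^sup>+y. ennreal (real (snd y)) \<partial>K j) = mean_sojourn K j"
    by (simp add: mean_sojourn_def ennreal_of_nat_eq_real_of_nat)
  show "integrable (K j) (\<lambda>y. real (snd y))"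
    using assms by (intro integrableI_nonneg) (auto simp: eq)
  show "(\<integral>y. real (snd y) \<partial>K j) = enn2real (mean_sojourn K j)"
    by (subst integral_eq_nn_integral) (auto simp: eq)
qed

text \<open>The mean hitting times, put to zero at the target, correct the time process to a martingale
  whose compensator counts the visits to the target.\<close>

lemma hitting_corrector:
  fixes K :: "'e::finite \<Rightarrow> ('e \<times> nat) pmf"
  assumes fin: "\<And>j. mean_hitting K i j < \<infinity>"
  obtains g where "\<And>j. g j + (if j = i then enn2real (mean_hitting K i i) else 0) =
    (\<integral>y. real (snd y) \<partial>K j) + (\<integral>y. g (fst y) \<partial>K j)"
    and "\<And>j. integrable (K j) (\<lambda>y. real (snd y))"
proof
  define g where "g j = (if j = i then 0 else enn2real (mean_hitting K i j))" for j
  have m_fin: "mean_sojourn K j < \<infinity>" and t_fin: "taboo K i (mean_hitting K i) j < \<infinity>" for j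
    using fin[of j] by (auto simp: mean_hitting_first_step[of K i j] less_top)
  note m = sojourn_integrable[OF m_fin]
  show "integrable (K j) (\<lambda>y. real (snd y))" for j by (rule m)
  have "(\<integral>\<^sup>+y. ennreal (g (fst y)) \<partial>K j) = taboo K i (mean_hitting K i) j" for j
    unfolding taboo_def g_def using fin by (intro nn_integral_cong) (auto simp: less_top)
  then have gi: "(\<integral>y. g (fst y) \<partial>K j) = enn2real (taboo K i (mean_hitting K i) j)" for j
    by (subst integral_eq_nn_integral) (auto simp: g_def)
  show "g j + (if j = i then enn2real (mean_hitting K i i) else 0) =
    (\<integral>y. real (snd y) \<partial>K j) + (\<integral>y. g (fst y) \<partial>K j)" for j
  proof -
    have "enn2real (mean_hitting K i j) = enn2real (mean_sojourn K j) + enn2real (taboo K i (mean_hitting K i) j)"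
      using m_fin[of j] t_fin[of j] by (subst mean_hitting_first_step) (simp add: enn2real_plus)
    then show ?thesis unfolding gi m(2) by (cases "j = i") (simp_all add: g_def)
  qed
qed

text \<open>Only mean sojourn times are finite, so they are cut at a level \<open>b\<close> whose
  tail means are below r / 8. The truncated martingale has bounded increments and thus a second
  moment of order \<open>M\<close>; what was cut off and its compensator are controlled in
  mean.\<close>

lemma visits_lln:
  fixes K :: "'e::finite \<Rightarrow> ('e \<times> nat) pmf"
  assumes pos: "\<And>j y. y \<in> set_pmf (K j) \<Longrightarrow> snd y \<ge> 1"
    and fin: "\<And>j. mean_hitting K i j < \<infinity>" and r: "r > 0"
  shows "eventually (\<lambda>M. (\<integral>\<^sup>+h. ennreal \<bar>real M - enn2real (mean_hitting K i i) *
      stop_sum M (\<lambda>i' j k. if i' = i then 1 else 0) h\<bar> \<partial>path_pmf K i0 (Suc M)) \<le> ennreal (r * real (Suc M))) sequentially"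
proof -
  define \<mu> where "\<mu> = enn2real (mean_hitting K i i)"
  obtain g where g: "\<And>j. g j + (if j = i then \<mu> else 0) = (\<integral>y. real (snd y) \<partial>K j) + (\<integral>y. g (fst y) \<partial>K j)"
    and int: "\<And>j. integrable (K j) (\<lambda>y. real (snd y))"
    using hitting_corrector[OF fin] unfolding \<mu>_def by metis
  define G where "G = Max (range (\<lambda>j. \<bar>g j\<bar>))"
  have G: "\<bar>g j\<bar> \<le> G" for j unfolding G_def by (intro Max_ge) auto
  have gi: "integrable (K j) (\<lambda>y. g (fst y))" for j
    by (rule integrable_pmf_bounded[where B = G]) (simp add: G)
  define u where "u b = (\<lambda>k. if k > b then real k else 0)" for b k :: nat
  define \<tau> where "\<tau> b j = (\<integral>y. u b (snd y) \<partial>K j)" for b j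
  have ui: "integrable (K j) (\<lambda>y. u b (snd y))" for b j
    by (rule Bochner_Integration.integrable_bound[OF int[of j]]) (auto simp: u_def)
  have "(\<lambda>b. \<tau> b j) \<longlonglongrightarrow> (\<integral>y. 0 \<partial>K j)" for j
    unfolding \<tau>_def
  proof (rule integral_dominated_convergence[where w = "\<lambda>y. real (snd y)"])
    show "AE y in K j. (\<lambda>b. u b (snd y)) \<longlonglongrightarrow> 0"
    proof (rule AE_I2)
      fix y :: "'e \<times> nat"
      have "eventually (\<lambda>b. u b (snd y) = 0) sequentially"
        using eventually_ge_at_top[of "snd y"] by eventually_elim (auto simp: u_def)
      then show "(\<lambda>b. u b (snd y)) \<longlonglongrightarrow> 0" by (rule tendsto_eventually)
    qed
  qed (auto simp: u_def int)
  then have "eventually (\<lambda>b. \<tau> b j < r / 8) sequentially" for j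
    using r by (intro order_tendstoD(2)[where y = 0]) auto
  then have "eventually (\<lambda>b. \<forall>j. \<tau> b j < r / 8) sequentially"
    by (simp add: eventually_all_finite)
  then obtain b where b: "\<And>j. \<tau> b j < r / 8" by (auto simp: eventually_sequentially)
  have \<tau>0: "0 \<le> \<tau> b j" for j unfolding \<tau>_def by (intro integral_nonneg_AE) (auto simp: u_def)
  \<comment> \<open>The increment of S n + g (J n) minus \<mu> times the visits to \<open>i\<close>,
    with the sojourn time truncated; the term \<open>\<tau> b i'\<close> restores the mean lost by
    the truncation.\<close>
  define \<phi> where "\<phi> i' j k = (if k \<le> b then real k else 0) + (g j - g i') - (if i' = i then \<mu> else 0) + \<tau> b i'" for i' j k
  define C where "C = real b + 2 * G + \<bar>\<mu>\<bar> + r"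
  have \<phi>_bound: "\<bar>\<phi> i' j k\<bar> \<le> C" for i' j k
    using G[of j] G[of i'] b[of i'] \<tau>0[of i'] r unfolding \<phi>_def C_def by (auto split: if_splits)
  have \<phi>_centred: "(\<integral>y. \<phi> j (fst y) (snd y) \<partial>K j) = 0" for j
  proof -
    have "(\<integral>y. \<phi> j (fst y) (snd y) \<partial>K j) =
        (\<integral>y. real (snd y) - u b (snd y) + g (fst y) + (\<tau> b j - g j - (if j = i then \<mu> else 0)) \<partial>K j)"
      by (intro Bochner_Integration.integral_cong) (auto simp: \<phi>_def u_def)
    also have "\<dots> = (\<integral>y. real (snd y) \<partial>K j) - \<tau> b j + (\<integral>y. g (fst y) \<partial>K j) + (\<tau> b j - g j - (if j = i then \<mu> else 0))"
      using int[of j] ui[of j b] gi[of j] by (simp add: \<tau>_def)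
    finally show ?thesis using g[of j] by linarith
  qed
  let ?n = "\<lambda>M. stop_sum M (\<lambda>i' j k. if i' = i then 1 else 0)"
  let ?u = "\<lambda>M. stop_sum M (\<lambda>i j k. u b k)" and ?\<tau> = "\<lambda>M. stop_sum M (\<lambda>i j k. \<tau> b i)"
  have pointwise: "\<bar>real M - \<mu> * ?n M h\<bar> \<le>
      ((stop_sum M \<phi> h)\<^sup>2 / (r / 4 * real (Suc M)) + r / 4 * real (Suc M) + (real b + 2 * G)) + (?u M h + ?\<tau> M h)"
    if h: "h \<in> set_pmf (path_pmf K i0 (Suc M))" for h M
  proof -
    have elapsed: "Suc M \<le> elapsed h" by (rule elapsed_path_ge[OF _ h]) (rule pos)
    have ne: "h \<noteq> []" "snd (last h) = 0" "elapsed h > M"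
      using path_nonempty[OF h] last_path[OF h] elapsed by auto
    note t = stop_sum_time(2)[OF ne(1,2,3), of b, folded u_def]
    have "stop_sum M \<phi> h = stop_sum M (\<lambda>i j k. real k) h - ?u M h + stop_sum M (\<lambda>i j k. g j - g i) h - \<mu> * ?n M h + ?\<tau> M h"
    proof -
      have "stop_sum M \<phi> h = stop_sum M (\<lambda>i' j k. (real k - u b k) + (g j - g i') - \<mu> * (if i' = i then 1 else 0) + \<tau> b i') h"
        by (intro arg_cong[where f = "\<lambda>\<phi>. stop_sum M \<phi> h"] ext) (auto simp: \<phi>_def u_def)
      then show ?thesis
        by (simp only: stop_sum_add stop_sum_diff stop_sum_cmult)
    qed
    moreover have "\<bar>stop_sum M (\<lambda>i j k. g j - g i) h\<bar> \<le> 2 * G" by (rule stop_sum_telescope[OF G])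
    moreover have "0 \<le> ?u M h" "0 \<le> ?\<tau> M h" using \<tau>0 by (auto intro!: stop_sum_nonneg simp: u_def)
    ultimately have "\<bar>real M - \<mu> * ?n M h\<bar> \<le> \<bar>stop_sum M \<phi> h\<bar> + (real b + 2 * G) + (?u M h + ?\<tau> M h)"
      using t by linarith
    \<comment> \<open>Used with a = r / 4 * (M + 1), this trades the first absolute moment for the
      second, which martingale orthogonality controls.\<close>
    moreover have "\<bar>x\<bar> \<le> x\<^sup>2 / a + a" if "a > 0" for x a :: real
    proof -
      have "2 * (\<bar>x\<bar> * a) \<le> \<bar>x\<bar>\<^sup>2 + a\<^sup>2" using zero_le_power2[of "\<bar>x\<bar> - a"] by (simp add: power2_diff)
      moreover have "0 \<le> \<bar>x\<bar> * a" using that by simp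
      ultimately have "\<bar>x\<bar> * a \<le> \<bar>x\<bar>\<^sup>2 + a\<^sup>2" by linarith
      then have "\<bar>x\<bar> * a \<le> x\<^sup>2 + a * a" by (simp add: power2_eq_square)
      then show ?thesis using that by (simp add: field_simps)
    qed
    ultimately show ?thesis using r by (smt (verit) divide_pos_pos mult_pos_pos of_nat_0_less_iff zero_less_Suc)
  qed
  have bound: "(\<integral>\<^sup>+h. ennreal \<bar>real M - \<mu> * ?n M h\<bar> \<partial>path_pmf K i0 (Suc M)) \<le>
      ennreal (4 * C\<^sup>2 / r + (real b + 2 * G) + r / 2 * real (Suc M))" for M
  proof -
    let ?A = "\<lambda>h. (stop_sum M \<phi> h)\<^sup>2 / (r / 4 * real (Suc M)) + r / 4 * real (Suc M) + (real b + 2 * G)"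
    have G0: "0 \<le> G" using G[of i] by linarith
    have A0: "0 \<le> ?A h" for h using r G0 by simp
    have uc: "(\<integral>\<^sup>+y. ennreal (u b (snd y)) \<partial>K i) \<le> ennreal (r / 8)" for i
      using ui[of i b] b[of i] by (subst nn_integral_eq_integral) (auto simp: \<tau>_def u_def intro!: ennreal_leI)
    have \<tau>c: "(\<integral>\<^sup>+y. ennreal (\<tau> b i) \<partial>K i) \<le> ennreal (r / 8)" for i
      using b[of i] by (simp add: measure_pmf.emeasure_space_1 ennreal_leI less_imp_le)
    have "(\<integral>\<^sup>+h. ennreal \<bar>real M - \<mu> * ?n M h\<bar> \<partial>path_pmf K i0 (Suc M)) \<le>
        (\<integral>\<^sup>+h. ennreal (?A h) + (ennreal (?u M h) + ennreal (?\<tau> M h)) \<partial>path_pmf K i0 (Suc M))"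
    proof (rule nn_integral_mono_AE, unfold AE_measure_pmf_iff, rule ballI)
      fix h assume h: "h \<in> set_pmf (path_pmf K i0 (Suc M))"
      have "0 \<le> ?u M h" "0 \<le> ?\<tau> M h" using \<tau>0 by (auto intro!: stop_sum_nonneg simp: u_def)
      then show "ennreal \<bar>real M - \<mu> * ?n M h\<bar> \<le> ennreal (?A h) + (ennreal (?u M h) + ennreal (?\<tau> M h))"
        using pointwise[OF h] A0[of h] by (simp add: ennreal_plus[symmetric] ennreal_leI del: ennreal_plus)
    qed
    also have "\<dots> = (\<integral>\<^sup>+h. ennreal (?A h) \<partial>path_pmf K i0 (Suc M)) +
        ((\<integral>\<^sup>+h. ennreal (?u M h) \<partial>path_pmf K i0 (Suc M)) + (\<integral>\<^sup>+h. ennreal (?\<tau> M h) \<partial>path_pmf K i0 (Suc M)))"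
      by (simp add: nn_integral_add del: path_pmf.simps)
    also have "\<dots> \<le> ennreal (4 * C\<^sup>2 / r + r / 4 * real (Suc M) + (real b + 2 * G)) +
        (of_nat (Suc M) * ennreal (r / 8) + of_nat (Suc M) * ennreal (r / 8))"
    proof (intro add_mono)
      have bd: "(stop_sum M \<phi> h)\<^sup>2 \<le> (C * real (Suc M))\<^sup>2" if "h \<in> set_pmf (path_pmf K i0 (Suc M))" for h
        using stop_sum_abs_le[of \<phi> C M h, OF \<phi>_bound] length_path[OF that] \<phi>_bound[of i i 0]
        by (intro power2_le_if_abs_le) (auto simp del: path_pmf.simps)
      have i: "integrable (path_pmf K i0 (Suc M)) (\<lambda>h. (stop_sum M \<phi> h)\<^sup>2)"
        by (rule integrable_pmf_bounded[where B = "(C * real (Suc M))\<^sup>2"]) (use bd in auto)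
      have "(\<integral>\<^sup>+h. ennreal (?A h) \<partial>path_pmf K i0 (Suc M)) = ennreal (\<integral>h. ?A h \<partial>path_pmf K i0 (Suc M))"
        using i A0 by (intro nn_integral_eq_integral) auto
      also have "(\<integral>h. ?A h \<partial>path_pmf K i0 (Suc M)) =
          (\<integral>h. (stop_sum M \<phi> h)\<^sup>2 \<partial>path_pmf K i0 (Suc M)) / (r / 4 * real (Suc M)) + r / 4 * real (Suc M) + (real b + 2 * G)"
        using i by (simp del: path_pmf.simps)
      also have "\<dots> \<le> (real (Suc M) * C\<^sup>2) / (r / 4 * real (Suc M)) + r / 4 * real (Suc M) + (real b + 2 * G)"
        using stop_sum_second_moment[where \<phi> = \<phi> and C = C and K = K and M = M and n = "Suc M" and i = i0, OF \<phi>_bound \<phi>_centred] r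
        by (intro add_right_mono divide_right_mono) auto
      also have "(real (Suc M) * C\<^sup>2) / (r / 4 * real (Suc M)) = 4 * C\<^sup>2 / r"
      proof -
        have "x * C\<^sup>2 / (r / 4 * x) = 4 * C\<^sup>2 / r" if "x > 0" for x
          using r that by (simp add: field_simps)
        then show ?thesis by simp
      qed
      finally show "(\<integral>\<^sup>+h. ennreal (?A h) \<partial>path_pmf K i0 (Suc M)) \<le>
          ennreal (4 * C\<^sup>2 / r + r / 4 * real (Suc M) + (real b + 2 * G))"
        by (simp add: ennreal_leI)
      show "(\<integral>\<^sup>+h. ennreal (?u M h) \<partial>path_pmf K i0 (Suc M)) \<le> of_nat (Suc M) * ennreal (r / 8)"
        by (rule nn_integral_stop_sum_le) (auto simp: u_def uc[unfolded u_def])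
      show "(\<integral>\<^sup>+h. ennreal (?\<tau> M h) \<partial>path_pmf K i0 (Suc M)) \<le> of_nat (Suc M) * ennreal (r / 8)"
        by (rule nn_integral_stop_sum_le) (use \<tau>0 \<tau>c in auto)
    qed
    also have "\<dots> = ennreal (4 * C\<^sup>2 / r + (real b + 2 * G) + r / 2 * real (Suc M))"
    proof -
      have "of_nat (Suc M) * ennreal (r / 8) = ennreal (real (Suc M) * (r / 8))"
        using r by (subst ennreal_mult) (auto simp: ennreal_of_nat_eq_real_of_nat)
      moreover have "0 \<le> 4 * C\<^sup>2 / r + r / 4 * real (Suc M) + (real b + 2 * G)" using r G0 by simp
      ultimately show ?thesis using r
        by (simp add: ennreal_plus[symmetric] del: ennreal_plus of_nat_Suc) (simp add: algebra_simps)
    qed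
    finally show ?thesis .
  qed
  \<comment> \<open>The share r / 2 of the budget is spent: r / 4 on the square bound, r / 8 on the
    long sojourn times, r / 8 on their compensator. The other half absorbs the terms free of
    \<open>M\<close>.\<close>
  have "eventually (\<lambda>M. 4 * C\<^sup>2 / r + (real b + 2 * G) \<le> r / 2 * real M) sequentially"
  proof -
    obtain N where N: "(4 * C\<^sup>2 / r + (real b + 2 * G)) / (r / 2) \<le> real N" using real_arch_simple by blast
    show ?thesis unfolding eventually_sequentially
    proof (intro exI allI impI)
      fix M assume "M \<ge> N"
      then have "(4 * C\<^sup>2 / r + (real b + 2 * G)) / (r / 2) \<le> real M" using N by linarith
      then show "4 * C\<^sup>2 / r + (real b + 2 * G) \<le> r / 2 * real M"
        using r by (subst (asm) pos_divide_le_eq) (simp_all add: mult.commute)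
    qed
  qed
  then show ?thesis unfolding \<mu>_def[symmetric]
  proof (rule eventually_mono)
    fix M assume "4 * C\<^sup>2 / r + (real b + 2 * G) \<le> r / 2 * real M"
    then have "4 * C\<^sup>2 / r + (real b + 2 * G) + r / 2 * real (Suc M) \<le> r * real (Suc M)"
    proof -
      have "r * real (Suc M) = r / 2 * real M + r / 2 * real (Suc M) + r / 2" by (simp add: field_simps)
      with r \<open>4 * C\<^sup>2 / r + (real b + 2 * G) \<le> r / 2 * real M\<close> show ?thesis by linarith
    qed
    from order_trans[OF bound[of M] ennreal_leI[OF this]]
    show "(\<integral>\<^sup>+h. ennreal \<bar>real M - \<mu> * ?n M h\<bar> \<partial>path_pmf K i0 (Suc M)) \<le> ennreal (r * real (Suc M))" .
  qed
qed

section \<open>The sample path and its law\<close>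

definition jump_pmf :: "('e::finite) mseq \<Rightarrow> 'e \<Rightarrow> ('e \<times> nat) pmf" where
  "jump_pmf q i = embed_pmf (\<lambda>(j, k). q i j k)"

lemma pmf_jump_pmf:
  assumes "semi_markov_kernel q"
  shows "pmf (jump_pmf q i) (j, k) = q i j k"
proof -
  have nonneg: "q i j k \<ge> 0" and sm: "summable (q i j)" for j k
    using assms by (auto simp: semi_markov_kernel_def)
  have one: "(\<Sum>j\<in>UNIV. \<Sum>k. q i j k) = 1" using assms by (simp add: semi_markov_kernel_def)
  have "(\<integral>\<^sup>+x. ennreal (case x of (j, k) \<Rightarrow> q i j k) \<partial>count_space UNIV) =
      (\<integral>\<^sup>+j. (\<integral>\<^sup>+k. ennreal (q i j k) \<partial>count_space UNIV) \<partial>count_space UNIV)"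
    by (subst nn_integral_fst_count_space[symmetric]) simp
  also have "\<dots> = (\<Sum>j\<in>UNIV. ennreal (\<Sum>k. q i j k))"
    by (simp add: nn_integral_count_space_finite nn_integral_count_space_nat suminf_ennreal2 nonneg sm)
  also have "\<dots> = 1" by (subst sum_ennreal) (auto simp: one nonneg sm intro!: suminf_nonneg)
  finally show ?thesis
    unfolding jump_pmf_def by (subst pmf_embed_pmf) (auto simp: nonneg)
qed

lemma measurable_pair_count_space:
  fixes f :: "'w \<Rightarrow> 'a::countable" and g :: "'w \<Rightarrow> 'b"
  assumes f: "f \<in> measurable M (count_space UNIV)" and g: "g \<in> measurable M (count_space UNIV)"
  shows "(\<lambda>\<omega>. h (f \<omega>) (g \<omega>)) \<in> measurable M (count_space UNIV)"
  by (rule measurable_compose_countable[OF _ f]) (rule measurable_compose[OF g], simp)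

context markov_renewal_chain
begin

abbreviation "K \<equiv> jump_pmf q"

lemma pmf_K: "pmf (K i) (j, k) = q i j k"
  by (rule pmf_jump_pmf[OF kernel])

lemma K_pos: "y \<in> set_pmf (K i) \<Longrightarrow> snd y \<ge> 1"
proof (rule ccontr)
  assume y: "y \<in> set_pmf (K i)" and n: "\<not> snd y \<ge> 1"
  obtain j k where jk: "y = (j, k)" by (cases y)
  with n have "k = 0" by simp
  with y jk have "q i j 0 \<noteq> 0" using pmf_K[of i j 0] by (simp add: set_pmf_eq)
  then show False using kernel by (simp add: semi_markov_kernel_def)
qed

primrec hist :: "nat \<Rightarrow> 'w \<Rightarrow> 'e history" where
  "hist 0 \<omega> = [(J 0 \<omega>, sojourn S 0 \<omega>)]"
| "hist (Suc n) \<omega> = (J (Suc n) \<omega>, sojourn S (Suc n) \<omega>) # hist n \<omega>"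

lemma length_hist [simp]: "length (hist n \<omega>) = Suc n"
  by (induction n) auto

lemma hist_nonempty [simp]: "hist n \<omega> \<noteq> []"
  using length_hist[of n \<omega>] by (metis length_0_conv nat.distinct(1))

lemma cur_hist [simp]: "cur (hist n \<omega>) = J n \<omega>"
  by (cases n) auto

lemma measurable_sojourn: "sojourn S n \<in> measurable (P i) (count_space UNIV)"
  unfolding sojourn_def[abs_def] by (rule measurable_pair_count_space[OF measurable_S measurable_S])

lemma measurable_hist: "hist n \<in> measurable (P i) (count_space UNIV)"
proof (induction n)
  case 0
  show ?case using measurable_pair_count_space[OF measurable_J[of 0 i] measurable_sojourn[of 0 i], where h = "\<lambda>a b. [(a, b)]"]
    by (simp cong: measurable_cong)
next
  case (Suc n)
  have "(\<lambda>\<omega>. (J (Suc n) \<omega>, sojourn S (Suc n) \<omega>)) \<in> measurable (P i) (count_space UNIV)"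
    by (rule measurable_pair_count_space[OF measurable_J measurable_sojourn])
  from measurable_pair_count_space[OF this Suc, where h = "(#)"] show ?case by (simp cong: measurable_cong)
qed

lemma hist_eq_iff: "hist n \<omega> = hist n \<omega>' \<longleftrightarrow> (\<forall>m\<le>n. J m \<omega> = J m \<omega>' \<and> sojourn S m \<omega> = sojourn S m \<omega>')"
  by (induction n) (auto simp: le_Suc_eq)

text \<open>The Markov property factors the probability of a history into that of its past times one
  kernel entry; if the past is null, both sides are 0.\<close>

lemma measure_hist:
  "measure (P i0) {\<omega> \<in> space (P i0). hist n \<omega> = h} = pmf (path_pmf K i0 n) h"
proof (induction n arbitrary: h)
  case 0
  interpret prob_space "P i0" by (rule prob_space_P)
  have AE: "AE \<omega> in P i0. hist 0 \<omega> = [(i0, 0)]"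
    using initial[of i0] by eventually_elim (simp add: sojourn_def)
  note [measurable] = measurable_hist[of 0 i0]
  show ?case
  proof (cases "h = [(i0, 0)]")
    case True
    then show ?thesis using AE by (simp del: hist.simps add: prob_eq_1)
  next
    case False
    then have "measure (P i0) {\<omega> \<in> space (P i0). hist 0 \<omega> = h} = 0"
      using AE by (subst prob_eq_0) (auto simp del: hist.simps)
    with False show ?thesis by simp
  qed
next
  case (Suc n)
  interpret prob_space "P i0" by (rule prob_space_P)
  note [measurable] = measurable_hist[of _ i0]
  have path: "pmf (path_pmf K i0 (Suc n)) (y # h) = pmf (path_pmf K i0 n) h * pmf (K (cur h)) y" for y h
  proof -
    have "pmf (map_pmf (\<lambda>y. y # h') (K (cur h'))) (y # h) = indicator {h} h' * pmf (K (cur h)) y" for h'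
    proof (cases "h' = h")
      case True
      then show ?thesis using pmf_map_inj'[of "\<lambda>y. y # h" "K (cur h)" y] by (simp add: inj_def)
    next
      case False
      then have "y # h \<notin> set_pmf (map_pmf (\<lambda>y. y # h') (K (cur h')))" by auto
      then show ?thesis using False by (simp add: pmf_eq_0_set_pmf)
    qed
    then show ?thesis by (simp add: pmf_bind measure_pmf_single)
  qed
  show ?case
  proof (cases h)
    case Nil
    have "[] \<notin> set_pmf (path_pmf K i0 (Suc n))" by auto
    then show ?thesis using Nil by (simp add: pmf_eq_0_set_pmf del: path_pmf.simps)
  next
    case (Cons y h')
    let ?past = "{\<omega> \<in> space (P i0). hist n \<omega> = h'}"
    have ev: "{\<omega> \<in> space (P i0). hist (Suc n) \<omega> = h} =
      {\<omega> \<in> space (P i0). (J (Suc n) \<omega> = fst y \<and> sojourn S (Suc n) \<omega> = snd y) \<and> hist n \<omega> = h'}"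
      using Cons by auto
    show ?thesis
    proof (cases "measure (P i0) ?past = 0")
      case True
      have "measure (P i0) {\<omega> \<in> space (P i0). hist (Suc n) \<omega> = h} \<le> measure (P i0) ?past"
        using Cons by (intro finite_measure_mono) auto
      then have "measure (P i0) {\<omega> \<in> space (P i0). hist (Suc n) \<omega> = h} = 0"
        using True measure_nonneg[of "P i0" "{\<omega> \<in> space (P i0). hist (Suc n) \<omega> = h}"] by linarith
      then show ?thesis using True Suc.IH[of h'] unfolding Cons path by simp
    next
      case False
      then have "?past \<noteq> {}" by (metis measure_empty)
      \<comment> \<open>The Markov property is stated for sequences of states and sojourn times. A
        sample point of the past event supplies such sequences.\<close>
      then obtain \<omega>0 where \<omega>0: "\<omega>0 \<in> space (P i0)" "hist n \<omega>0 = h'" by auto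
      let ?c = "\<lambda>\<omega>. \<forall>m\<le>n. J m \<omega> = J m \<omega>0 \<and> sojourn S m \<omega> = sojourn S m \<omega>0"
      have c: "?c \<omega> \<longleftrightarrow> hist n \<omega> = h'" for \<omega>
        using hist_eq_iff[of n \<omega> \<omega>0] \<omega>0 by simp
      have pos: "measure (P i0) {\<omega> \<in> space (P i0). ?c \<omega>} > 0"
        unfolding c using False by (simp add: zero_less_measure_iff)
      have "cond_prob (P i0) (\<lambda>\<omega>. J (Suc n) \<omega> = fst y \<and> sojourn S (Suc n) \<omega> = snd y) ?c = q (J n \<omega>0) (fst y) (snd y)"
        by (rule markov[OF pos])
      then have "measure (P i0) {\<omega> \<in> space (P i0). hist (Suc n) \<omega> = h} = q (J n \<omega>0) (fst y) (snd y) * measure (P i0) ?past"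
        unfolding cond_prob_def c ev using False by (simp add: field_simps)
      moreover have "cur h' = J n \<omega>0" using \<omega>0(2) by (metis cur_hist)
      ultimately show ?thesis
        unfolding Cons path Suc.IH[symmetric] using pmf_K[of "J n \<omega>0" "fst y" "snd y"] by simp
    qed
  qed
qed

lemma distr_hist: "distr (P i0) (count_space UNIV) (hist n) = measure_pmf (path_pmf K i0 n)"
proof (rule measure_eqI_countable[where A = UNIV])
  interpret prob_space "P i0" by (rule prob_space_P)
  show "emeasure (distr (P i0) (count_space UNIV) (hist n)) {h} = emeasure (measure_pmf (path_pmf K i0 n)) {h}" for h
    using measure_hist[of i0 n h]
    by (subst emeasure_distr)
       (auto simp: measurable_hist emeasure_eq_measure emeasure_pmf_single vimage_def Int_def conj_commute)
qed auto

lemma integral_hist: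
  fixes F :: "'e history \<Rightarrow> 'b :: {banach, second_countable_topology}"
  shows "(\<integral>\<omega>. F (hist n \<omega>) \<partial>P i0) = (\<integral>h. F h \<partial>path_pmf K i0 n)"
  unfolding distr_hist[symmetric] by (subst integral_distr) (auto intro: measurable_hist)

lemma nn_integral_hist: "(\<integral>\<^sup>+\<omega>. F (hist n \<omega>) \<partial>P i0) = (\<integral>\<^sup>+h. F h \<partial>path_pmf K i0 n)"
  unfolding distr_hist[symmetric] by (subst nn_integral_distr) (auto intro: measurable_hist)

lemma measurable_hist_comp: "(\<lambda>\<omega>. F (hist n \<omega>)) \<in> measurable (P i0) borel"
  by (rule measurable_compose[OF measurable_hist]) simp

lemma AE_hist: "AE \<omega> in P i0. hist n \<omega> \<in> set_pmf (path_pmf K i0 n)"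
proof -
  have "AE h in distr (P i0) (count_space UNIV) (hist n). h \<in> set_pmf (path_pmf K i0 n)"
    unfolding distr_hist by (simp add: AE_measure_pmf_iff)
  then show ?thesis by (subst (asm) AE_distr_iff) (auto intro: measurable_hist)
qed

text \<open>The exceptional null set is removed once: on the remaining paths the subtraction in
  \<open>sojourn\<close> is exact, the jump times increase strictly, and every finite history lies
  in the support of its law.\<close>

definition regular :: "'e \<Rightarrow> 'w \<Rightarrow> bool" where
  "regular i0 \<omega> \<longleftrightarrow> J 0 \<omega> = i0 \<and> S 0 \<omega> = 0 \<and> (\<forall>n. S n \<omega> < S (Suc n) \<omega>) \<and>
     (\<forall>n. hist n \<omega> \<in> set_pmf (path_pmf K i0 n))"

lemma AE_regular: "AE \<omega> in P i0. regular i0 \<omega>"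
proof -
  have "AE \<omega> in P i0. \<forall>n. hist n \<omega> \<in> set_pmf (path_pmf K i0 n)"
    by (subst AE_all_countable) (simp add: AE_hist)
  with initial[of i0] show ?thesis
  proof eventually_elim
    fix \<omega> assume 0: "J 0 \<omega> = i0 \<and> S 0 \<omega> = 0" and h: "\<forall>n. hist n \<omega> \<in> set_pmf (path_pmf K i0 n)"
    have "S n \<omega> < S (Suc n) \<omega>" for n
    proof -
      have "hist (Suc n) \<omega> \<in> set_pmf (path_pmf K i0 (Suc n))" using h by blast
      then have "(J (Suc n) \<omega>, sojourn S (Suc n) \<omega>) \<in> set_pmf (K (J n \<omega>))" by auto
      from K_pos[OF this] show ?thesis by (simp add: sojourn_def)
    qed
    with 0 h show "regular i0 \<omega>" by (simp add: regular_def)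
  qed
qed

lemma elapsed_hist: "regular i0 \<omega> \<Longrightarrow> elapsed (hist n \<omega>) = S n \<omega>"
proof (induction n)
  case (Suc n)
  then have "S n \<omega> < S (Suc n) \<omega>" by (simp add: regular_def)
  with Suc show ?case by (simp add: sojourn_def)
qed (simp add: regular_def sojourn_def)

lemma S_strict_mono: "regular i0 \<omega> \<Longrightarrow> strict_mono (\<lambda>n. S n \<omega>)"
  by (simp add: strict_mono_Suc_iff regular_def)

lemma S_ge: "regular i0 \<omega> \<Longrightarrow> n \<le> S n \<omega>"
  using strict_mono_imp_increasing[OF S_strict_mono] by blast

text \<open>The set of jump indices up to time \<open>M\<close> is finite because S n \<ge> n and
  downward closed because jump times increase, so it is an initial segment ending at its
  maximum.\<close>

lemma le_jumps_iff:
  assumes "regular i0 \<omega>"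
  shows "n \<le> jumps S M \<omega> \<longleftrightarrow> S n \<omega> \<le> M"
proof -
  let ?A = "{n. S n \<omega> \<le> M}"
  have "?A \<subseteq> {..M}" using S_ge[OF assms] by (auto intro: order_trans)
  then have fin: "finite ?A" by (rule finite_subset) simp
  have "0 \<in> ?A" using assms by (simp add: regular_def)
  then have "Max ?A \<in> ?A" using fin by (intro Max_in) auto
  moreover have "S n \<omega> \<le> S (Max ?A) \<omega>" if "n \<le> Max ?A"
    using that strict_mono_less_eq[OF S_strict_mono[OF assms]] by blast
  moreover have "n \<le> Max ?A" if "n \<in> ?A" using fin that by (intro Max_ge)
  ultimately show ?thesis unfolding jumps_def by fastforce
qed

lemma jumps_le: "regular i0 \<omega> \<Longrightarrow> jumps S M \<omega> \<le> M"
  using le_jumps_iff[of i0 \<omega> "jumps S M \<omega>" M] S_ge[of i0 \<omega> "jumps S M \<omega>"] by simp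

definition transition_sum :: "nat \<Rightarrow> ('e \<Rightarrow> 'e \<Rightarrow> nat \<Rightarrow> real) \<Rightarrow> 'w \<Rightarrow> real" where
  "transition_sum M \<phi> \<omega> = (\<Sum>n = 1..jumps S M \<omega>. \<phi> (J (n - 1) \<omega>) (J n \<omega>) (sojourn S n \<omega>))"

lemma stop_sum_hist:
  assumes "regular i0 \<omega>"
  shows "stop_sum M \<phi> (hist n \<omega>) =
    (\<Sum>m = 1..n. if S (m - 1) \<omega> \<le> M then \<phi> (J (m - 1) \<omega>) (J m \<omega>) (sojourn S m \<omega>) else 0)"
  by (induction n) (simp_all add: elapsed_hist[OF assms])

text \<open>A transition starts by time \<open>M\<close> exactly if its index is at most
  \<open>Suc (jumps S M \<omega>)\<close>. The history of \<open>Suc M\<close> steps is long enough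
  to contain that index because there are at most \<open>M\<close> jumps by time
  \<open>M\<close>.\<close>

lemma stop_sum_eq_transition_sum:
  assumes "regular i0 \<omega>"
  shows "stop_sum M \<phi> (hist (Suc M) \<omega>) = transition_sum M \<phi> \<omega> +
    \<phi> (J (jumps S M \<omega>) \<omega>) (J (Suc (jumps S M \<omega>)) \<omega>) (sojourn S (Suc (jumps S M \<omega>)) \<omega>)"
proof -
  let ?N = "jumps S M \<omega>" and ?f = "\<lambda>m. \<phi> (J (m - 1) \<omega>) (J m \<omega>) (sojourn S m \<omega>)"
  have "stop_sum M \<phi> (hist (Suc M) \<omega>) = (\<Sum>m = 1..Suc M. if m \<le> Suc ?N then ?f m else 0)"
    unfolding stop_sum_hist[OF assms]
    by (intro sum.cong refl) (auto simp: le_jumps_iff[OF assms, symmetric])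
  also have "\<dots> = (\<Sum>m = 1..Suc ?N. ?f m)"
    using jumps_le[OF assms, of M] by (intro sum.mono_neutral_cong_right) auto
  finally show ?thesis by (simp add: transition_sum_def)
qed

lemma stop_sum_transition_sum_diff:
  assumes "regular i0 \<omega>" "\<And>i j k. \<bar>\<phi> i j k\<bar> \<le> C"
  shows "\<bar>stop_sum M \<phi> (hist (Suc M) \<omega>) - transition_sum M \<phi> \<omega>\<bar> \<le> C"
  unfolding stop_sum_eq_transition_sum[OF assms(1)] using assms(2) by simp

section \<open>Hitting times and mean recurrence times\<close>

lemma hit_time_gt_iff: "enat n < hit_time J i \<omega> \<longleftrightarrow> i \<notin> fst ` set (butlast (hist n \<omega>))"
proof -
  have "fst ` set (butlast (hist n \<omega>)) = {J m \<omega> | m. 1 \<le> m \<and> m \<le> n}"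
  proof (induction n)
    case (Suc n)
    have "{J m \<omega> | m. 1 \<le> m \<and> m \<le> Suc n} = insert (J (Suc n) \<omega>) {J m \<omega> | m. 1 \<le> m \<and> m \<le> n}"
      by (auto simp: le_Suc_eq)
    with Suc show ?case by simp
  qed auto
  moreover have "enat n < hit_time J i \<omega> \<longleftrightarrow> (\<forall>m. 1 \<le> m \<and> m \<le> n \<longrightarrow> J m \<omega> \<noteq> i)"
  proof
    assume lt: "enat n < hit_time J i \<omega>"
    show "\<forall>m. 1 \<le> m \<and> m \<le> n \<longrightarrow> J m \<omega> \<noteq> i"
    proof (intro allI impI notI)
      fix m assume m: "1 \<le> m \<and> m \<le> n" "J m \<omega> = i"
      then have "hit_time J i \<omega> \<le> enat m" unfolding hit_time_def by (intro Inf_lower) auto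
      with lt have "enat n < enat m" by (rule less_le_trans)
      with m show False by simp
    qed
  next
    assume *: "\<forall>m. 1 \<le> m \<and> m \<le> n \<longrightarrow> J m \<omega> \<noteq> i"
    have "enat (Suc n) \<le> hit_time J i \<omega>"
      unfolding hit_time_def using * by (intro Inf_greatest) (auto simp: not_less_eq_eq[symmetric])
    then show "enat n < hit_time J i \<omega>" by (rule less_le_trans[rotated]) simp
  qed
  ultimately show ?thesis by auto
qed

text \<open>The sojourn times up to the hit telescope to its time. If the state is never hit, every
  summand is at least 1, so both sides are infinite.\<close>

lemma at_time_hit_time:
  assumes "regular i0 \<omega>"
  shows "ennreal_of_enat (at_time S (hit_time J i) \<omega>) =
    (\<Sum>n. if enat n < hit_time J i \<omega> then of_nat (sojourn S (Suc n) \<omega>) else 0)"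
proof (cases "hit_time J i \<omega>")
  case (enat N)
  have "(\<Sum>n. if enat n < hit_time J i \<omega> then of_nat (sojourn S (Suc n) \<omega>) else (0::ennreal)) =
      (\<Sum>n<N. of_nat (sojourn S (Suc n) \<omega>))"
    by (subst suminf_finite[of "{..<N}"]) (auto simp: enat)
  also have "\<dots> = of_nat (S N \<omega>)"
  proof (induction N)
    case (Suc N)
    have "S N \<omega> < S (Suc N) \<omega>" using assms by (simp add: regular_def)
    then have "S (Suc N) \<omega> = S N \<omega> + sojourn S (Suc N) \<omega>" by (simp add: sojourn_def)
    with Suc show ?case by simp
  qed (use assms in \<open>simp add: regular_def\<close>)
  finally show ?thesis using enat by (simp add: at_time_def)
next
  case infinity
  have "(1::ennreal) \<le> of_nat (sojourn S (Suc n) \<omega>)" for n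
  proof -
    have "S n \<omega> < S (Suc n) \<omega>" using assms by (simp add: regular_def)
    then have "1 \<le> sojourn S (Suc n) \<omega>" by (simp add: sojourn_def)
    then show ?thesis by (metis of_nat_1 of_nat_mono)
  qed
  then have le: "(\<Sum>n. (1::ennreal)) \<le> (\<Sum>n. of_nat (sojourn S (Suc n) \<omega>))"
    by (intro suminf_le summableI)
  have "(\<Sum>n. (1::ennreal)) = \<top>"
    by (simp add: nn_integral_count_space_nat[symmetric] emeasure_count_space_infinite) 
  with le have "(\<Sum>n. of_nat (sojourn S (Suc n) \<omega>)) = (\<top>::ennreal)" by (simp add: top_unique)
  then show ?thesis using infinity by (simp add: at_time_def)
qed

text \<open>Whether the hitting time exceeds \<open>n\<close> is known from the first
  \<open>n\<close> transitions, that is, from \<open>tl h\<close>. The next sojourn time can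
  therefore be averaged first, which gives the terms of \<open>mean_hitting\<close>.\<close>

lemma mean_recurrence_eq: "mean_recurrence P J S i = mean_hitting K i i"
proof -
  have "mean_recurrence P J S i =
      (\<integral>\<^sup>+\<omega>. (\<Sum>n. if enat n < hit_time J i \<omega> then of_nat (sojourn S (Suc n) \<omega>) else 0) \<partial>P i)"
    unfolding mean_recurrence_def using AE_regular[of i]
    by (intro nn_integral_cong_AE, eventually_elim) (rule at_time_hit_time)
  also have "\<dots> = (\<integral>\<^sup>+\<omega>. (\<Sum>n. (\<lambda>h. if i \<in> fst ` set (butlast (tl h)) then 0 else of_nat (snd (hd h))) (hist (Suc n) \<omega>)) \<partial>P i)"
    by (intro nn_integral_cong suminf_cong) (simp add: hit_time_gt_iff)
  also have "\<dots> = (\<Sum>n. \<integral>\<^sup>+\<omega>. (\<lambda>h. if i \<in> fst ` set (butlast (tl h)) then 0 else of_nat (snd (hd h))) (hist (Suc n) \<omega>) \<partial>P i)"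
    by (rule nn_integral_suminf) (rule measurable_hist_comp)
  also have "\<dots> = (\<Sum>n. (taboo K i ^^ n) (mean_sojourn K) i)"
  proof (rule suminf_cong)
    fix n
    have "(\<integral>\<^sup>+\<omega>. (\<lambda>h. if i \<in> fst ` set (butlast (tl h)) then 0 else of_nat (snd (hd h))) (hist (Suc n) \<omega>) \<partial>P i) =
        (\<integral>\<^sup>+h. (if i \<in> fst ` set (butlast (tl h)) then 0 else of_nat (snd (hd h))) \<partial>path_pmf K i (Suc n))"
      by (rule nn_integral_hist)
    also have "\<dots> = (\<integral>\<^sup>+h. (if i \<in> fst ` set (butlast h) then 0 else mean_sojourn K (cur h)) \<partial>path_pmf K i n)"
      unfolding nn_integral_path_Suc by (intro nn_integral_cong) (simp add: mean_sojourn_def)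
    also have "\<dots> = (taboo K i ^^ n) (mean_sojourn K) i" by (rule nn_integral_taboo_path)
    finally show "(\<integral>\<^sup>+\<omega>. (\<lambda>h. if i \<in> fst ` set (butlast (tl h)) then 0 else of_nat (snd (hd h))) (hist (Suc n) \<omega>) \<partial>P i) =
        (taboo K i ^^ n) (mean_sojourn K) i" .
  qed
  finally show ?thesis by (simp add: mean_hitting_def)
qed

text \<open>Contraposition: if no history in the support ends at \<open>j\<close>, then on regular
  paths the hitting time is the infimum of the empty set, that is, infinite.\<close>

lemma irreducible_path:
  assumes "irreducible_chain P J"
  shows "\<exists>n. \<exists>h\<in>set_pmf (path_pmf K i n). cur h = j"
proof (rule ccontr)
  interpret prob_space "P i" by (rule prob_space_P)
  assume no: "\<not> (\<exists>n. \<exists>h\<in>set_pmf (path_pmf K i n). cur h = j)"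
  have "AE \<omega> in P i. \<not> hit_time J j \<omega> < \<infinity>"
    using AE_regular[of i]
  proof eventually_elim
    fix \<omega> assume "regular i \<omega>"
    then have "J n \<omega> \<noteq> j" for n using no by (metis cur_hist regular_def)
    then show "\<not> hit_time J j \<omega> < \<infinity>" by (simp add: hit_time_def top_enat_def)
  qed
  then have "measure (P i) {\<omega> \<in> space (P i). hit_time J j \<omega> < \<infinity>} = 0"
    \<comment> \<open>The event need not be shown measurable: a nonmeasurable set has
      \<open>measure\<close> 0 as well.\<close>
    by (cases "{\<omega> \<in> space (P i). hit_time J j \<omega> < \<infinity>} \<in> sets (P i)")
       (subst prob_eq_0, auto simp: measure_notin_sets)
  moreover have "measure (P i) {\<omega> \<in> space (P i). hit_time J j \<omega> < \<infinity>} > 0"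
    using assms unfolding irreducible_chain_def by blast
  ultimately show False by linarith
qed

end

section \<open>The central limit theorem for additive functionals\<close>

lemma cmod_iexp_scaled_diff:
  "cmod (iexp x * exp (complex_of_real a) - complex_of_real b * iexp x) = \<bar>exp a - b\<bar>"
proof -
  have alg: "z * u - v * z = (u - v) * z" for u v z :: complex by (simp add: left_diff_distrib)
  have "cmod (iexp x * exp (complex_of_real a) - complex_of_real b * iexp x) = cmod (complex_of_real (exp a - b)) * cmod (iexp x)"
    by (simp only: alg norm_mult exp_of_real of_real_diff)
  also have "\<dots> = \<bar>exp a - b\<bar>" by (simp only: norm_exp_i_times norm_of_real mult_1_right)
  finally show ?thesis .
qed

context markov_renewal_chain
begin

text \<open>The deterministic number M + 1 of steps replaces the random stopping index: since S n
  \<ge> n almost surely, time \<open>M\<close> has then been passed and the sum no longer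
  changes.\<close>

definition stopped :: "('e \<Rightarrow> 'e \<Rightarrow> nat \<Rightarrow> real) \<Rightarrow> nat \<Rightarrow> 'w \<Rightarrow> real" where
  "stopped \<phi> M \<omega> = stop_sum M \<phi> (hist (Suc M) \<omega>)"

lemma measurable_stopped [measurable]: "stopped \<phi> M \<in> borel_measurable (P i)"
  unfolding stopped_def[abs_def] by (rule measurable_hist_comp)

lemma stopped_bound:
  assumes "\<And>i j k. \<bar>\<phi> i j k\<bar> \<le> C"
  shows "\<bar>stopped \<phi> M \<omega>\<bar> \<le> C * real (Suc M)"
proof -
  have "0 \<le> C" using assms[of undefined undefined undefined] by linarith
  from stop_sum_abs_le[where \<phi> = \<phi>, OF assms this, of M "hist (Suc M) \<omega>"] show ?thesis
    by (simp add: stopped_def del: hist.simps)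
qed

definition centred :: "('e \<Rightarrow> 'e \<Rightarrow> nat \<Rightarrow> real) \<Rightarrow> bool" where
  "centred \<phi> \<longleftrightarrow> (\<exists>C. \<forall>i j k. \<bar>\<phi> i j k\<bar> \<le> C) \<and> (\<forall>i. (\<integral>y. \<phi> i (fst y) (snd y) \<partial>K i) = 0)"

lemma tight_stopped:
  assumes "centred \<phi>"
  shows "tight_rv (P i0) (\<lambda>M \<omega>. stopped \<phi> M \<omega> / sqrt (real M))"
proof -
  interpret prob_space "P i0" by (rule prob_space_P)
  obtain C where C: "\<And>i j k. \<bar>\<phi> i j k\<bar> \<le> C" and c: "\<And>i. (\<integral>y. \<phi> i (fst y) (snd y) \<partial>K i) = 0"
    using assms by (auto simp: centred_def)
  show ?thesis
  proof (rule tight_rv_if_second_moment)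
    show int: "integrable (P i0) (\<lambda>\<omega>. (stopped \<phi> M \<omega> / sqrt (real M))\<^sup>2)" for M
    proof (rule integrable_const_bound[where B = "(C * real (Suc M) / sqrt (real M))\<^sup>2"])
      show "AE \<omega> in P i0. norm ((stopped \<phi> M \<omega> / sqrt (real M))\<^sup>2) \<le> (C * real (Suc M) / sqrt (real M))\<^sup>2"
      proof (rule AE_I2)
        fix \<omega>
        have "\<bar>stopped \<phi> M \<omega> / sqrt (real M)\<bar> \<le> C * real (Suc M) / sqrt (real M)"
          using stopped_bound[where \<phi> = \<phi> and M = M and \<omega> = \<omega>, OF C] by (simp add: divide_right_mono)
        from power2_le_if_abs_le[OF this]
        show "norm ((stopped \<phi> M \<omega> / sqrt (real M))\<^sup>2) \<le> (C * real (Suc M) / sqrt (real M))\<^sup>2" by simp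
      qed
    qed simp
    show "(\<integral>\<omega>. (stopped \<phi> M \<omega> / sqrt (real M))\<^sup>2 \<partial>P i0) \<le> 2 * C\<^sup>2" for M
    proof (cases "M = 0")
      case False
      have "(\<integral>\<omega>. (stopped \<phi> M \<omega>)\<^sup>2 \<partial>P i0) = (\<integral>h. (stop_sum M \<phi> h)\<^sup>2 \<partial>path_pmf K i0 (Suc M))"
        unfolding stopped_def by (rule integral_hist)
      also have "\<dots> \<le> real (Suc M) * C\<^sup>2"
        by (rule stop_sum_second_moment[where \<phi> = \<phi>, OF C c])
      \<comment> \<open>This makes the bound proportional to \<open>M\<close>. At M = 0 the
        normalised sum is 0 by x / 0 = 0.\<close>
      also have "\<dots> \<le> (2 * real M) * C\<^sup>2" using False by (intro mult_right_mono) auto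
      finally show ?thesis using False by (simp add: power_divide field_simps)
    qed simp
  qed simp
qed

lemma lim_inverse_sqrt: "(\<lambda>M. 1 / sqrt (real M)) \<longlonglongrightarrow> 0"
  by (rule tendsto_divide_0[OF tendsto_const])
     (auto intro!: filterlim_at_top_imp_at_infinity filterlim_compose[OF sqrt_at_top] filterlim_real_sequentially)

lemma stopped_small:
  assumes "centred \<phi>"
  shows "tendsto_prob (P i0) (\<lambda>M \<omega>. stopped \<phi> M \<omega> / real M) 0"
proof -
  interpret prob_space "P i0" by (rule prob_space_P)
  have "tendsto_prob (P i0) (\<lambda>M \<omega>. (1 / sqrt (real M)) * (stopped \<phi> M \<omega> / sqrt (real M))) 0"
    by (rule tendsto_prob_mult_tight[OF tendsto_prob_lim[OF lim_inverse_sqrt] tight_stopped[OF assms]]) simp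
  then show ?thesis by simp
qed

end

locale positive_recurrent_markov_renewal_chain = markov_renewal_chain +
  assumes irreducible: "irreducible_chain P J"
    and pos_recurrent: "positive_recurrent_chain P J S"
begin

definition \<mu> :: "'a \<Rightarrow> real" where "\<mu> i = enn2real (mean_recurrence P J S i)"

lemma mean_hitting_K_finite: "mean_hitting K i j < \<infinity>"
proof (rule mean_hitting_finite)
  show "\<exists>n. \<exists>h\<in>set_pmf (path_pmf K i n). cur h = j" for j by (rule irreducible_path[OF irreducible])
  show "mean_hitting K i i < \<infinity>"
    using pos_recurrent by (simp add: positive_recurrent_chain_def mean_recurrence_eq)
qed

lemma \<mu>_eq: "\<mu> i = enn2real (mean_hitting K i i)"
  by (simp add: \<mu>_def mean_recurrence_eq)

lemma \<mu>_pos: "\<mu> i > 0"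
proof -
  have "1 = (\<integral>\<^sup>+y. 1 \<partial>K i)" by (simp add: measure_pmf.emeasure_space_1)
  also have "\<dots> \<le> mean_sojourn K i"
    unfolding mean_sojourn_def
  proof (rule nn_integral_mono_AE, unfold AE_measure_pmf_iff, rule ballI)
    fix y assume "y \<in> set_pmf (K i)"
    from K_pos[OF this] show "(1::ennreal) \<le> of_nat (snd y)" by (metis of_nat_1 of_nat_mono)
  qed
  also have "\<dots> \<le> mean_hitting K i i" by (subst mean_hitting_first_step) simp
  finally have "1 \<le> mean_hitting K i i" .
  then have "mean_hitting K i i \<noteq> 0" by auto
  with mean_hitting_K_finite[of i i] show ?thesis by (simp add: \<mu>_eq enn2real_positive_iff zero_less_iff_neq_zero less_top)
qed

definition from_state :: "'a \<Rightarrow> 'a \<Rightarrow> 'a \<Rightarrow> nat \<Rightarrow> real" where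
  "from_state i i' j k = (if i' = i then 1 else 0)"

lemma visits_frequency: "tendsto_prob (P i0) (\<lambda>M \<omega>. stopped (from_state i) M \<omega> / real M) (1 / \<mu> i)"
proof -
  interpret prob_space "P i0" by (rule prob_space_P)
  let ?n = "stopped (from_state i)"
  have 1: "tendsto_prob (P i0) (\<lambda>M \<omega>. (real M - \<mu> i * ?n M \<omega>) / real (Suc M)) 0"
  proof (rule tendsto_prob_if_nn_integral)
    fix r :: real assume r: "r > 0"
    have "eventually (\<lambda>M. (\<integral>\<^sup>+h. ennreal \<bar>real M - enn2real (mean_hitting K i i) *
        stop_sum M (\<lambda>i' j k. if i' = i then 1 else 0) h\<bar> \<partial>path_pmf K i0 (Suc M)) \<le> ennreal (r * real (Suc M))) sequentially"
      by (rule visits_lln[OF _ _ r]) (rule K_pos, assumption, rule mean_hitting_K_finite)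
    then show "eventually (\<lambda>M. (\<integral>\<^sup>+\<omega>. ennreal \<bar>(real M - \<mu> i * ?n M \<omega>) / real (Suc M) - 0\<bar> \<partial>P i0) \<le> ennreal r) sequentially"
    proof (rule eventually_mono)
      fix M
      assume *: "(\<integral>\<^sup>+h. ennreal \<bar>real M - enn2real (mean_hitting K i i) *
        stop_sum M (\<lambda>i' j k. if i' = i then 1 else 0) h\<bar> \<partial>path_pmf K i0 (Suc M)) \<le> ennreal (r * real (Suc M))"
      have "(\<integral>\<^sup>+\<omega>. ennreal \<bar>(real M - \<mu> i * ?n M \<omega>) / real (Suc M) - 0\<bar> \<partial>P i0) =
          (\<integral>\<^sup>+\<omega>. ennreal (1 / real (Suc M)) * ennreal \<bar>real M - \<mu> i * ?n M \<omega>\<bar> \<partial>P i0)"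
        by (intro nn_integral_cong) (simp add: ennreal_mult[symmetric] abs_divide)
      also have "\<dots> = ennreal (1 / real (Suc M)) * (\<integral>\<^sup>+\<omega>. ennreal \<bar>real M - \<mu> i * ?n M \<omega>\<bar> \<partial>P i0)"
        by (rule nn_integral_cmult) simp
      also have "(\<integral>\<^sup>+\<omega>. ennreal \<bar>real M - \<mu> i * ?n M \<omega>\<bar> \<partial>P i0) =
          (\<integral>\<^sup>+h. ennreal \<bar>real M - \<mu> i * stop_sum M (from_state i) h\<bar> \<partial>path_pmf K i0 (Suc M))"
        unfolding stopped_def by (rule nn_integral_hist)
      also have "ennreal (1 / real (Suc M)) * \<dots> \<le> ennreal (1 / real (Suc M)) * ennreal (r * real (Suc M))"
        using * by (intro mult_left_mono) (simp_all add: \<mu>_eq from_state_def[abs_def] del: path_pmf.simps)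
      also have "\<dots> = ennreal r" using r by (subst ennreal_mult[symmetric]) auto
      finally show "(\<integral>\<^sup>+\<omega>. ennreal \<bar>(real M - \<mu> i * ?n M \<omega>) / real (Suc M) - 0\<bar> \<partial>P i0) \<le> ennreal r" .
    qed
  qed simp
  have 2: "(\<lambda>M. real (Suc M) / real M) \<longlonglongrightarrow> 1" by (rule LIMSEQ_Suc_n_over_n)
  \<comment> \<open>The value 0 at M = 0 makes the identity \<open>eq\<close> hold there too, where
    both sides involve a division by 0.\<close>
  have 3: "(\<lambda>M. if M = 0 then 0 else 1) \<longlonglongrightarrow> (1::real)"
    by (rule tendsto_eventually) (auto simp: eventually_sequentially intro!: exI[of _ 1])
  have lim: "tendsto_prob (P i0) (\<lambda>M \<omega>. (1 / \<mu> i) * ((if M = 0 then 0 else 1) -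
      (real (Suc M) / real M) * ((real M - \<mu> i * ?n M \<omega>) / real (Suc M)))) ((1 / \<mu> i) * (1 - 1 * 0))"
    by (intro tendsto_prob_cmult tendsto_prob_diff tendsto_prob_mult tendsto_prob_lim 1 2 3)
  have eq: "(1 / \<mu> i) * ((if M = 0 then 0 else 1) -
      (real (Suc M) / real M) * ((real M - \<mu> i * ?n M \<omega>) / real (Suc M))) = ?n M \<omega> / real M" for M \<omega>
  proof (cases "M = 0")
    case False
    have "(1 / m) * (1 - (y / x) * ((x - m * z) / y)) = z / x" if "x > 0" "y > 0" "m > 0" for x y z m :: real
      using that by (simp add: field_simps)
    from this[of "real M" "real (Suc M)" "\<mu> i" "?n M \<omega>"] False \<mu>_pos[of i] show ?thesis
      by (simp del: of_nat_Suc)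
  qed simp
  have "(1 / \<mu> i) * (1 - 1 * 0) = 1 / \<mu> i" by simp
  with lim show ?thesis unfolding eq by (simp only:)
qed

text \<open>The compensated exponential has mean tending to 1. Its compensator exp (V / 2) is
  bounded and tends in probability to the constant exp (\<tau> / 2), which may therefore be taken
  out of the mean and divided off.\<close>

theorem stopped_clt:
  assumes "centred \<phi>"
  shows "(\<lambda>M. \<integral>\<omega>. iexp (stopped \<phi> M \<omega> / sqrt (real M)) \<partial>P i0) \<longlonglongrightarrow>
    complex_of_real (exp (- (\<Sum>i\<in>UNIV. (1 / \<mu> i) * (\<integral>y. (\<phi> i (fst y) (snd y))\<^sup>2 \<partial>K i)) / 2))"
proof -
  interpret prob_space "P i0" by (rule prob_space_P)
  obtain C where C: "\<And>i j k. \<bar>\<phi> i j k\<bar> \<le> C" and c: "\<And>i. (\<integral>y. \<phi> i (fst y) (snd y) \<partial>K i) = 0"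
    using assms by (auto simp: centred_def)
  have C0: "0 \<le> C" using C[of undefined undefined undefined] by linarith
  define v where "v i = (\<integral>y. (\<phi> i (fst y) (snd y))\<^sup>2 \<partial>K i)" for i
  have i2: "integrable (K i) (\<lambda>y. (\<phi> i (fst y) (snd y))\<^sup>2)" for i
    by (rule integrable_pmf_bounded[where B = "C\<^sup>2"]) (simp add: power2_le_if_abs_le C)
  have v: "0 \<le> v i" "v i \<le> C\<^sup>2" for i
    unfolding v_def
    by (intro integral_nonneg_AE, simp, intro expectation_pmf_le i2 power2_le_if_abs_le C)
  define V where "V M \<omega> = stopped (\<lambda>i j k. v i) M \<omega> / real M" for M \<omega>
  define \<tau> where "\<tau> = (\<Sum>i\<in>UNIV. (1 / \<mu> i) * v i)"
  have V_lim: "tendsto_prob (P i0) V \<tau>"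
  proof -
    have "(\<lambda>i' j k. v i') = (\<lambda>i' j k. \<Sum>i\<in>UNIV. v i * from_state i i' j k)"
      by (simp add: from_state_def fun_eq_iff if_distrib[of "\<lambda>z. _ * z"] cong: if_cong)
    then have "V = (\<lambda>M \<omega>. \<Sum>i\<in>UNIV. v i * (stopped (from_state i) M \<omega> / real M))"
      unfolding V_def[abs_def] stopped_def
      by (simp only: stop_sum_sum stop_sum_cmult sum_divide_distrib times_divide_eq_right)
    moreover have "tendsto_prob (P i0) (\<lambda>M \<omega>. \<Sum>i\<in>UNIV. v i * (stopped (from_state i) M \<omega> / real M)) (\<Sum>i\<in>UNIV. v i * (1 / \<mu> i))"
      by (intro tendsto_prob_sum tendsto_prob_cmult visits_frequency)
    ultimately show ?thesis by (simp add: \<tau>_def mult.commute)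
  qed
  have V_bound: "0 \<le> V M \<omega>" "V M \<omega> \<le> 2 * C\<^sup>2" for M \<omega>
  proof -
    show "0 \<le> V M \<omega>" unfolding V_def stopped_def by (intro divide_nonneg_nonneg stop_sum_nonneg v) simp
    show "V M \<omega> \<le> 2 * C\<^sup>2"
    proof (cases "M = 0")
      case False
      have "stopped (\<lambda>i j k. v i) M \<omega> \<le> C\<^sup>2 * real (Suc M)"
        using stopped_bound[of "\<lambda>i j k. v i" "C\<^sup>2" M \<omega>] v by (simp add: abs_le_iff)
      also have "\<dots> \<le> C\<^sup>2 * (2 * real M)" using False by (intro mult_left_mono) auto
      finally show ?thesis using False by (simp add: V_def field_simps)
    qed (simp add: V_def)
  qed
  let ?X = "\<lambda>M \<omega>. stopped \<phi> M \<omega> / sqrt (real M)"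
  have expV: "tendsto_prob (P i0) (\<lambda>M \<omega>. exp (V M \<omega> / 2)) (exp (\<tau> / 2))"
    by (rule tendsto_prob_cont1[OF V_lim]) (auto intro!: continuous_intros)
  have expV_bound: "\<bar>exp (V M \<omega> / 2)\<bar> \<le> exp (C\<^sup>2)" for M \<omega> using V_bound[of M \<omega>] by simp
  have diff0: "(\<lambda>M. \<integral>\<omega>. \<bar>exp (V M \<omega> / 2) - exp (\<tau> / 2)\<bar> \<partial>P i0) \<longlonglongrightarrow> 0"
    by (rule tendsto_prob_bounded_integral[OF expV expV_bound])
  have one: "(\<lambda>M. \<integral>\<omega>. iexp (?X M \<omega>) * exp (complex_of_real (V M \<omega> / 2)) \<partial>P i0) \<longlonglongrightarrow> 1"
  proof (rule LIM_zero_cancel, rule Lim_null_comparison)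
    let ?b = "\<lambda>M. real (Suc M) * (6 * (1 / sqrt (real M) * C) ^ 3 * exp (real (Suc M) * (1 / sqrt (real M) * C)\<^sup>2))"
    have "eventually (\<lambda>M. 1 / sqrt (real M) * C < 1) sequentially"
      using tendsto_mult[OF lim_inverse_sqrt tendsto_const, of C] by (intro order_tendstoD(2)) auto
    then show "eventually (\<lambda>M. norm ((\<integral>\<omega>. iexp (?X M \<omega>) * exp (complex_of_real (V M \<omega> / 2)) \<partial>P i0) - 1) \<le> ?b M) sequentially"
    proof (rule eventually_mono)
      fix M assume M: "1 / sqrt (real M) * C < 1"
      let ?s = "1 / sqrt (real M)"
      have "(\<integral>\<omega>. iexp (?X M \<omega>) * exp (complex_of_real (V M \<omega> / 2)) \<partial>P i0) =
        (\<integral>\<omega>. iexp (?s * stop_sum M \<phi> (hist (Suc M) \<omega>)) *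
          exp (complex_of_real (?s\<^sup>2 * stop_sum M (\<lambda>i j k. v i) (hist (Suc M) \<omega>) / 2)) \<partial>P i0)"
        by (intro Bochner_Integration.integral_cong refl) (simp add: V_def stopped_def power_divide)
      also have "\<dots> = (\<integral>h. iexp (?s * stop_sum M \<phi> h) *
          exp (complex_of_real (?s\<^sup>2 * stop_sum M (\<lambda>i j k. v i) h / 2)) \<partial>path_pmf K i0 (Suc M))"
        by (rule integral_hist)
      finally have eq: "(\<integral>\<omega>. iexp (?X M \<omega>) * exp (complex_of_real (V M \<omega> / 2)) \<partial>P i0) =
        (\<integral>h. iexp (?s * stop_sum M \<phi> h) *
          exp (complex_of_real (?s\<^sup>2 * stop_sum M (\<lambda>i j k. v i) h / 2)) \<partial>path_pmf K i0 (Suc M))" .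
      show "norm ((\<integral>\<omega>. iexp (?X M \<omega>) * exp (complex_of_real (V M \<omega> / 2)) \<partial>P i0) - 1) \<le> ?b M"
        unfolding eq by (rule stop_sum_char[where \<phi> = \<phi>]) (use C c M in \<open>simp_all add: v_def\<close>)
    qed
    have "?b M = 6 * C ^ 3 * (1 / sqrt (real M)) * (real (Suc M) / real M) * exp (C\<^sup>2 * (real (Suc M) / real M))" for M
      by (cases "M = 0") (simp_all add: power_mult_distrib power_divide power3_eq_cube power2_eq_square field_simps del: of_nat_Suc)
    moreover have "(\<lambda>M. 6 * C ^ 3 * (1 / sqrt (real M)) * (real (Suc M) / real M) * exp (C\<^sup>2 * (real (Suc M) / real M)))
        \<longlonglongrightarrow> 6 * C ^ 3 * 0 * 1 * exp (C\<^sup>2 * 1)"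
      by (intro tendsto_intros lim_inverse_sqrt LIMSEQ_Suc_n_over_n)
    ultimately show "?b \<longlonglongrightarrow> 0" by simp
  qed
  have le: "cmod ((\<integral>\<omega>. iexp (?X M \<omega>) * exp (complex_of_real (V M \<omega> / 2)) \<partial>P i0) -
      exp (\<tau> / 2) * (\<integral>\<omega>. iexp (?X M \<omega>) \<partial>P i0)) \<le> (\<integral>\<omega>. \<bar>exp (V M \<omega> / 2) - exp (\<tau> / 2)\<bar> \<partial>P i0)" for M
  proof -
    have [measurable]: "V M \<in> borel_measurable (P i0)" using V_lim by (rule tendsto_prob_measurable)
    have iX: "integrable (P i0) (\<lambda>\<omega>. iexp (?X M \<omega>))"
      by (rule integrable_const_bound[where B = 1]) auto
    have iXV: "integrable (P i0) (\<lambda>\<omega>. iexp (?X M \<omega>) * exp (complex_of_real (V M \<omega> / 2)))"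
    proof (rule integrable_const_bound[where B = "exp (C\<^sup>2)"])
      show "AE \<omega> in P i0. cmod (iexp (?X M \<omega>) * exp (complex_of_real (V M \<omega> / 2))) \<le> exp (C\<^sup>2)"
      proof (rule AE_I2)
        fix \<omega>
        have "cmod (iexp (?X M \<omega>) * exp (complex_of_real (V M \<omega> / 2))) = exp (V M \<omega> / 2)"
          unfolding exp_of_real norm_mult norm_of_real norm_exp_i_times by simp
        then show "cmod (iexp (?X M \<omega>) * exp (complex_of_real (V M \<omega> / 2))) \<le> exp (C\<^sup>2)"
          using V_bound(2)[of M \<omega>] by simp
      qed
    qed measurable
    have d: "(\<integral>\<omega>. iexp (?X M \<omega>) * exp (complex_of_real (V M \<omega> / 2)) \<partial>P i0) -
        exp (\<tau> / 2) * (\<integral>\<omega>. iexp (?X M \<omega>) \<partial>P i0) =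
        (\<integral>\<omega>. iexp (?X M \<omega>) * exp (complex_of_real (V M \<omega> / 2)) - complex_of_real (exp (\<tau> / 2)) * iexp (?X M \<omega>) \<partial>P i0)"
      by (subst Bochner_Integration.integral_diff[OF iXV]) (use iX in \<open>simp_all only: integrable_mult_right integral_mult_right_zero\<close>)
    have "cmod ((\<integral>\<omega>. iexp (?X M \<omega>) * exp (complex_of_real (V M \<omega> / 2)) \<partial>P i0) -
        exp (\<tau> / 2) * (\<integral>\<omega>. iexp (?X M \<omega>) \<partial>P i0)) \<le> (\<integral>\<omega>. cmod (iexp (?X M \<omega>) * exp (complex_of_real (V M \<omega> / 2)) -
        complex_of_real (exp (\<tau> / 2)) * iexp (?X M \<omega>)) \<partial>P i0)"
      unfolding d by (rule integral_norm_bound)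
    also have "\<dots> = (\<integral>\<omega>. \<bar>exp (V M \<omega> / 2) - exp (\<tau> / 2)\<bar> \<partial>P i0)"
      by (rule Bochner_Integration.integral_cong[OF refl]) (rule cmod_iexp_scaled_diff)
    finally show ?thesis .
  qed
  have "(\<lambda>M. (\<integral>\<omega>. iexp (?X M \<omega>) * exp (complex_of_real (V M \<omega> / 2)) \<partial>P i0) -
      exp (\<tau> / 2) * (\<integral>\<omega>. iexp (?X M \<omega>) \<partial>P i0)) \<longlonglongrightarrow> 0"
    by (rule Lim_null_comparison[OF always_eventually[OF allI[OF le]] diff0])
  from tendsto_diff[OF one this]
  have "(\<lambda>M. complex_of_real (exp (\<tau> / 2)) * (\<integral>\<omega>. iexp (?X M \<omega>) \<partial>P i0)) \<longlonglongrightarrow> 1" by simp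
  from tendsto_mult[OF tendsto_const[of "complex_of_real (exp (- \<tau> / 2))"] this]
  have "(\<lambda>M. complex_of_real (exp (- \<tau> / 2) * exp (\<tau> / 2)) * (\<integral>\<omega>. iexp (?X M \<omega>) \<partial>P i0)) \<longlonglongrightarrow> complex_of_real (exp (- \<tau> / 2))"
    unfolding of_real_mult mult.assoc mult_1_right .
  moreover have "exp (- \<tau> / 2) * exp (\<tau> / 2) = 1" using exp_minus_inverse[of "\<tau> / 2"] by (simp add: mult.commute)
  ultimately have "(\<lambda>M. \<integral>\<omega>. iexp (?X M \<omega>) \<partial>P i0) \<longlonglongrightarrow> complex_of_real (exp (- \<tau> / 2))"
    by (simp only: of_real_1 mult_1)
  then show ?thesis unfolding \<tau>_def v_def .
qed

end

section \<open>Convolution equations and the influence of a transition\<close>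

lemma conv_vec_apply: "conv_vec U A r (i, k) = (\<Sum>l\<le>k. \<Sum>u\<in>U. A i u l * r (u, k - l))"
  by (simp add: conv_vec_def)

lemma conv_vec_cong:
  assumes "\<And>u l. u \<in> U \<Longrightarrow> l \<le> k \<Longrightarrow> r (u, l) = r' (u, l)"
  shows "conv_vec U A r (i, k) = conv_vec U A r' (i, k)"
  unfolding conv_vec_apply by (intro sum.cong refl) (simp add: assms)

lemma conv_vec_add:
  "conv_vec U A (\<lambda>e. r e + s e) (i, k) = conv_vec U A r (i, k) + conv_vec U A s (i, k)"
  by (simp add: conv_vec_apply distrib_left sum.distrib)

lemma conv_vec_diff:
  "conv_vec U A (\<lambda>e. r e - s e) (i, k) = conv_vec U A r (i, k) - conv_vec U A s (i, k)"
  by (simp add: conv_vec_apply right_diff_distrib sum_subtractf)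

text \<open>Both sides sum \<open>f\<close> over all triples of times with sum \<open>k\<close>; the
  reindexing is the one behind associativity of products of formal power series.\<close>

lemma conv_vec_conv_mat:
  "conv_vec U (conv_mat U A B) r (i, k) = conv_vec U A (conv_vec U B r) (i, k)"
proof -
  define f where "f l m p = (\<Sum>v\<in>U. \<Sum>u\<in>U. A i v l * B v u m * r (u, p))" for l m p
  have lhs: "(\<Sum>u\<in>U. conv_mat U A B i u l * r (u, k - l)) = (\<Sum>m\<le>l. f m (l - m) (k - l))" for l
  proof -
    have "(\<Sum>u\<in>U. conv_mat U A B i u l * r (u, k - l)) =
        (\<Sum>u\<in>U. \<Sum>m\<le>l. \<Sum>v\<in>U. A i v m * B v u (l - m) * r (u, k - l))"
      by (simp only: conv_mat_def sum_distrib_right)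
    also have "\<dots> = (\<Sum>m\<le>l. \<Sum>u\<in>U. \<Sum>v\<in>U. A i v m * B v u (l - m) * r (u, k - l))"
      by (rule sum.swap)
    also have "\<dots> = (\<Sum>m\<le>l. f m (l - m) (k - l))"
      unfolding f_def by (rule sum.cong[OF refl]) (rule sum.swap)
    finally show ?thesis .
  qed
  have rhs: "(\<Sum>u\<in>U. A i u l * conv_vec U B r (u, k - l)) = (\<Sum>m\<le>k - l. f l m (k - l - m))" for l
  proof -
    have "(\<Sum>u\<in>U. A i u l * conv_vec U B r (u, k - l)) =
        (\<Sum>u\<in>U. \<Sum>m\<le>k - l. \<Sum>v\<in>U. A i u l * B u v m * r (v, k - l - m))"
      by (simp only: conv_vec_apply sum_distrib_left mult.assoc)
    also have "\<dots> = (\<Sum>m\<le>k - l. f l m (k - l - m))"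
      unfolding f_def by (rule sum.swap)
    finally show ?thesis .
  qed
  show ?thesis
    unfolding conv_vec_apply[of U "conv_mat U A B"] conv_vec_apply[of U A] lhs rhs
    using fps_mult_assoc_lemma[of f k k] by (simp only: atLeast0AtMost)
qed

lemma conv_pow_eq_0:
  assumes "\<And>i j. A i j 0 = 0"
  shows "k < n \<Longrightarrow> conv_pow U A n i j k = 0"
proof (induction n arbitrary: i k)
  case (Suc n)
  have "A i u l * conv_pow U A n u j (k - l) = 0" if "l \<le> k" for u l
    using Suc that by (cases "l = 0") (auto simp: assms)
  then show ?case unfolding conv_pow.simps conv_mat_def by (intro sum.neutral ballI) simp
qed simp

lemma conv_inv_eq_sum:
  assumes "\<And>i j. A i j 0 = 0" "k \<le> m"
  shows "conv_inv U A i j k = (\<Sum>n\<le>m. conv_pow U A n i j k)"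
  unfolding conv_inv_def using assms
  by (intro suminf_finite) (auto intro!: conv_pow_eq_0)

text \<open>Up to time \<open>k\<close> powers beyond \<open>k\<close> vanish, so the series is a
  finite sum; multiplication by \<open>A\<close> shifts it by one, and the additional power
  \<open>Suc k\<close> is 0.\<close>

lemma conv_inv_unfold:
  assumes A0: "\<And>i j. A i j 0 = 0"
  shows "conv_inv U A i j k = conv_one i j k + conv_mat U A (conv_inv U A) i j k"
proof -
  have "conv_mat U A (conv_inv U A) i j k = (\<Sum>l\<le>k. \<Sum>u\<in>U. A i u l * (\<Sum>n\<le>k. conv_pow U A n u j (k - l)))"
    unfolding conv_mat_def by (intro sum.cong refl) (simp add: conv_inv_eq_sum[where A = A, OF A0, of _ k])
  also have "\<dots> = (\<Sum>l\<le>k. \<Sum>n\<le>k. \<Sum>u\<in>U. A i u l * conv_pow U A n u j (k - l))"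
    unfolding sum_distrib_left by (rule sum.cong[OF refl]) (rule sum.swap)
  also have "\<dots> = (\<Sum>n\<le>k. conv_pow U A (Suc n) i j k)"
    unfolding conv_pow.simps conv_mat_def by (rule sum.swap)
  also have "conv_one i j k + \<dots> = (\<Sum>n\<le>Suc k. conv_pow U A n i j k)"
    by (simp only: sum.atMost_Suc_shift conv_pow.simps(1))
  also have "\<dots> = conv_inv U A i j k" by (rule conv_inv_eq_sum[where A = A, symmetric]) (simp_all add: A0)
  finally show ?thesis by simp
qed

lemma conv_vec_conv_one: "finite U \<Longrightarrow> i \<in> U \<Longrightarrow> conv_vec U conv_one r (i, k) = r (i, k)"
proof -
  assume "finite U" "i \<in> U"
  have "(\<Sum>u\<in>U. conv_one i u l * r (u, k - l)) = (if l = 0 then r (i, k) else 0)" for l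
  proof -
    have "conv_one i u l * r (u, k - l) = (if u = i then if l = 0 then r (i, k) else 0 else 0)" for u
      by (simp add: conv_one_def)
    then show ?thesis using \<open>finite U\<close> \<open>i \<in> U\<close> by (simp add: sum.delta)
  qed
  then show ?thesis by (simp add: conv_vec_apply)
qed

lemma conv_inv_solves:
  assumes A0: "\<And>i j. A i j 0 = 0" and "finite U" "i \<in> U"
  shows "conv_vec U (conv_inv U A) r (i, k) = r (i, k) + conv_vec U A (conv_vec U (conv_inv U A) r) (i, k)"
proof -
  have "conv_vec U (conv_inv U A) r (i, k) =
      conv_vec U conv_one r (i, k) + conv_vec U (conv_mat U A (conv_inv U A)) r (i, k)"
    unfolding conv_vec_apply
    by (subst conv_inv_unfold[where A = A, OF A0]) (simp add: distrib_right sum.distrib)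
  then show ?thesis by (simp add: conv_vec_conv_one assms conv_vec_conv_mat)
qed

text \<open>Since \<open>A\<close> vanishes at time 0, the convolution at time \<open>k\<close>
  involves the unknown at earlier times only, and induction on time applies.\<close>

lemma conv_equation_unique:
  assumes A0: "\<And>i j. A i j 0 = 0"
    and x: "\<And>i k. i \<in> U \<Longrightarrow> x (i, k) = r (i, k) + conv_vec U A x (i, k)"
    and y: "\<And>i k. i \<in> U \<Longrightarrow> y (i, k) = r (i, k) + conv_vec U A y (i, k)"
  shows "i \<in> U \<Longrightarrow> x (i, k) = y (i, k)"
proof (induction k arbitrary: i rule: less_induct)
  case (less k)
  have "conv_vec U A x (i, k) = conv_vec U A y (i, k)"
    unfolding conv_vec_apply
  proof (intro sum.cong refl)
    fix l u assume "l \<in> {..k}" "u \<in> U"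
    then show "A i u l * x (u, k - l) = A i u l * y (u, k - l)"
      using less.IH[of "k - l" u] by (cases "l = 0") (auto simp: A0)
  qed
  with x[OF less.prems] y[OF less.prems] show ?case by simp
qed

text \<open>For the kernel, the n-th iterate is the contribution of paths with \<open>n\<close>
  transitions inside \<open>U\<close>; this links the algebraic inverse with the sample
  paths.\<close>

lemma conv_inv_eq_iterate:
  assumes A0: "\<And>i j. A i j 0 = 0" and U: "finite U" "i \<in> U"
  shows "conv_vec U (conv_inv U A) r (i, k) = (\<Sum>n\<le>k. (conv_vec U A ^^ n) r (i, k))"
proof -
  have pow: "conv_vec U (conv_pow U A n) r (i, k) = (conv_vec U A ^^ n) r (i, k)" if "i \<in> U" for n i k
    using that
  proof (induction n arbitrary: i k)
    case (Suc n)
    have "conv_vec U (conv_pow U A (Suc n)) r (i, k) = conv_vec U A (conv_vec U (conv_pow U A n) r) (i, k)"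
      by (simp add: conv_vec_conv_mat)
    also have "\<dots> = conv_vec U A ((conv_vec U A ^^ n) r) (i, k)"
      by (rule conv_vec_cong) (rule Suc.IH)
    finally show ?case by simp
  qed (simp add: conv_vec_conv_one U)
  have "conv_vec U (conv_inv U A) r (i, k) = (\<Sum>n\<le>k. conv_vec U (conv_pow U A n) r (i, k))"
  proof -
    have "conv_vec U (conv_inv U A) r (i, k) = (\<Sum>l\<le>k. \<Sum>u\<in>U. (\<Sum>n\<le>k. conv_pow U A n i u l) * r (u, k - l))"
      unfolding conv_vec_apply by (intro sum.cong refl) (simp add: conv_inv_eq_sum[where A = A, OF A0, of _ k])
    also have "\<dots> = (\<Sum>l\<le>k. \<Sum>n\<le>k. \<Sum>u\<in>U. conv_pow U A n i u l * r (u, k - l))"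
      unfolding sum_distrib_right by (rule sum.cong[OF refl]) (rule sum.swap)
    also have "\<dots> = (\<Sum>n\<le>k. conv_vec U (conv_pow U A n) r (i, k))"
      unfolding conv_vec_apply by (rule sum.swap)
    finally show ?thesis .
  qed
  then show ?thesis by (simp add: pow U)
qed

section \<open>The derivative of the reliability in the direction of a change of the kernel\<close>

lemma tail_op_delta:
  "tail_op (delta_seq (i', j', l')) i i k = (if i = i' \<and> k < l' then 1 else 0)" for i' :: "'e::finite"
proof -
  have "(\<Sum>j\<in>UNIV. \<Sum>k'\<in>{k<..N}. delta_seq (i', j', l') i j k') = (if i = i' \<and> k < l' then 1 else 0)"
    if "N \<ge> l'" for N
  proof -
    have "delta_seq (i', j', l') i j k' = (if j = j' then if k' = l' then if i = i' then 1 else 0 else 0 else 0)" for j k'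
      by (simp add: delta_seq_def)
    then have "(\<Sum>k'\<in>{k<..N}. delta_seq (i', j', l') i j k') = (if j = j' then if i = i' \<and> k < l' then 1 else 0 else 0)" for j
      using that by (simp add: sum.delta)
    then show ?thesis by (simp add: sum.delta)
  qed
  then have "(\<lambda>N. \<Sum>j\<in>UNIV. \<Sum>k'\<in>{k<..N}. delta_seq (i', j', l') i j k') \<longlonglongrightarrow> (if i = i' \<and> k < l' then 1 else 0)"
    by (intro tendsto_eventually eventually_sequentiallyI[of l'])
  then show ?thesis unfolding tail_op_def by (simp add: limI)
qed

lemma tail_op_q_row: "tail_op (q_row q i') i i k = (if i = i' then tail_op q i i k else 0)"
  by (simp add: tail_op_def q_row_def)

text \<open>This is the formal derivative at \<open>q\<close>, in direction \<open>B\<close>, of the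
  map sending \<open>A\<close> to its convolution inverse applied to its tail. Taking out the left
  factor shows it as the solution of a renewal equation with source \<open>B\<close> applied to the
  survival sequence plus the tail of \<open>B\<close>.\<close>

lemma full_term_eq:
  "full_term U q B (i, k) = conv_vec U (conv_inv U q)
     (\<lambda>e. conv_vec U B (conv_vec U (conv_inv U q) (diag_seq (tail_op q))) e + diag_seq (tail_op B) e) (i, k)"
proof -
  have "conv_vec U (conv_mat U (conv_mat U (conv_inv U q) B) (conv_inv U q)) (diag_seq (tail_op q)) (i, k) =
      conv_vec U (conv_inv U q) (conv_vec U B (conv_vec U (conv_inv U q) (diag_seq (tail_op q)))) (i, k)"
    by (simp add: conv_vec_conv_mat)
  then show ?thesis by (simp add: full_term_def tail_term_def conv_vec_add)
qed

context markov_renewal_chain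
begin

lemma q_zero: "q i j 0 = 0"
  using kernel by (simp add: semi_markov_kernel_def)

lemma integral_K_indicator: "(\<integral>y. (if fst y = j \<and> snd y = k then 1 else 0) \<partial>K i) = q i j k"
proof -
  have "(\<integral>y. (if fst y = j \<and> snd y = k then 1 else 0) \<partial>K i) = (\<integral>y. indicat_real {(j, k)} y \<partial>K i)"
    by (intro Bochner_Integration.integral_cong) (auto split: split_indicator)
  then show ?thesis by (simp add: measure_pmf_single pmf_K)
qed

lemma tail_op_q: "tail_op q i i k = (\<integral>y. (if k < snd y then 1 else 0) \<partial>K i)"
proof -
  have fin: "(\<Sum>j\<in>UNIV. \<Sum>k'\<in>{k<..N}. q i j k') = measure (K i) (UNIV \<times> {k<..N})" for N
  proof -
    have "measure (K i) (UNIV \<times> {k<..N}) = (\<Sum>(j, k')\<in>UNIV \<times> {k<..N}. pmf (K i) (j, k'))"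
      by (subst measure_measure_pmf_finite) (simp_all add: case_prod_unfold)
    then show ?thesis by (simp add: sum.cartesian_product pmf_K)
  qed
  have "(\<lambda>N. measure (K i) (UNIV \<times> {k<..N})) \<longlonglongrightarrow> measure (K i) (\<Union>N. UNIV \<times> {k<..N})"
    by (rule measure_pmf.finite_Lim_measure_incseq) (auto simp: incseq_def)
  also have "(\<Union>N. UNIV \<times> {k<..N}) = {y :: 'e \<times> nat. k < snd y}" by auto
  finally have "tail_op q i i k = measure (K i) {y. k < snd y}"
    unfolding tail_op_def fin by (simp add: limI)
  also have "\<dots> = (\<integral>y. indicat_real {y. k < snd y} y \<partial>K i)" by simp
  also have "\<dots> = (\<integral>y. (if k < snd y then 1 else 0) \<partial>K i)"
    by (intro Bochner_Integration.integral_cong) (auto split: split_indicator)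
  finally show ?thesis .
qed

text \<open>With \<open>r\<close> the reliability, this is the conditional survival probability beyond time \<open>k\<close> given the
  first transition \<open>(j, l)\<close>.\<close>

definition one_step :: "'e set \<Rightarrow> 'e vseq \<Rightarrow> nat \<Rightarrow> 'e \<times> nat \<Rightarrow> real" where
  "one_step U r k y = (if snd y \<le> k \<and> fst y \<in> U then r (fst y, k - snd y) else 0) + (if k < snd y then 1 else 0)"

text \<open>A finite combination of point indicators plus one tail indicator: any linear average,
  under the kernel or over the observed transitions, turns this into a convolution plus a
  tail.\<close>

lemma one_step_eq_sum:
  "one_step U r k y = (\<Sum>l\<le>k. \<Sum>u\<in>U. (if fst y = u \<and> snd y = l then 1 else 0) * r (u, k - l))
     + (if k < snd y then 1 else 0)"
proof -
  have "(\<Sum>u\<in>U. (if fst y = u \<and> snd y = l then 1 else 0) * r (u, k - l)) =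
      (if l = snd y then if fst y \<in> U then r (fst y, k - snd y) else 0 else 0)" for l
  proof -
    have "(if fst y = u \<and> snd y = l then 1 else 0) * r (u, k - l) =
        (if u = fst y then if l = snd y then r (fst y, k - snd y) else 0 else 0)" for u by auto
    then show ?thesis by (simp add: sum.delta)
  qed
  then show ?thesis by (simp add: one_step_def sum.delta)
qed

lemma one_step_bounded: "\<exists>C. \<forall>y. \<bar>one_step U r k y\<bar> \<le> C"
proof -
  have "\<bar>one_step U r k y\<bar> \<le> (\<Sum>l\<le>k. \<Sum>u\<in>U. \<bar>r (u, k - l)\<bar>) + 1" for y
  proof -
    have "\<bar>one_step U r k y\<bar> \<le> \<bar>\<Sum>l\<le>k. \<Sum>u\<in>U. (if fst y = u \<and> snd y = l then 1 else 0) * r (u, k - l)\<bar> + 1"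
      unfolding one_step_eq_sum by (rule order_trans[OF abs_triangle_ineq]) auto
    also have "\<bar>\<Sum>l\<le>k. \<Sum>u\<in>U. (if fst y = u \<and> snd y = l then 1 else 0) * r (u, k - l)\<bar> \<le>
        (\<Sum>l\<le>k. \<Sum>u\<in>U. \<bar>r (u, k - l)\<bar>)"
      by (rule order_trans[OF sum_abs], intro sum_mono, rule order_trans[OF sum_abs], intro sum_mono) auto
    finally show ?thesis by simp
  qed
  then show ?thesis by blast
qed

lemma integrable_one_step: "integrable (K i) (one_step U r k)"
proof -
  obtain C where "\<And>y. \<bar>one_step U r k y\<bar> \<le> C" using one_step_bounded by blast
  then show ?thesis by (intro integrable_pmf_bounded[where B = C]) simp
qed

lemma integral_one_step:
  "(\<integral>y. one_step U r k y \<partial>K i) = conv_vec U q r (i, k) + diag_seq (tail_op q) (i, k)"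
proof -
  have ind: "integrable (K i) (\<lambda>y. (if Q y then 1 else 0) * c :: real)" for Q c
    by (rule integrable_pmf_bounded[where B = "\<bar>c\<bar>"]) simp
  have ind1: "integrable (K i) (\<lambda>y. (if Q y then 1 else 0) :: real)" for Q
    by (rule integrable_pmf_bounded[where B = 1]) simp
  have "(\<integral>y. one_step U r k y \<partial>K i) =
      (\<Sum>l\<le>k. \<Sum>u\<in>U. (\<integral>y. (if fst y = u \<and> snd y = l then 1 else 0) * r (u, k - l) \<partial>K i))
      + (\<integral>y. (if k < snd y then 1 else 0) \<partial>K i)"
    unfolding one_step_eq_sum
    by (subst Bochner_Integration.integral_add)
       (simp_all only: Bochner_Integration.integral_sum Bochner_Integration.integrable_sum ind ind1)
  also have "\<dots> = (\<Sum>l\<le>k. \<Sum>u\<in>U. q i u l * r (u, k - l)) + tail_op q i i k"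
    by (simp only: integral_mult_left_zero integral_K_indicator tail_op_q)
  finally show ?thesis by (simp add: conv_vec_apply diag_seq_def)
qed

definition survival :: "'e set \<Rightarrow> 'e vseq" where
  "survival U = conv_vec U (conv_inv U q) (diag_seq (tail_op q))"

text \<open>The renewal equation read as a mean value property, which makes the deviations of
  empirical averages from the survival sequence centred.\<close>

lemma integral_one_step_survival:
  assumes "i \<in> U"
  shows "(\<integral>y. one_step U (survival U) k y \<partial>K i) = survival U (i, k)"
  unfolding integral_one_step survival_def
  using conv_inv_solves[where A = q and U = U and i = i and k = k and r = "diag_seq (tail_op q)"]
  by (simp add: q_zero assms)

text \<open>The value at \<open>e\<close> of the vector sequence that is squared in the asymptotic variance.\<close>

definition influence :: "'e set \<Rightarrow> 'e \<times> nat \<Rightarrow> 'e \<Rightarrow> 'e \<times> nat \<Rightarrow> real" where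
  "influence U e i' y = (if i' \<in> U
     then \<Sum>l\<le>snd e. conv_inv U q (fst e) i' l * one_step U (survival U) (snd e - l) y else 0)"

lemma influence_bounded: "\<exists>C. \<forall>i' y. \<bar>influence U e i' y\<bar> \<le> C"
proof -
  obtain B where B: "\<And>k y. \<bar>one_step U (survival U) k y\<bar> \<le> B k"
    using one_step_bounded[of U "survival U"] by metis
  have "\<bar>influence U e i' y\<bar> \<le> (\<Sum>u\<in>UNIV. \<Sum>l\<le>snd e. \<bar>conv_inv U q (fst e) u l\<bar> * B (snd e - l))" for i' y
  proof -
    have B0: "0 \<le> B k" for k using B[of k undefined] by linarith
    have "\<bar>influence U e i' y\<bar> \<le> (\<Sum>l\<le>snd e. \<bar>conv_inv U q (fst e) i' l\<bar> * B (snd e - l))"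
      unfolding influence_def using B0
      by (auto intro!: order_trans[OF sum_abs] sum_mono sum_nonneg mult_left_mono B simp: abs_mult)
    also have "\<dots> \<le> (\<Sum>u\<in>UNIV. \<Sum>l\<le>snd e. \<bar>conv_inv U q (fst e) u l\<bar> * B (snd e - l))"
      by (rule member_le_sum) (auto intro!: sum_nonneg mult_nonneg_nonneg B0)
    finally show ?thesis .
  qed
  then show ?thesis by blast
qed

text \<open>For a unit mass at \<open>(i', j, l)\<close> the source of the renewal equation lives in
  row \<open>i'\<close> and equals \<open>one_step\<close> at \<open>(j, l)\<close>.\<close>

lemma full_term_delta: "full_term U q (delta_seq (i', j, l)) e = influence U e i' (j, l)"
proof -
  obtain i k where e: "e = (i, k)" by (cases e)
  have inner: "conv_vec U (delta_seq (i', j, l)) r (u, m) + diag_seq (tail_op (delta_seq (i', j, l))) (u, m) =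
      (if u = i' then one_step U r m (j, l) else 0)" for r u m
  proof -
    have "delta_seq (i', j, l) u v p = (if u = i' then if j = v \<and> l = p then 1 else 0 else 0)" for v p
      by (auto simp: delta_seq_def)
    then have "conv_vec U (delta_seq (i', j, l)) r (u, m) =
        (if u = i' then \<Sum>p\<le>m. \<Sum>v\<in>U. (if j = v \<and> l = p then 1 else 0) * r (v, m - p) else 0)"
      by (simp add: conv_vec_apply)
    then show ?thesis
      by (simp add: one_step_eq_sum diag_seq_def tail_op_delta)
  qed
  have "full_term U q (delta_seq (i', j, l)) e =
      (\<Sum>m\<le>k. \<Sum>u\<in>U. conv_inv U q i u m * (if u = i' then one_step U (survival U) (k - m) (j, l) else 0))"
    unfolding e full_term_eq conv_vec_apply[of U "conv_inv U q" "\<lambda>e. _ e + _ e"] inner survival_def[symmetric] ..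
  also have "\<dots> = influence U e i' (j, l)"
    by (simp add: influence_def e if_distrib[of "\<lambda>z. _ * z"] sum.delta cong: if_cong)
  finally show ?thesis .
qed

text \<open>A unit mass at a transition leaving \<open>U\<close> vanishes on
  \<open>U \<times> U\<close>, so only the tail part of the derivative remains. The sum over
  transitions into \<open>D\<close> thus has the same form as the one inside
  \<open>U\<close>.\<close>

lemma tail_term_delta:
  assumes "j \<notin> U"
  shows "tail_term U q (delta_seq (i', j, l)) e = full_term U q (delta_seq (i', j, l)) e"
proof -
  obtain i k where e: "e = (i, k)" by (cases e)
  have "conv_vec U (delta_seq (i', j, l)) r (u, m) = 0" for r u m
    unfolding conv_vec_apply using assms by (intro sum.neutral ballI) (auto simp: delta_seq_def)
  then have "conv_vec U (delta_seq (i', j, l)) r = (\<lambda>_. 0)" for r by (auto simp: fun_eq_iff)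
  then show ?thesis unfolding e full_term_eq by (simp add: tail_term_def)
qed

text \<open>The derivative is linear in its direction and row \<open>i'\<close> of the kernel is the
  mean of unit masses under \<open>K i'\<close>; hence the subtracted term of the variance is a
  product of conditional means.\<close>

lemma full_term_q_row:
  assumes "i' \<in> U"
  shows "full_term U q (q_row q i') e = (\<integral>y. influence U e i' y \<partial>K i')"
proof -
  obtain i k where e: "e = (i, k)" by (cases e)
  have inner: "conv_vec U (q_row q i') (survival U) (u, m) + diag_seq (tail_op (q_row q i')) (u, m) =
      (if u = i' then survival U (i', m) else 0)" for u m
  proof -
    have "conv_vec U (q_row q i') (survival U) (u, m) = (if u = i' then conv_vec U q (survival U) (u, m) else 0)"
      by (simp add: conv_vec_apply q_row_def)
    then show ?thesis
      using integral_one_step[of i' U "survival U" m] integral_one_step_survival[OF assms, of m]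
      by (simp add: diag_seq_def tail_op_q_row)
  qed
  have "full_term U q (q_row q i') e =
      (\<Sum>m\<le>k. \<Sum>u\<in>U. conv_inv U q i u m * (if u = i' then survival U (i', k - m) else 0))"
    unfolding e full_term_eq survival_def[symmetric] conv_vec_apply[of U "conv_inv U q" "\<lambda>e. _ e + _ e"] inner ..
  also have "\<dots> = (\<Sum>m\<le>k. conv_inv U q i i' m * (\<integral>y. one_step U (survival U) (k - m) y \<partial>K i'))"
    using assms by (simp add: integral_one_step_survival if_distrib[of "\<lambda>z. _ * z"] sum.delta cong: if_cong)
  also have "\<dots> = (\<integral>y. influence U e i' y \<partial>K i')"
    using assms integrable_one_step by (simp add: influence_def e)
  finally show ?thesis .
qed

text \<open>A bounded function is integrable under each row of the kernel, so its weighted sum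
  converges absolutely to the expectation; finitely many rows are then joined. The
  \<open>has_sum\<close> form provides summability and value at once.\<close>

lemma pmf_weighted_has_sum:
  fixes f :: "'e \<Rightarrow> 'e \<times> nat \<Rightarrow> real"
  assumes bound: "\<And>i y. \<bar>f i y\<bar> \<le> C"
  shows "((\<lambda>(i, j, k). w i * q i j k * f i (j, k)) has_sum
    (\<Sum>i\<in>A. w i * (\<integral>y. (if fst y \<in> B then f i y else 0) \<partial>K i))) (A \<times> B \<times> UNIV)"
proof -
  have one: "((\<lambda>(i, j, k). w i * q i j k * f i (j, k)) has_sum
      (w i * (\<integral>y. (if fst y \<in> B then f i y else 0) \<partial>K i))) (Pair i ` (B \<times> UNIV))" for i
  proof -
    let ?g = "\<lambda>y. if fst y \<in> B then f i y else 0"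
    have "\<bar>f i y\<bar> \<le> \<bar>C\<bar>" for y using bound[of i y] by linarith
    then have int: "integrable (K i) ?g"
      by (intro integrable_pmf_bounded[where B = "\<bar>C\<bar>"]) simp
    have "integrable (density (count_space UNIV) (\<lambda>y. ennreal (pmf (K i) y))) ?g"
      using int by (simp only: measure_pmf_eq_density)
    then have abs: "Infinite_Set_Sum.abs_summable_on (\<lambda>y. pmf (K i) y * ?g y) UNIV"
      unfolding abs_summable_on_def by (subst (asm) integrable_density) simp_all
    have "Infinite_Sum.abs_summable_on (\<lambda>y. pmf (K i) y * ?g y) UNIV"
      using abs by (rule abs_summable_equivalent[THEN iffD2])
    then have "(\<lambda>y. pmf (K i) y * ?g y) summable_on UNIV" by (rule abs_summable_summable)
    then have "((\<lambda>y. pmf (K i) y * ?g y) has_sum infsum (\<lambda>y. pmf (K i) y * ?g y) UNIV) UNIV"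
      by (rule has_sum_infsum)
    then have "((\<lambda>y. pmf (K i) y * ?g y) has_sum (\<integral>y. ?g y \<partial>K i)) UNIV"
      unfolding infsetsum_infsum[OF abs, symmetric] pmf_expectation_eq_infsetsum .
    then have "((\<lambda>y. w i * (pmf (K i) y * ?g y)) has_sum (w i * (\<integral>y. ?g y \<partial>K i))) UNIV"
      by (rule has_sum_cmult_right)
    then have "((\<lambda>y. w i * (pmf (K i) y * f i y)) has_sum (w i * (\<integral>y. ?g y \<partial>K i))) (B \<times> UNIV)"
      by (rule has_sum_cong_neutral[THEN iffD1, rotated -1]) auto
    also have "(\<lambda>y. w i * (pmf (K i) y * f i y)) = (\<lambda>(i, j, k). w i * q i j k * f i (j, k)) \<circ> Pair i"
      by (auto simp: fun_eq_iff pmf_K mult.assoc)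
    finally have "((\<lambda>(i, j, k). w i * q i j k * f i (j, k)) \<circ> Pair i has_sum
        w i * (\<integral>y. ?g y \<partial>K i)) (B \<times> UNIV)" .
    then show ?thesis by (rule has_sum_reindex[THEN iffD2, rotated]) (simp add: inj_on_def)
  qed
  have "((\<lambda>(i, j, k). w i * q i j k * f i (j, k)) has_sum
      (\<Sum>i\<in>A. w i * (\<integral>y. (if fst y \<in> B then f i y else 0) \<partial>K i))) (\<Union>i\<in>A. Pair i ` (B \<times> UNIV))"
    by (rule sum_has_sum) (auto intro: one)
  moreover have "(\<Union>i\<in>A. Pair i ` (B \<times> UNIV)) = A \<times> B \<times> (UNIV :: nat set)" by auto
  ultimately show ?thesis by simp
qed

text \<open>The sums over transitions into \<open>U\<close> and into \<open>D\<close> join to the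
  conditional second moment of the influence, and subtracting the product of conditional means
  leaves a conditional covariance.\<close>

lemma variance_summands:
  assumes "U \<union> D = UNIV" "U \<inter> D = {}"
  shows "var_summand_UU U w q e e' summable_on (U \<times> U \<times> UNIV)"
    and "var_summand_UD U w q e e' summable_on (U \<times> D \<times> UNIV)"
    and "reliability_variance U D w q e e' = (\<Sum>i\<in>U. w i *
      ((\<integral>y. influence U e i y * influence U e' i y \<partial>K i) -
       (\<integral>y. influence U e i y \<partial>K i) * (\<integral>y. influence U e' i y \<partial>K i)))"
proof -
  obtain C C' where C: "\<And>i y. \<bar>influence U e i y\<bar> \<le> C" and C': "\<And>i y. \<bar>influence U e' i y\<bar> \<le> C'"
    using influence_bounded[of U e] influence_bounded[of U e'] by auto
  let ?f = "\<lambda>i y. influence U e i y * influence U e' i y"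
  have b: "\<bar>?f i y\<bar> \<le> \<bar>C\<bar> * \<bar>C'\<bar>" for i y
    unfolding abs_mult using C[of i y] C'[of i y] by (intro mult_mono) auto
  have UU: "(var_summand_UU U w q e e' has_sum (\<Sum>i\<in>U. w i * (\<integral>y. (if fst y \<in> U then ?f i y else 0) \<partial>K i))) (U \<times> U \<times> UNIV)"
  proof -
    have "var_summand_UU U w q e e' = (\<lambda>(i, j, k). w i * q i j k * ?f i (j, k))"
      by (auto simp: fun_eq_iff var_summand_UU_def q_bar_def outer_square_def full_term_delta)
    then show ?thesis using pmf_weighted_has_sum[where f = ?f, OF b, of w U U] by simp
  qed
  have UD: "(var_summand_UD U w q e e' has_sum (\<Sum>i\<in>U. w i * (\<integral>y. (if fst y \<in> D then ?f i y else 0) \<partial>K i))) (U \<times> D \<times> UNIV)"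
  proof -
    have "(var_summand_UD U w q e e' has_sum s) (U \<times> D \<times> UNIV) \<longleftrightarrow>
        ((\<lambda>(i, j, k). w i * q i j k * ?f i (j, k)) has_sum s) (U \<times> D \<times> UNIV)" for s
    proof (rule has_sum_cong)
      fix t assume t: "t \<in> U \<times> D \<times> (UNIV :: nat set)"
      obtain i j k where ijk: "t = (i, j, k)" by (cases t) auto
      with t assms(2) have "j \<notin> U" by auto
      then show "var_summand_UD U w q e e' t = (case t of (i, j, k) \<Rightarrow> w i * q i j k * ?f i (j, k))"
        by (simp add: ijk var_summand_UD_def q_bar_def outer_square_def tail_term_delta full_term_delta)
    qed
    then show ?thesis using pmf_weighted_has_sum[where f = ?f, OF b, of w U D] by simp
  qed
  show "var_summand_UU U w q e e' summable_on (U \<times> U \<times> UNIV)" using UU by (rule has_sum_imp_summable)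
  show "var_summand_UD U w q e e' summable_on (U \<times> D \<times> UNIV)" using UD by (rule has_sum_imp_summable)
  have split: "(\<integral>y. (if fst y \<in> U then ?f i y else 0) \<partial>K i) + (\<integral>y. (if fst y \<in> D then ?f i y else 0) \<partial>K i) =
      (\<integral>y. ?f i y \<partial>K i)" for i
  proof -
    have int: "integrable (K i) (\<lambda>y. if fst y \<in> A then ?f i y else 0)" for A
      using b[of i] by (intro integrable_pmf_bounded[where B = "\<bar>C\<bar> * \<bar>C'\<bar>"]) auto
    have "fst y \<in> D \<longleftrightarrow> fst y \<notin> U" for y :: "'e \<times> nat" using assms by blast
    then show ?thesis
      unfolding Bochner_Integration.integral_add[OF int int, symmetric]
      by (intro Bochner_Integration.integral_cong) auto
  qed
  show "reliability_variance U D w q e e' = (\<Sum>i\<in>U. w i *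
      ((\<integral>y. influence U e i y * influence U e' i y \<partial>K i) -
       (\<integral>y. influence U e i y \<partial>K i) * (\<integral>y. influence U e' i y \<partial>K i)))"
    unfolding reliability_variance_def infsumI[OF UU] infsumI[OF UD] split[symmetric]
    by (simp add: full_term_q_row outer_square_def sum_subtractf[symmetric] sum.distrib[symmetric] algebra_simps)
qed

end

section \<open>Reliability and empirical averages\<close>

lemma L2_limit_measurable: "L2_limit M X Y \<Longrightarrow> Y \<in> borel_measurable M"
  by (simp add: L2_limit_def)

text \<open>From (Y - Z)^2 \<le> 2 (X - Y)^2 + 2 (X - Z)^2. This identifies the version picked by
  the choice operator in \<open>tail_op_rand\<close> up to a null set.\<close>

lemma L2_limit_AE_unique:
  assumes Y: "L2_limit M X Y" and Z: "L2_limit M X Z"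
  shows "AE \<omega> in M. Y \<omega> = Z \<omega>"
proof -
  have meas: "X n \<in> borel_measurable M" "Y \<in> borel_measurable M" "Z \<in> borel_measurable M"
    and sq: "integrable M (\<lambda>\<omega>. (X n \<omega>)\<^sup>2)" "integrable M (\<lambda>\<omega>. (Y \<omega>)\<^sup>2)" "integrable M (\<lambda>\<omega>. (Z \<omega>)\<^sup>2)" for n
    using Y Z by (auto simp: L2_limit_def)
  note [measurable] = meas
  have dsq: "integrable M (\<lambda>\<omega>. (f \<omega> - g \<omega>)\<^sup>2)"
    if [measurable]: "f \<in> borel_measurable M" "g \<in> borel_measurable M"
      and "integrable M (\<lambda>\<omega>. (f \<omega>)\<^sup>2)" "integrable M (\<lambda>\<omega>. (g \<omega>)\<^sup>2)" for f g :: "'a \<Rightarrow> real"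
  proof (rule Bochner_Integration.integrable_bound)
    show "integrable M (\<lambda>\<omega>. 2 * (f \<omega>)\<^sup>2 + 2 * (g \<omega>)\<^sup>2)" using that by simp
    have "(f \<omega> - g \<omega>)\<^sup>2 \<le> 2 * (f \<omega>)\<^sup>2 + 2 * (g \<omega>)\<^sup>2" for \<omega>
      using zero_le_power2[of "f \<omega> + g \<omega>"] by (simp add: power2_eq_square algebra_simps)
    then show "AE \<omega> in M. norm ((f \<omega> - g \<omega>)\<^sup>2) \<le> norm (2 * (f \<omega>)\<^sup>2 + 2 * (g \<omega>)\<^sup>2)" by simp
  qed simp
  have le: "(\<integral>\<omega>. (Y \<omega> - Z \<omega>)\<^sup>2 \<partial>M) \<le> 2 * (\<integral>\<omega>. (X n \<omega> - Y \<omega>)\<^sup>2 \<partial>M) + 2 * (\<integral>\<omega>. (X n \<omega> - Z \<omega>)\<^sup>2 \<partial>M)" for n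
  proof -
    have "(Y \<omega> - Z \<omega>)\<^sup>2 \<le> 2 * (X n \<omega> - Y \<omega>)\<^sup>2 + 2 * (X n \<omega> - Z \<omega>)\<^sup>2" for \<omega>
      using zero_le_power2[of "(X n \<omega> - Y \<omega>) + (X n \<omega> - Z \<omega>)"] by (simp add: power2_eq_square algebra_simps)
    then have "(\<integral>\<omega>. (Y \<omega> - Z \<omega>)\<^sup>2 \<partial>M) \<le> (\<integral>\<omega>. 2 * (X n \<omega> - Y \<omega>)\<^sup>2 + 2 * (X n \<omega> - Z \<omega>)\<^sup>2 \<partial>M)"
      by (intro integral_mono dsq meas sq Bochner_Integration.integrable_add integrable_mult_right)
    also have "\<dots> = 2 * (\<integral>\<omega>. (X n \<omega> - Y \<omega>)\<^sup>2 \<partial>M) + 2 * (\<integral>\<omega>. (X n \<omega> - Z \<omega>)\<^sup>2 \<partial>M)"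
      using dsq[OF meas(1,2) sq(1,2)] dsq[OF meas(1,3) sq(1,3)] by simp
    finally show ?thesis .
  qed
  have "(\<lambda>n. 2 * (\<integral>\<omega>. (X n \<omega> - Y \<omega>)\<^sup>2 \<partial>M) + 2 * (\<integral>\<omega>. (X n \<omega> - Z \<omega>)\<^sup>2 \<partial>M)) \<longlonglongrightarrow> 2 * 0 + 2 * 0"
    using Y Z unfolding L2_limit_def by (intro tendsto_intros) auto
  then have "(\<integral>\<omega>. (Y \<omega> - Z \<omega>)\<^sup>2 \<partial>M) \<le> 2 * 0 + 2 * 0"
    by (rule tendsto_lowerbound) (use le in simp_all)
  moreover have "0 \<le> (\<integral>\<omega>. (Y \<omega> - Z \<omega>)\<^sup>2 \<partial>M)" by (intro integral_nonneg_AE) simp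
  ultimately have "(\<integral>\<omega>. (Y \<omega> - Z \<omega>)\<^sup>2 \<partial>M) = 0" by simp
  then have "AE \<omega> in M. (Y \<omega> - Z \<omega>)\<^sup>2 = 0"
    by (subst (asm) integral_nonneg_eq_0_iff_AE) (auto intro: dsq meas sq)
  then show ?thesis by simp
qed

context markov_renewal_chain
begin

section \<open>The reliability as a sum over the number of jumps\<close>

lemma integral_reach:
  "(\<integral>y. (if fst y \<in> U \<and> snd y \<le> k then r (fst y, k - snd y) else 0) \<partial>K i) = conv_vec U q r (i, k)"
proof -
  have t: "integrable (K i) (\<lambda>y. (if k < snd y then 1 else 0) :: real)"
    by (rule integrable_pmf_bounded[where B = 1]) simp
  have "(\<integral>y. (if fst y \<in> U \<and> snd y \<le> k then r (fst y, k - snd y) else 0) \<partial>K i) =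
      (\<integral>y. one_step U r k y - (if k < snd y then 1 else 0) \<partial>K i)"
    by (intro Bochner_Integration.integral_cong) (auto simp: one_step_def)
  also have "\<dots> = conv_vec U q r (i, k)"
    using integrable_one_step t
    by (simp add: integral_one_step diag_seq_def tail_op_q)
  finally show ?thesis .
qed

text \<open>Averaging over the last transition replaces \<open>r\<close> by its convolution with the
  kernel, so the induction needs arbitrary \<open>r\<close>.\<close>

lemma expectation_path_inside:
  assumes "i \<in> U"
  shows "(\<integral>h. (if (\<forall>x\<in>set h. fst x \<in> U) \<and> elapsed h \<le> k then r (cur h, k - elapsed h) else 0) \<partial>path_pmf K i n)
    = (conv_vec U q ^^ n) r (i, k)"
proof (induction n arbitrary: r)
  case 0
  show ?case using assms by simp
next
  case (Suc n)
  let ?F = "\<lambda>r h. if (\<forall>x\<in>set h. fst x \<in> U) \<and> elapsed h \<le> k then r (cur h, k - elapsed h) else 0"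
  define B where "B = (\<Sum>e\<in>UNIV \<times> {..k}. \<bar>r e\<bar>)"
  have B: "\<bar>r (u, l)\<bar> \<le> B" if "l \<le> k" for u l
    unfolding B_def using that by (intro member_le_sum[where f = "\<lambda>e. \<bar>r e\<bar>"]) auto
  have B0: "0 \<le> B" unfolding B_def by (intro sum_nonneg) simp
  have "(\<integral>h. ?F r h \<partial>path_pmf K i (Suc n)) = (\<integral>h. (\<integral>y. ?F r (y # h) \<partial>K (cur h)) \<partial>path_pmf K i n)"
    by (rule expectation_path_Suc[where B = B]) (use B B0 in auto)
  also have "\<dots> = (\<integral>h. ?F (conv_vec U q r) h \<partial>path_pmf K i n)"
  proof (rule Bochner_Integration.integral_cong[OF refl])
    fix h :: "'e history"
    show "(\<integral>y. ?F r (y # h) \<partial>K (cur h)) = ?F (conv_vec U q r) h"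
    proof (cases "(\<forall>x\<in>set h. fst x \<in> U) \<and> elapsed h \<le> k")
      case True
      have "(\<integral>y. ?F r (y # h) \<partial>K (cur h)) = (\<integral>y. (if fst y \<in> U \<and> snd y \<le> k - elapsed h
          then r (fst y, k - elapsed h - snd y) else 0) \<partial>K (cur h))"
        using True by (intro Bochner_Integration.integral_cong refl if_cong) (auto simp: algebra_simps)
      also have "\<dots> = conv_vec U q r (cur h, k - elapsed h)" by (rule integral_reach)
      finally show ?thesis unfolding if_P[OF True] .
    next
      case False
      then have "?F r (y # h) = 0" for y by auto
      then show ?thesis unfolding if_not_P[OF False] by simp
    qed
  qed
  also have "\<dots> = (conv_vec U q ^^ n) (conv_vec U q r) (i, k)" by (rule Suc.IH)
  finally show ?case by (simp only: funpow_Suc_right comp_def)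
qed

text \<open>A last index with S m \<le> M is characterised by countably many conditions. If there is
  none, the set is empty or infinite, and \<open>Max\<close> takes the same default value in both
  cases.\<close>

lemma measurable_jumps: "jumps S M \<in> measurable (P i) (count_space UNIV)"
proof -
  let ?Q = "\<lambda>m \<omega>. S m \<omega> \<le> M \<and> (\<forall>n. m < n \<longrightarrow> M < S n \<omega>)"
  note [measurable] = measurable_S[of _ i]
  have eq: "jumps S M \<omega> = (if \<exists>m. ?Q m \<omega> then LEAST m. ?Q m \<omega> else Max {} )" for \<omega>
  proof (cases "\<exists>m. ?Q m \<omega>")
    case True
    then obtain m where m: "?Q m \<omega>" by blast
    have sub: "{n. S n \<omega> \<le> M} \<subseteq> {..m}"
    proof
      fix n assume "n \<in> {n. S n \<omega> \<le> M}"
      then have "\<not> m < n" using m by (auto simp: not_less)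
      then show "n \<in> {..m}" by simp
    qed
    have "Max {n. S n \<omega> \<le> M} = m"
      using m sub by (intro Max_eqI finite_subset[OF sub]) auto
    moreover have "(LEAST m. ?Q m \<omega>) = m"
      using m by (intro Least_equality) (auto simp: not_less[symmetric])
    ultimately show ?thesis using True by (simp add: jumps_def)
  next
    case False
    have "Max {n. S n \<omega> \<le> M} = Max {}"
    proof (cases "finite {n. S n \<omega> \<le> M}")
      case True
      have "{n. S n \<omega> \<le> M} = {}"
      proof (rule ccontr)
        assume ne: "{n. S n \<omega> \<le> M} \<noteq> {}"
        have "?Q (Max {n. S n \<omega> \<le> M}) \<omega>"
          using Max_in[OF True ne] Max_ge[OF True] by (auto simp: not_le[symmetric])
        with False show False by blast
      qed
      then show ?thesis by simp
    next
      case inf: False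
      then show ?thesis by (simp add: Max.infinite Max.eq_fold')
    qed
    then show ?thesis unfolding jumps_def if_not_P[OF False] .
  qed
  have "(\<lambda>\<omega>. if \<exists>m. ?Q m \<omega> then LEAST m. ?Q m \<omega> else Max {}) \<in> measurable (P i) (count_space UNIV)"
    by measurable
  then show ?thesis by (simp add: eq[abs_def])
qed

lemma measurable_transition_sum [measurable]: "transition_sum M \<phi> \<in> borel_measurable (P i)"
proof -
  have [measurable]: "(\<lambda>\<omega>. \<phi> (J (n - 1) \<omega>) (J n \<omega>) (sojourn S n \<omega>)) \<in> borel_measurable (P i)" for n
  proof -
    have "(\<lambda>\<omega>. (J n \<omega>, sojourn S n \<omega>)) \<in> measurable (P i) (count_space UNIV)"
      by (rule measurable_pair_count_space[OF measurable_J measurable_sojourn])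
    from measurable_pair_count_space[OF measurable_J this, where h = "\<lambda>a b. (a, b)", of "n - 1"]
    have "(\<lambda>\<omega>. (J (n - 1) \<omega>, J n \<omega>, sojourn S n \<omega>)) \<in> measurable (P i) (count_space UNIV)" .
    from measurable_compose[OF this, of "\<lambda>(a, b, c). \<phi> a b c" borel] show ?thesis by simp
  qed
  show ?thesis unfolding transition_sum_def[abs_def]
    by (rule measurable_compose_countable[OF _ measurable_jumps]) measurable
qed

lemma down_time_gt_iff: "enat k < down_time D J S \<omega> \<longleftrightarrow> (\<forall>k'\<le>k. semi_markov J S k' \<omega> \<notin> D)"
proof
  assume lt: "enat k < down_time D J S \<omega>"
  show "\<forall>k'\<le>k. semi_markov J S k' \<omega> \<notin> D"
  proof (intro allI impI notI)
    fix k' assume k': "k' \<le> k" "semi_markov J S k' \<omega> \<in> D"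
    then have "down_time D J S \<omega> \<le> enat k'" unfolding down_time_def by (intro Inf_lower) auto
    with lt have "enat k < enat k'" by (rule less_le_trans)
    with k' show False by simp
  qed
next
  assume *: "\<forall>k'\<le>k. semi_markov J S k' \<omega> \<notin> D"
  have "enat (Suc k) \<le> down_time D J S \<omega>"
    unfolding down_time_def using * by (intro Inf_greatest) (auto simp: not_less_eq_eq[symmetric])
  then show "enat k < down_time D J S \<omega>" by (rule less_le_trans[rotated]) simp
qed

text \<open>Survival beyond \<open>k\<close> is split by the number \<open>n\<close> of jumps up to
  \<open>k\<close>; the convolution inverse splits in the same way into iterates.\<close>

theorem reliability_eq_survival:
  assumes UD: "U \<union> D = UNIV" "U \<inter> D = {}" and i: "i \<in> U"
  shows "reliability D P J S (i, k) = survival U (i, k)"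
proof -
  interpret prob_space "P i" by (rule prob_space_P)
  have D: "x \<in> D \<longleftrightarrow> x \<notin> U" for x using UD by blast
  let ?E = "{\<omega> \<in> space (P i). enat k < down_time D J S \<omega>}"
  have [measurable]: "semi_markov J S k' \<in> measurable (P i) (count_space UNIV)" for k'
    unfolding semi_markov_def[abs_def]
    by (rule measurable_compose_countable[OF measurable_J measurable_jumps])
  have E: "?E \<in> sets (P i)" unfolding down_time_gt_iff by measurable
  \<comment> \<open>For a history of n + 1 transitions: \<open>tl h\<close> records the first
    \<open>n\<close>, inside \<open>U\<close> and completed by time \<open>k\<close>; the head ends
    after \<open>k\<close>, in whatever state.\<close>
  define F where "F h = (if (\<forall>x\<in>set (tl h). fst x \<in> U) \<and> elapsed (tl h) \<le> k \<and> k < elapsed h then 1 else 0 :: real)" for h :: "'e history"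
  have set_hist: "(\<forall>x\<in>set (hist n \<omega>). fst x \<in> U) \<longleftrightarrow> (\<forall>m\<le>n. J m \<omega> \<in> U)" for n \<omega>
    by (induction n) (auto simp: le_Suc_eq)
  have pt: "indicator ?E \<omega> = (\<Sum>n\<le>k. F (hist (Suc n) \<omega>))" if reg: "regular i \<omega>" and "\<omega> \<in> space (P i)" for \<omega>
  proof -
    let ?N = "jumps S k \<omega>"
    have el: "elapsed (hist n \<omega>) = S n \<omega>" for n by (rule elapsed_hist[OF reg])
    have "F (hist (Suc n) \<omega>) = (if n = ?N then if \<forall>m\<le>?N. J m \<omega> \<in> U then 1 else 0 else 0)" for n
    proof -
      have "n = ?N \<longleftrightarrow> S n \<omega> \<le> k \<and> \<not> S (Suc n) \<omega> \<le> k"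
        unfolding le_jumps_iff[OF reg, symmetric] by auto
      then show ?thesis
        using el[of n] el[of "Suc n"] set_hist[of n \<omega>] unfolding F_def by auto
    qed
    then have "(\<Sum>n\<le>k. F (hist (Suc n) \<omega>)) = (if \<forall>m\<le>?N. J m \<omega> \<in> U then 1 else 0)"
      using jumps_le[OF reg, of k] by (simp add: sum.delta)
    \<comment> \<open>The semi-Markov chain sits at \<open>J m\<close> at time \<open>S m\<close>,
      so up to time \<open>k\<close> it takes exactly the values of the embedded chain up to the
      index of the last jump.\<close>
    moreover have "enat k < down_time D J S \<omega> \<longleftrightarrow> (\<forall>m\<le>?N. J m \<omega> \<in> U)"
      unfolding down_time_gt_iff D semi_markov_def
    proof safe
      fix m assume *: "\<forall>k'\<le>k. \<not> J (jumps S k' \<omega>) \<omega> \<notin> U" and m: "m \<le> ?N"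
      have "m' \<le> jumps S (S m \<omega>) \<omega> \<longleftrightarrow> m' \<le> m" for m'
        unfolding le_jumps_iff[OF reg] using strict_mono_less_eq[OF S_strict_mono[OF reg]] by simp
      then have "jumps S (S m \<omega>) \<omega> = m" by (meson le_refl order_antisym)
      moreover have "S m \<omega> \<le> k" using m le_jumps_iff[OF reg] by simp
      ultimately show "J m \<omega> \<in> U" using * by metis
    next
      fix k' assume *: "\<forall>m\<le>?N. J m \<omega> \<in> U" and k': "k' \<le> k" "J (jumps S k' \<omega>) \<omega> \<notin> U"
      have "S (jumps S k' \<omega>) \<omega> \<le> k'" using le_jumps_iff[OF reg, of "jumps S k' \<omega>" k'] by simp
      then have "jumps S k' \<omega> \<le> ?N" using k'(1) by (simp add: le_jumps_iff[OF reg])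
      with * k'(2) show False by blast
    qed
    ultimately show ?thesis using that(2) by (simp add: indicator_def)
  qed
  have "reliability D P J S (i, k) = (\<integral>\<omega>. indicator ?E \<omega> \<partial>P i)"
    using E by (simp add: reliability_def)
  also have "\<dots> = (\<integral>\<omega>. (\<Sum>n\<le>k. F (hist (Suc n) \<omega>)) \<partial>P i)"
  proof (rule integral_cong_AE)
    show "AE \<omega> in P i. indicator ?E \<omega> = (\<Sum>n\<le>k. F (hist (Suc n) \<omega>))"
      using AE_regular[of i] AE_space by eventually_elim (rule pt)
    show "indicat_real ?E \<in> borel_measurable (P i)" using E by simp
    show "(\<lambda>\<omega>. \<Sum>n\<le>k. F (hist (Suc n) \<omega>)) \<in> borel_measurable (P i)"
      by (intro borel_measurable_sum measurable_hist_comp)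
  qed
  also have "\<dots> = (\<Sum>n\<le>k. \<integral>\<omega>. F (hist (Suc n) \<omega>) \<partial>P i)"
    by (intro Bochner_Integration.integral_sum integrable_const_bound[where B = 1] measurable_hist_comp)
       (simp add: F_def)
  also have "\<dots> = (\<Sum>n\<le>k. (conv_vec U q ^^ n) (diag_seq (tail_op q)) (i, k))"
  proof (rule sum.cong[OF refl])
    fix n
    have "(\<integral>\<omega>. F (hist (Suc n) \<omega>) \<partial>P i) = (\<integral>h. F h \<partial>path_pmf K i (Suc n))" by (rule integral_hist)
    also have "\<dots> = (\<integral>h. (\<integral>y. F (y # h) \<partial>K (cur h)) \<partial>path_pmf K i n)"
      by (rule expectation_path_Suc[where B = 1]) (simp add: F_def)
    also have "\<dots> = (\<integral>h. (if (\<forall>x\<in>set h. fst x \<in> U) \<and> elapsed h \<le> k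
        then diag_seq (tail_op q) (cur h, k - elapsed h) else 0) \<partial>path_pmf K i n)"
    proof (rule Bochner_Integration.integral_cong[OF refl])
      fix h :: "'e history"
      show "(\<integral>y. F (y # h) \<partial>K (cur h)) = (if (\<forall>x\<in>set h. fst x \<in> U) \<and> elapsed h \<le> k
          then diag_seq (tail_op q) (cur h, k - elapsed h) else 0)"
      proof (cases "(\<forall>x\<in>set h. fst x \<in> U) \<and> elapsed h \<le> k")
        case True
        have "(\<integral>y. F (y # h) \<partial>K (cur h)) = (\<integral>y. (if k - elapsed h < snd y then 1 else 0) \<partial>K (cur h))"
          using True by (intro Bochner_Integration.integral_cong) (auto simp: F_def)
        then show ?thesis unfolding if_P[OF True] by (simp add: tail_op_q diag_seq_def)
      next
        case False
        then have "F (y # h) = 0" for y by (auto simp: F_def)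
        then show ?thesis unfolding if_not_P[OF False] by simp
      qed
    qed
    also have "\<dots> = (conv_vec U q ^^ n) (diag_seq (tail_op q)) (i, k)"
      by (rule expectation_path_inside[OF i])
    finally show "(\<integral>\<omega>. F (hist (Suc n) \<omega>) \<partial>P i) = (conv_vec U q ^^ n) (diag_seq (tail_op q)) (i, k)" .
  qed
  also have "\<dots> = survival U (i, k)"
    unfolding survival_def by (rule conv_inv_eq_iterate[where A = q, symmetric]) (simp_all add: q_zero i)
  finally show ?thesis .
qed

text \<open>The empirical average over the completed transitions out of \<open>i\<close>, equal to 0
  if there are none. It is linear in \<open>f\<close>, and \<open>q_hat\<close> is its value at
  point indicators.\<close>

definition emp :: "'e \<Rightarrow> ('e \<times> nat \<Rightarrow> real) \<Rightarrow> nat \<Rightarrow> 'w \<Rightarrow> real" where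
  "emp i f M \<omega> = transition_sum M (\<lambda>i' j k. if i' = i then f (j, k) else 0) \<omega> / real (visits J S M i \<omega>)"

lemma visits_eq: "real (visits J S M i \<omega>) = transition_sum M (\<lambda>i' j k. if i' = i then 1 else 0) \<omega>"
  unfolding visits_def transition_sum_def of_nat_sum by (intro sum.cong) auto

lemma measurable_emp [measurable]: "emp i f M \<in> borel_measurable (P i0)"
  unfolding emp_def[abs_def] visits_eq by measurable

lemma q_hat_eq: "q_hat J S M i j k \<omega> = emp i (\<lambda>y. if fst y = j \<and> snd y = k then 1 else 0) M \<omega>"
  by (auto simp: q_hat_def emp_def transition_sum_def intro!: sum.cong)

lemma emp_sum: "emp i (\<lambda>y. \<Sum>a\<in>A. f a y) M \<omega> = (\<Sum>a\<in>A. emp i (f a) M \<omega>)"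
proof -
  have "(if i' = i then \<Sum>a\<in>A. f a y else 0) = (\<Sum>a\<in>A. if i' = i then f a y else 0)" for i' y by simp
  then show ?thesis
    unfolding emp_def transition_sum_def by (simp only: sum_divide_distrib[symmetric] sum.swap[of _ A])
qed

lemma emp_cmult: "emp i (\<lambda>y. f y * c) M \<omega> = emp i f M \<omega> * c"
proof -
  have "(if i' = i then f y * c else 0) = (if i' = i then f y else 0) * c" for i' y by simp
  then show ?thesis
    unfolding emp_def transition_sum_def by (simp only: sum_distrib_right[symmetric] times_divide_eq_left)
qed

lemma emp_add: "emp i (\<lambda>y. f y + g y) M \<omega> = emp i f M \<omega> + emp i g M \<omega>"
proof -
  have "(if i' = i then f y + g y else 0) = (if i' = i then f y else 0) + (if i' = i then g y else 0)" for i' y by simp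
  then show ?thesis
    unfolding emp_def transition_sum_def by (simp only: sum.distrib add_divide_distrib)
qed

lemma emp_bounded:
  assumes "\<And>y. 0 \<le> f y" "\<And>y. f y \<le> 1"
  shows "0 \<le> emp i f M \<omega>" "emp i f M \<omega> \<le> 1"
proof -
  let ?t = "transition_sum M (\<lambda>i' j k. if i' = i then f (j, k) else 0) \<omega>"
  have "0 \<le> ?t" unfolding transition_sum_def using assms by (intro sum_nonneg) auto
  moreover have "?t \<le> real (visits J S M i \<omega>)"
    unfolding visits_eq transition_sum_def using assms by (intro sum_mono) auto
  ultimately show "0 \<le> emp i f M \<omega>" "emp i f M \<omega> \<le> 1"
    by (auto simp: emp_def divide_le_eq_1)
qed

text \<open>On a fixed path only finitely many sojourn times are observed, so the partial sums are
  eventually equal to the empirical tail. They lie between 0 and 1, hence converge in the mean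
  square as well.\<close>

lemma tail_op_rand_q_hat:
  "tail_op_rand (P i0) (q_hat J S M) i i k \<in> borel_measurable (P i0)"
  "AE \<omega> in P i0. tail_op_rand (P i0) (q_hat J S M) i i k \<omega> = emp i (\<lambda>y. if k < snd y then 1 else 0) M \<omega>"
proof -
  interpret prob_space "P i0" by (rule prob_space_P)
  let ?X = "\<lambda>N \<omega>. \<Sum>j'\<in>UNIV. \<Sum>k'\<in>{k<..N}. q_hat J S M i j' k' \<omega>"
  let ?Y = "emp i (\<lambda>y. if k < snd y then 1 else 0) M"
  have X: "?X N \<omega> = emp i (\<lambda>y. if k < snd y \<and> snd y \<le> N then 1 else 0) M \<omega>" for N \<omega>
  proof -
    have "(\<Sum>j'\<in>UNIV. \<Sum>k'\<in>{k<..N}. (if fst y = j' \<and> snd y = k' then 1 else 0)) = (if k < snd y \<and> snd y \<le> N then 1 else 0 :: real)"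
      for y :: "'e \<times> nat"
    proof -
      have "(\<Sum>k'\<in>{k<..N}. (if fst y = j' \<and> snd y = k' then 1 else 0 :: real)) =
          (if j' = fst y then if k < snd y \<and> snd y \<le> N then 1 else 0 else 0)" for j'
        by (cases "j' = fst y") (simp_all add: sum.delta)
      then show ?thesis by (simp add: sum.delta)
    qed
    then have "emp i (\<lambda>y. if k < snd y \<and> snd y \<le> N then 1 else 0) M \<omega> =
        emp i (\<lambda>y. \<Sum>j'\<in>UNIV. \<Sum>k'\<in>{k<..N}. (if fst y = j' \<and> snd y = k' then 1 else 0)) M \<omega>" by simp
    then show ?thesis by (simp only: emp_sum q_hat_eq)
  qed
  have lim: "(\<lambda>N. ?X N \<omega>) \<longlonglongrightarrow> ?Y \<omega>" for \<omega>
  proof (rule tendsto_eventually)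
    \<comment> \<open>The total of the observed sojourn times, a crude bound for each of
      them.\<close>
    define N0 where "N0 = (\<Sum>n = 1..jumps S M \<omega>. sojourn S n \<omega>)"
    have N0: "sojourn S n \<omega> \<le> N0" if "n \<in> {1..jumps S M \<omega>}" for n
      unfolding N0_def using that by (intro member_le_sum) auto
    show "eventually (\<lambda>N. ?X N \<omega> = ?Y \<omega>) sequentially"
      unfolding eventually_sequentially
    proof (intro exI[of _ N0] allI impI)
      fix N assume N: "N0 \<le> N"
      show "?X N \<omega> = ?Y \<omega>"
        unfolding X emp_def transition_sum_def
      proof (intro arg_cong2[where f = "(/)"] sum.cong refl)
        fix n assume "n \<in> {1..jumps S M \<omega>}"
        then have "sojourn S n \<omega> \<le> N" using N0 N order_trans by blast
        then show "(if J (n - 1) \<omega> = i then if k < snd (J n \<omega>, sojourn S n \<omega>) \<and> snd (J n \<omega>, sojourn S n \<omega>) \<le> N then 1 else 0 else 0) =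
            (if J (n - 1) \<omega> = i then if k < snd (J n \<omega>, sojourn S n \<omega>) then 1 else 0 else (0::real))" by simp
      qed
    qed
  qed
  have bX: "\<forall>N \<omega>. 0 \<le> ?X N \<omega> \<and> ?X N \<omega> \<le> 1" unfolding X by (auto intro!: emp_bounded)
  have bY: "0 \<le> ?Y \<omega>" "?Y \<omega> \<le> 1" for \<omega> by (auto intro!: emp_bounded)
  have mX [measurable]: "?X N \<in> borel_measurable (P i0)" for N unfolding X by measurable
  have L2: "L2_limit (P i0) ?X ?Y"
    unfolding L2_limit_def
  proof (intro conjI allI)
    show "?X N \<in> borel_measurable (P i0)" for N by (rule mX)
    show "integrable (P i0) (\<lambda>\<omega>. (?X N \<omega>)\<^sup>2)" for N
    proof (rule integrable_const_bound[where B = 1], rule AE_I2)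
      fix \<omega>
      have "\<bar>?X N \<omega>\<bar> \<le> 1" using bX[THEN spec[of _ N], THEN spec[of _ \<omega>]] by linarith
      from power2_le_if_abs_le[OF this] show "norm ((?X N \<omega>)\<^sup>2) \<le> 1" by simp
    qed (use mX in simp)
    show "integrable (P i0) (\<lambda>\<omega>. (?Y \<omega>)\<^sup>2)"
    proof (rule integrable_const_bound[where B = 1], rule AE_I2)
      fix \<omega>
      have "\<bar>?Y \<omega>\<bar> \<le> 1" using bY[of \<omega>] by linarith
      from power2_le_if_abs_le[OF this] show "norm ((?Y \<omega>)\<^sup>2) \<le> 1" by simp
    qed simp
    have "(\<lambda>N. \<integral>\<omega>. (?X N \<omega> - ?Y \<omega>)\<^sup>2 \<partial>P i0) \<longlonglongrightarrow> (\<integral>\<omega>. 0 \<partial>P i0)"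
    proof (rule integral_dominated_convergence[where w = "\<lambda>_. 1"])
      show "AE \<omega> in P i0. (\<lambda>N. (?X N \<omega> - ?Y \<omega>)\<^sup>2) \<longlonglongrightarrow> 0"
      proof (rule AE_I2)
        fix \<omega>
        have "(\<lambda>N. (?X N \<omega> - ?Y \<omega>)\<^sup>2) \<longlonglongrightarrow> (?Y \<omega> - ?Y \<omega>)\<^sup>2"
          by (intro tendsto_power tendsto_diff lim tendsto_const)
        then show "(\<lambda>N. (?X N \<omega> - ?Y \<omega>)\<^sup>2) \<longlonglongrightarrow> 0" by simp
      qed
      show "AE \<omega> in P i0. norm ((?X N \<omega> - ?Y \<omega>)\<^sup>2) \<le> 1" for N
      proof (rule AE_I2)
        fix \<omega>
        have "\<bar>?X N \<omega> - ?Y \<omega>\<bar> \<le> 1" using bX[THEN spec[of _ N], THEN spec[of _ \<omega>]] bY[of \<omega>] by linarith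
        from power2_le_if_abs_le[OF this] show "norm ((?X N \<omega> - ?Y \<omega>)\<^sup>2) \<le> 1" by simp
      qed
    qed (use mX in simp_all)
    then show "(\<lambda>N. \<integral>\<omega>. (?X N \<omega> - ?Y \<omega>)\<^sup>2 \<partial>P i0) \<longlonglongrightarrow> 0" by simp
  qed simp
  have eq: "tail_op_rand (P i0) (q_hat J S M) i i k = (SOME Y. L2_limit (P i0) ?X Y)"
    by (simp add: tail_op_rand_def fun_eq_iff)
  have some: "L2_limit (P i0) ?X (SOME Y. L2_limit (P i0) ?X Y)"
    by (rule someI[of "L2_limit (P i0) ?X", OF L2])
  show "tail_op_rand (P i0) (q_hat J S M) i i k \<in> borel_measurable (P i0)"
    unfolding eq by (rule L2_limit_measurable[OF some])
  show "AE \<omega> in P i0. tail_op_rand (P i0) (q_hat J S M) i i k \<omega> = ?Y \<omega>"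
    unfolding eq by (rule L2_limit_AE_unique[OF some L2])
qed

end

section \<open>Asymptotics of the estimators\<close>

lemma (in prob_space) tendsto_prob_if_AE_bound:
  assumes [measurable]: "\<And>n. X n \<in> borel_measurable M"
    and bound: "\<And>n. AE \<omega> in M. \<bar>X n \<omega>\<bar> \<le> b n" and b: "b \<longlonglongrightarrow> 0"
  shows "tendsto_prob M X 0"
proof (rule tendsto_prob_if_nn_integral)
  fix r :: real assume "r > 0"
  then have "eventually (\<lambda>n. b n < r) sequentially" by (intro order_tendstoD(2)[OF b])
  then show "eventually (\<lambda>n. (\<integral>\<^sup>+\<omega>. ennreal \<bar>X n \<omega> - 0\<bar> \<partial>M) \<le> ennreal r) sequentially"
  proof (rule eventually_mono)
    fix n assume n: "b n < r"
    have "(\<integral>\<^sup>+\<omega>. ennreal \<bar>X n \<omega> - 0\<bar> \<partial>M) \<le> (\<integral>\<^sup>+\<omega>. ennreal r \<partial>M)"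
      using bound[of n] n by (intro nn_integral_mono_AE) (elim eventually_mono, auto intro: ennreal_leI)
    then show "(\<integral>\<^sup>+\<omega>. ennreal \<bar>X n \<omega> - 0\<bar> \<partial>M) \<le> ennreal r" by (simp add: emeasure_space_1)
  qed
qed simp

context positive_recurrent_markov_renewal_chain
begin

text \<open>The martingale increment behind \<open>emp i f\<close>: the deviation of
  \<open>f\<close> from its mean at departures from \<open>i\<close>, and 0 at all others.\<close>

definition dev :: "'a \<Rightarrow> ('a \<times> nat \<Rightarrow> real) \<Rightarrow> 'a \<Rightarrow> 'a \<Rightarrow> nat \<Rightarrow> real" where
  "dev i f i' j k = (if i' = i then f (j, k) - (\<integral>y. f y \<partial>K i) else 0)"

lemma dev_bound:
  assumes "\<And>y. \<bar>f y\<bar> \<le> C"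
  shows "\<bar>dev i f i' j k\<bar> \<le> 2 * C"
proof -
  have int: "integrable (K i) f" by (rule integrable_pmf_bounded[where B = C]) (simp add: assms)
  have "\<bar>\<integral>y. f y \<partial>K i\<bar> \<le> (\<integral>y. \<bar>f y\<bar> \<partial>K i)" by (rule integral_abs_bound)
  also have "\<dots> \<le> C" by (rule expectation_pmf_le) (simp_all add: int assms)
  finally have "\<bar>\<integral>y. f y \<partial>K i\<bar> \<le> C" .
  moreover have "0 \<le> C" using assms[of undefined] by linarith
  ultimately show ?thesis using assms[of "(j, k)"] by (auto simp: dev_def)
qed

lemma centred_dev:
  assumes "\<And>y. \<bar>f y\<bar> \<le> C"
  shows "centred (dev i f)"
  unfolding centred_def
proof (intro conjI allI exI)
  show "\<bar>dev i f i' j k\<bar> \<le> 2 * C" for i' j k by (rule dev_bound[OF assms])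
  have int: "integrable (K i) f" by (rule integrable_pmf_bounded[where B = C]) (simp add: assms)
  show "(\<integral>y. dev i f i' (fst y) (snd y) \<partial>K i') = 0" for i'
    by (cases "i' = i") (simp_all add: dev_def int)
qed

lemma lim_const_over_sqrt: "(\<lambda>M. c / sqrt (real M)) \<longlonglongrightarrow> 0"
  using tendsto_mult[OF tendsto_const[of c] lim_inverse_sqrt] by simp

lemma visits_over: "tendsto_prob (P i0) (\<lambda>M \<omega>. real (visits J S M i \<omega>) / real M) (1 / \<mu> i)"
proof -
  interpret prob_space "P i0" by (rule prob_space_P)
  have eq: "(\<lambda>i' j k. if i' = i then 1 else 0) = from_state i" by (simp add: from_state_def fun_eq_iff)
  have m [measurable]: "(\<lambda>\<omega>. real (visits J S M i \<omega>)) \<in> borel_measurable (P i0)" for M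
    unfolding visits_eq by measurable
  let ?X = "\<lambda>M \<omega>. stopped (from_state i) M \<omega> / real M - real (visits J S M i \<omega>) / real M"
  have "tendsto_prob (P i0) ?X 0"
  proof (rule tendsto_prob_if_AE_bound)
    show "AE \<omega> in P i0. \<bar>?X M \<omega>\<bar> \<le> 1 / real M" for M
      using AE_regular[of i0]
    proof eventually_elim
      fix \<omega> assume "regular i0 \<omega>"
      then have "\<bar>stopped (from_state i) M \<omega> - real (visits J S M i \<omega>)\<bar> \<le> 1"
        unfolding stopped_def visits_eq eq by (rule stop_sum_transition_sum_diff) (simp add: from_state_def)
      from divide_right_mono[OF this, of "real M"] show "\<bar>?X M \<omega>\<bar> \<le> 1 / real M"
        by (simp add: diff_divide_distrib[symmetric])
    qed
    show "(\<lambda>M. 1 / real M) \<longlonglongrightarrow> 0" by (rule lim_1_over_n)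
  qed simp
  from tendsto_prob_diff[OF visits_frequency[of i0 i] this] show ?thesis by simp
qed

lemma over_visits: "tendsto_prob (P i0) (\<lambda>M \<omega>. real M / real (visits J S M i \<omega>)) (\<mu> i)"
proof -
  interpret prob_space "P i0" by (rule prob_space_P)
  have "isCont inverse (1 / \<mu> i)" using \<mu>_pos[of i] by (intro continuous_intros) auto
  from tendsto_prob_cont1[OF visits_over[of i0 i] this] show ?thesis by simp
qed

lemma no_visits: "(\<lambda>M. measure (P i0) {\<omega> \<in> space (P i0). visits J S M i \<omega> = 0}) \<longlonglongrightarrow> 0"
proof -
  interpret prob_space "P i0" by (rule prob_space_P)
  have [measurable]: "(\<lambda>\<omega>. real (visits J S M i \<omega>)) \<in> borel_measurable (P i0)" for M
    unfolding visits_eq by measurable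
  \<comment> \<open>Without a visit the frequency is 0, at distance 1 / \<mu> i from its limit; half
    of that distance serves as threshold.\<close>
  have e: "0 < 1 / (2 * \<mu> i)" using \<mu>_pos[of i] by simp
  have le: "measure (P i0) {\<omega> \<in> space (P i0). visits J S M i \<omega> = 0} \<le>
      measure (P i0) {\<omega> \<in> space (P i0). \<bar>real (visits J S M i \<omega>) / real M - 1 / \<mu> i\<bar> > 1 / (2 * \<mu> i)}" for M
    using \<mu>_pos[of i] by (intro finite_measure_mono) (auto simp: field_simps)
  show ?thesis
    by (rule tendsto_sandwich[OF _ _ tendsto_const tendsto_probD[OF visits_over[of i0 i] e]])
       (simp_all add: le)
qed

lemma transition_sum_dev:
  "transition_sum M (dev i f) \<omega> = transition_sum M (\<lambda>i' j k. if i' = i then f (j, k) else 0) \<omega>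
     - (\<integral>y. f y \<partial>K i) * real (visits J S M i \<omega>)"
proof -
  have "dev i f i' j k = (if i' = i then f (j, k) else 0) - (\<integral>y. f y \<partial>K i) * (if i' = i then 1 else 0)" for i' j k
    by (simp add: dev_def)
  then show ?thesis
    unfolding visits_eq transition_sum_def by (simp only: sum_subtractf sum_distrib_left)
qed

text \<open>Identities that divide by the visit count hold only after a visit to \<open>i\<close>;
  the complementary event has vanishing probability.\<close>

lemma tendsto_prob_cong_visits:
  assumes Y: "tendsto_prob (P i0) Y c" and X: "\<And>M. X M \<in> borel_measurable (P i0)"
    and eq: "\<And>M \<omega>. visits J S M i \<omega> \<noteq> 0 \<Longrightarrow> X M \<omega> = Y M \<omega>"
  shows "tendsto_prob (P i0) X c"
proof -
  interpret prob_space "P i0" by (rule prob_space_P)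
  have [measurable]: "(\<lambda>\<omega>. real (visits J S M i \<omega>)) \<in> borel_measurable (P i0)" for M
    unfolding visits_eq by measurable
  have s: "{\<omega> \<in> space (P i0). visits J S M i \<omega> = 0} = {\<omega> \<in> space (P i0). real (visits J S M i \<omega>) = 0}" for M
    by simp
  have "measure (P i0) {\<omega> \<in> space (P i0). X M \<omega> \<noteq> Y M \<omega>} \<le> measure (P i0) {\<omega> \<in> space (P i0). visits J S M i \<omega> = 0}" for M
  proof (rule finite_measure_mono)
    show "{\<omega> \<in> space (P i0). X M \<omega> \<noteq> Y M \<omega>} \<subseteq> {\<omega> \<in> space (P i0). visits J S M i \<omega> = 0}"
      using eq by blast
    show "{\<omega> \<in> space (P i0). visits J S M i \<omega> = 0} \<in> sets (P i0)" unfolding s by measurable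
  qed
  then have "(\<lambda>M. measure (P i0) {\<omega> \<in> space (P i0). X M \<omega> \<noteq> Y M \<omega>}) \<longlonglongrightarrow> 0"
    by (intro tendsto_sandwich[OF _ _ tendsto_const no_visits[of i0 i]] always_eventually allI) simp
  then show ?thesis by (intro tendsto_prob_cong[OF Y X])
qed

text \<open>The random factor M / (number of visits) tends to \<mu> i and may be replaced by it,
  since it multiplies a tight sequence. Passing from the completed to the stopped sum costs at most
  2 C / sqrt M.\<close>

lemma emp_linearization:
  assumes f: "\<And>y. \<bar>f y\<bar> \<le> C"
  shows "tendsto_prob (P i0) (\<lambda>M \<omega>. sqrt (real M) * (emp i f M \<omega> - (\<integral>y. f y \<partial>K i)) -
    \<mu> i * (stopped (dev i f) M \<omega> / sqrt (real M))) 0"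
proof -
  interpret prob_space "P i0" by (rule prob_space_P)
  let ?T = "\<lambda>M \<omega>. transition_sum M (dev i f) \<omega> / sqrt (real M)"
  let ?H = "\<lambda>M \<omega>. stopped (dev i f) M \<omega> / sqrt (real M)"
  let ?a = "\<lambda>M \<omega>. real M / real (visits J S M i \<omega>)"
  have TH: "tendsto_prob (P i0) (\<lambda>M \<omega>. ?T M \<omega> - ?H M \<omega>) 0"
  proof (rule tendsto_prob_if_AE_bound[OF _ _ lim_const_over_sqrt])
    show "AE \<omega> in P i0. \<bar>?T M \<omega> - ?H M \<omega>\<bar> \<le> 2 * C / sqrt (real M)" for M
      using AE_regular[of i0]
    proof eventually_elim
      fix \<omega> assume "regular i0 \<omega>"
      then have "\<bar>stopped (dev i f) M \<omega> - transition_sum M (dev i f) \<omega>\<bar> \<le> 2 * C"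
        unfolding stopped_def by (rule stop_sum_transition_sum_diff) (rule dev_bound[OF f])
      then have "\<bar>transition_sum M (dev i f) \<omega> - stopped (dev i f) M \<omega>\<bar> \<le> 2 * C"
        by (simp add: abs_minus_commute)
      from divide_right_mono[OF this, of "sqrt (real M)"] show "\<bar>?T M \<omega> - ?H M \<omega>\<bar> \<le> 2 * C / sqrt (real M)"
        by (simp add: diff_divide_distrib[symmetric])
    qed
  qed measurable
  have "tendsto_prob (P i0) (\<lambda>M \<omega>. ?a M \<omega> - \<mu> i) (\<mu> i - \<mu> i)"
    by (intro tendsto_prob_diff over_visits tendsto_prob_const)
  then have a: "tendsto_prob (P i0) (\<lambda>M \<omega>. ?a M \<omega> - \<mu> i) 0" by simp
  have "tendsto_prob (P i0) (\<lambda>M \<omega>. (?a M \<omega> - \<mu> i) * ?H M \<omega>) 0"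
    by (rule tendsto_prob_mult_tight[OF a tight_stopped[OF centred_dev[OF f]]]) simp
  from tendsto_prob_add[OF this tendsto_prob_mult[OF over_visits TH]]
  have Y: "tendsto_prob (P i0) (\<lambda>M \<omega>. (?a M \<omega> - \<mu> i) * ?H M \<omega> + ?a M \<omega> * (?T M \<omega> - ?H M \<omega>)) 0" by simp
  show ?thesis
  proof (rule tendsto_prob_cong_visits[OF Y])
    fix M \<omega> assume v: "visits J S M i \<omega> \<noteq> 0"
    have "emp i f M \<omega> - (\<integral>y. f y \<partial>K i) = transition_sum M (dev i f) \<omega> / real (visits J S M i \<omega>)"
      using v unfolding transition_sum_dev emp_def by (simp add: diff_divide_distrib)
    moreover have "sqrt (real M) * (t / n) = real M / n * (t / sqrt (real M))" for t n
    proof -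
      have "real M / n * (t / sqrt (real M)) = (real M / sqrt (real M)) * (t / n)" by simp
      then show ?thesis by (simp only: real_div_sqrt[OF of_nat_0_le_iff])
    qed
    ultimately show "sqrt (real M) * (emp i f M \<omega> - (\<integral>y. f y \<partial>K i)) - \<mu> i * ?H M \<omega> =
        (?a M \<omega> - \<mu> i) * ?H M \<omega> + ?a M \<omega> * (?T M \<omega> - ?H M \<omega>)"
      by (simp only: left_diff_distrib right_diff_distrib)
  qed measurable
qed

text \<open>The linearization divided by sqrt M; the resulting identity fails at most at M =
  0.\<close>

lemma emp_lln:
  assumes f: "\<And>y. \<bar>f y\<bar> \<le> C"
  shows "tendsto_prob (P i0) (emp i f) (\<integral>y. f y \<partial>K i)"
proof -
  interpret prob_space "P i0" by (rule prob_space_P)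
  let ?c = "\<integral>y. f y \<partial>K i" and ?H = "stopped (dev i f)"
  let ?X = "\<lambda>M \<omega>. sqrt (real M) * (emp i f M \<omega> - ?c) - \<mu> i * (?H M \<omega> / sqrt (real M))"
  have Y: "tendsto_prob (P i0) (\<lambda>M \<omega>. (1 / sqrt (real M)) * ?X M \<omega> + \<mu> i * (?H M \<omega> / real M) + ?c) (0 * 0 + \<mu> i * 0 + ?c)"
    by (intro tendsto_prob_add tendsto_prob_mult tendsto_prob_const tendsto_prob_lim lim_inverse_sqrt
        emp_linearization[OF f] stopped_small centred_dev[OF f])
  have eq: "emp i f M \<omega> = (1 / sqrt (real M)) * ?X M \<omega> + \<mu> i * (?H M \<omega> / real M) + ?c" if "M \<noteq> 0" for M \<omega>
  proof -
    have "(1 / s) * (s * (x - c) - m * (h / s)) + m * (h / (s * s)) + c = x" if "s > 0" for s x c m h :: real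
      using that by (simp add: field_simps)
    from this[of "sqrt (real M)"] that show ?thesis by simp
  qed
  have c: "0 * 0 + \<mu> i * 0 + ?c = ?c" by simp
  show ?thesis
  proof (rule tendsto_prob_cong[OF Y[unfolded c]])
    show "(\<lambda>M. measure (P i0) {\<omega> \<in> space (P i0). emp i f M \<omega> \<noteq>
        (1 / sqrt (real M)) * ?X M \<omega> + \<mu> i * (?H M \<omega> / real M) + ?c}) \<longlonglongrightarrow> 0"
    proof (rule tendsto_eventually, rule eventually_sequentiallyI[of 1])
      fix M :: nat assume "1 \<le> M"
      then have "M \<noteq> 0" by simp
      then have "{\<omega> \<in> space (P i0). emp i f M \<omega> \<noteq>
        (1 / sqrt (real M)) * ?X M \<omega> + \<mu> i * (?H M \<omega> / real M) + ?c} = {}"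
        using eq by blast
      then show "measure (P i0) {\<omega> \<in> space (P i0). emp i f M \<omega> \<noteq>
        (1 / sqrt (real M)) * ?X M \<omega> + \<mu> i * (?H M \<omega> / real M) + ?c} = 0"
        by (simp only: measure_empty)
    qed
  qed measurable
qed

lemma q_hat_lln: "tendsto_prob (P i0) (\<lambda>M \<omega>. q_hat J S M i j k \<omega>) (q i j k)"
proof -
  have "tendsto_prob (P i0) (emp i (\<lambda>y. if fst y = j \<and> snd y = k then 1 else 0))
      (\<integral>y. (if fst y = j \<and> snd y = k then 1 else 0) \<partial>K i)"
    by (rule emp_lln[where C = 1]) simp
  then show ?thesis unfolding integral_K_indicator q_hat_eq .
qed

abbreviation qh :: "nat \<Rightarrow> 'b \<Rightarrow> 'a mseq" where
  "qh M \<omega> \<equiv> \<lambda>i j k. q_hat J S M i j k \<omega>"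

lemma conv_pow_lln: "tendsto_prob (P i0) (\<lambda>M \<omega>. conv_pow U (qh M \<omega>) n i j k) (conv_pow U q n i j k)"
proof (induction n arbitrary: i k)
  case 0
  show ?case using prob_space.tendsto_prob_const[OF prob_space_P] by simp
next
  case (Suc n)
  interpret prob_space "P i0" by (rule prob_space_P)
  show ?case unfolding conv_pow.simps conv_mat_def
    by (intro tendsto_prob_sum tendsto_prob_mult q_hat_lln Suc.IH)
qed

lemma q_hat_zero: "regular i0 \<omega> \<Longrightarrow> q_hat J S M i j 0 \<omega> = 0"
proof -
  assume reg: "regular i0 \<omega>"
  have "sojourn S n \<omega> \<noteq> 0" if "n \<in> {1..jumps S M \<omega>}" for n
  proof -
    have "n \<noteq> 0" using that by simp
    then obtain m where n: "n = Suc m" by (cases n) auto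
    have "S m \<omega> < S (Suc m) \<omega>" using reg by (simp add: regular_def)
    then show ?thesis by (simp add: n sojourn_def)
  qed
  then have "(\<Sum>n = 1..jumps S M \<omega>. if J (n - 1) \<omega> = i \<and> J n \<omega> = j \<and> sojourn S n \<omega> = 0 then 1 else (0::real)) = 0"
    by (intro sum.neutral) auto
  then show ?thesis by (simp add: q_hat_def)
qed

text \<open>The series reduces to a finite sum only where the estimated kernel vanishes at time 0,
  which holds on regular paths. The finite sum therefore replaces it up to a null set.\<close>

lemma conv_inv_lln: "tendsto_prob (P i0) (\<lambda>M \<omega>. conv_inv U (qh M \<omega>) i j k) (conv_inv U q i j k)"
proof -
  interpret prob_space "P i0" by (rule prob_space_P)
  have "tendsto_prob (P i0) (\<lambda>M \<omega>. \<Sum>n\<le>k. conv_pow U (qh M \<omega>) n i j k) (\<Sum>n\<le>k. conv_pow U q n i j k)"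
    by (intro tendsto_prob_sum conv_pow_lln)
  moreover have "(\<Sum>n\<le>k. conv_pow U q n i j k) = conv_inv U q i j k"
    by (rule conv_inv_eq_sum[symmetric]) (simp_all add: q_zero)
  ultimately have Y: "tendsto_prob (P i0) (\<lambda>M \<omega>. \<Sum>n\<le>k. conv_pow U (qh M \<omega>) n i j k) (conv_inv U q i j k)" by simp
  show ?thesis
  proof (rule tendsto_prob_cong_AE[OF Y])
    show "(\<lambda>\<omega>. conv_inv U (qh M \<omega>) i j k) \<in> borel_measurable (P i0)" for M
      unfolding conv_inv_def by (rule borel_measurable_suminf) (rule tendsto_prob_measurable[OF conv_pow_lln])
    show "AE \<omega> in P i0. conv_inv U (qh M \<omega>) i j k = (\<Sum>n\<le>k. conv_pow U (qh M \<omega>) n i j k)" for M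
      using AE_regular[of i0]
      by eventually_elim (rule conv_inv_eq_sum, auto intro: q_hat_zero)
  qed
qed

section \<open>Linearization of the estimated reliability\<close>

lemma measurable_reliability_hat: "(\<lambda>\<omega>. reliability_hat U (P i0) J S M \<omega> e) \<in> borel_measurable (P i0)"
proof -
  obtain i k where e: "e = (i, k)" by (cases e)
  show ?thesis
    unfolding e reliability_hat_def conv_vec_apply diag_seq_def prod.case
    by (intro borel_measurable_sum borel_measurable_times tendsto_prob_measurable[OF conv_inv_lln] tail_op_rand_q_hat(1))
qed

lemma emp_one_step:
  "emp u (one_step U r m) M \<omega> = conv_vec U (qh M \<omega>) r (u, m) + emp u (\<lambda>y. if m < snd y then 1 else 0) M \<omega>"
proof -
  have "one_step U r m = (\<lambda>y. (\<Sum>l\<le>m. \<Sum>v\<in>U. (if fst y = v \<and> snd y = l then 1 else 0) * r (v, m - l)) + (if m < snd y then 1 else 0))"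
    by (rule ext) (rule one_step_eq_sum)
  then show ?thesis by (simp only: emp_add emp_sum emp_cmult conv_vec_apply q_hat_eq)
qed

text \<open>Both sides solve the renewal equation of the estimated kernel with source
  \<open>?w\<close>, and that equation has one solution. The identity is exact; the estimated
  inverse is replaced by its limit only afterwards.\<close>

lemma reliability_hat_expansion:
  assumes "i \<in> U"
  shows "AE \<omega> in P i0. reliability_hat U (P i0) J S M \<omega> (i, k) - survival U (i, k) =
    conv_vec U (conv_inv U (qh M \<omega>)) (\<lambda>e. emp (fst e) (one_step U (survival U) (snd e)) M \<omega> - survival U e) (i, k)"
proof -
  interpret prob_space "P i0" by (rule prob_space_P)
  have "AE \<omega> in P i0. \<forall>u m. tail_op_rand (P i0) (q_hat J S M) u u m \<omega> = emp u (\<lambda>y. if m < snd y then 1 else 0) M \<omega>"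
    unfolding AE_all_countable using tail_op_rand_q_hat(2) by blast
  with AE_regular[of i0] show ?thesis
  proof eventually_elim
    fix \<omega> assume reg: "regular i0 \<omega>"
      and tail: "\<forall>u m. tail_op_rand (P i0) (q_hat J S M) u u m \<omega> = emp u (\<lambda>y. if m < snd y then 1 else 0) M \<omega>"
    let ?A = "qh M \<omega>" and ?r = "survival U"
    let ?s = "diag_seq (\<lambda>i j k. tail_op_rand (P i0) (q_hat J S M) i j k \<omega>)"
    let ?x = "conv_vec U (conv_inv U ?A) ?s"
    let ?w = "\<lambda>e. emp (fst e) (one_step U ?r (snd e)) M \<omega> - ?r e"
    have A0: "?A i j 0 = 0" for i j by (rule q_hat_zero[OF reg])
    have x: "?x (u, m) = ?s (u, m) + conv_vec U ?A ?x (u, m)" if "u \<in> U" for u m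
      by (rule conv_inv_solves) (use A0 that in simp_all)
    have w: "?w (u, m) = conv_vec U ?A ?r (u, m) + ?s (u, m) - ?r (u, m)" for u m
      using tail by (simp add: emp_one_step diag_seq_def)
    have "(\<lambda>e. ?x e - ?r e) (i, k) = conv_vec U (conv_inv U ?A) ?w (i, k)"
    proof (rule conv_equation_unique[where A = ?A and r = ?w and U = U and x = "\<lambda>e. ?x e - ?r e"])
      show "?x (u, m) - ?r (u, m) = ?w (u, m) + conv_vec U ?A (\<lambda>e. ?x e - ?r e) (u, m)" if "u \<in> U" for u m
        unfolding conv_vec_diff w using x[OF that, of m] by linarith
      show "conv_vec U (conv_inv U ?A) ?w (u, m) = ?w (u, m) + conv_vec U ?A (conv_vec U (conv_inv U ?A) ?w) (u, m)" if "u \<in> U" for u m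
        by (rule conv_inv_solves) (use A0 that in simp_all)
    qed (use A0 assms in simp_all)
    then show "reliability_hat U (P i0) J S M \<omega> (i, k) - ?r (i, k) = conv_vec U (conv_inv U ?A) ?w (i, k)"
      by (simp add: reliability_hat_def)
  qed
qed

text \<open>The expansion with the estimated inverse replaced by its limit and each average by its
  martingale increment. The factor \<open>\<mu> u\<close> is the limit of M divided by the visits to
  \<open>u\<close>.\<close>

definition score :: "'a set \<Rightarrow> 'a \<times> nat \<Rightarrow> 'a \<Rightarrow> 'a \<Rightarrow> nat \<Rightarrow> real" where
  "score U e = (\<lambda>i' j k. \<Sum>l\<le>snd e. \<Sum>u\<in>U.
     conv_inv U q (fst e) u l * (\<mu> u * dev u (one_step U (survival U) (snd e - l)) i' j k))"

text \<open>Since \<open>dev u\<close> charges departures from \<open>u\<close> only, the sum over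
  \<open>U\<close> reduces to the state being left.\<close>

lemma score_eq: "score U e i' j k = \<mu> i' * (influence U e i' (j, k) - (\<integral>y. influence U e i' y \<partial>K i'))"
proof -
  let ?g = "\<lambda>l. one_step U (survival U) (snd e - l)"
  have "(\<Sum>u\<in>U. conv_inv U q (fst e) u l * (\<mu> u * dev u (?g l) i' j k)) =
      (if i' \<in> U then conv_inv U q (fst e) i' l * (\<mu> i' * (?g l (j, k) - (\<integral>y. ?g l y \<partial>K i'))) else 0)" for l
  proof -
    have "conv_inv U q (fst e) u l * (\<mu> u * dev u (?g l) i' j k) =
        (if u = i' then conv_inv U q (fst e) i' l * (\<mu> i' * (?g l (j, k) - (\<integral>y. ?g l y \<partial>K i'))) else 0)" for u
      by (simp add: dev_def)
    then show ?thesis by (simp add: sum.delta)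
  qed
  then have "score U e i' j k = (if i' \<in> U then \<mu> i' * (\<Sum>l\<le>snd e. conv_inv U q (fst e) i' l * ?g l (j, k) -
      conv_inv U q (fst e) i' l * (\<integral>y. ?g l y \<partial>K i')) else 0)"
    by (simp add: score_def sum_distrib_left algebra_simps)
  moreover have "(\<integral>y. influence U e i' y \<partial>K i') = (\<Sum>l\<le>snd e. conv_inv U q (fst e) i' l * (\<integral>y. ?g l y \<partial>K i'))" if "i' \<in> U"
    using that integrable_one_step by (simp add: influence_def)
  ultimately show ?thesis by (simp add: influence_def sum_subtractf)
qed

lemma reliability_hat_linearization:
  assumes "i \<in> U"
  shows "tendsto_prob (P i0) (\<lambda>M \<omega>. sqrt (real M) * (reliability_hat U (P i0) J S M \<omega> (i, k) - survival U (i, k)) -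
    stopped (score U (i, k)) M \<omega> / sqrt (real M)) 0"
proof -
  interpret prob_space "P i0" by (rule prob_space_P)
  let ?g = "\<lambda>l. one_step U (survival U) (k - l)" and ?\<psi> = "\<lambda>M \<omega>. conv_inv U (qh M \<omega>)"
  let ?H = "\<lambda>l u M \<omega>. \<mu> u * (stopped (dev u (?g l)) M \<omega> / sqrt (real M))"
  let ?W = "\<lambda>l u M \<omega>. sqrt (real M) * (emp u (?g l) M \<omega> - (\<integral>y. ?g l y \<partial>K u))"
  have summand: "tendsto_prob (P i0) (\<lambda>M \<omega>. ?\<psi> M \<omega> i u l * (?W l u M \<omega> - ?H l u M \<omega>) +
      \<mu> u * ((?\<psi> M \<omega> i u l - conv_inv U q i u l) * (stopped (dev u (?g l)) M \<omega> / sqrt (real M)))) 0" for l u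
  proof -
    obtain C where C: "\<And>y. \<bar>?g l y\<bar> \<le> C" using one_step_bounded by blast
    have "tendsto_prob (P i0) (\<lambda>M \<omega>. ?\<psi> M \<omega> i u l - conv_inv U q i u l) (conv_inv U q i u l - conv_inv U q i u l)"
      by (intro tendsto_prob_diff conv_inv_lln tendsto_prob_const)
    then have "tendsto_prob (P i0) (\<lambda>M \<omega>. ?\<psi> M \<omega> i u l - conv_inv U q i u l) 0" by simp
    from tendsto_prob_mult_tight[OF this tight_stopped[OF centred_dev[where f = "?g l", OF C]]]
    have 1: "tendsto_prob (P i0) (\<lambda>M \<omega>. (?\<psi> M \<omega> i u l - conv_inv U q i u l) * (stopped (dev u (?g l)) M \<omega> / sqrt (real M))) 0"
      by simp
    have 2: "tendsto_prob (P i0) (\<lambda>M \<omega>. ?\<psi> M \<omega> i u l * (?W l u M \<omega> - ?H l u M \<omega>)) (conv_inv U q i u l * 0)"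
      by (intro tendsto_prob_mult conv_inv_lln emp_linearization[where f = "?g l", OF C])
    from tendsto_prob_add[OF 2 tendsto_prob_cmult[OF 1, of "\<mu> u"]] show ?thesis by simp
  qed
  have Y: "tendsto_prob (P i0) (\<lambda>M \<omega>. \<Sum>l\<le>k. \<Sum>u\<in>U. ?\<psi> M \<omega> i u l * (?W l u M \<omega> - ?H l u M \<omega>) +
      \<mu> u * ((?\<psi> M \<omega> i u l - conv_inv U q i u l) * (stopped (dev u (?g l)) M \<omega> / sqrt (real M)))) (\<Sum>l\<le>k. \<Sum>u\<in>U. 0)"
    by (intro tendsto_prob_sum summand)
  have st: "stopped (score U (i, k)) M \<omega> / sqrt (real M) = (\<Sum>l\<le>k. \<Sum>u\<in>U. conv_inv U q i u l * ?H l u M \<omega>)" for M \<omega>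
    unfolding stopped_def score_def fst_conv snd_conv
    by (simp only: stop_sum_sum stop_sum_cmult sum_divide_distrib times_divide_eq_right)
  have z: "(\<Sum>l\<le>k. \<Sum>u\<in>U. 0) = (0 :: real)" by simp
  show ?thesis
  proof (rule tendsto_prob_cong_AE[OF Y[unfolded z]])
    show "(\<lambda>\<omega>. sqrt (real M) * (reliability_hat U (P i0) J S M \<omega> (i, k) - survival U (i, k)) -
        stopped (score U (i, k)) M \<omega> / sqrt (real M)) \<in> borel_measurable (P i0)" for M
      using measurable_reliability_hat by measurable
    fix M
    show "AE \<omega> in P i0. sqrt (real M) * (reliability_hat U (P i0) J S M \<omega> (i, k) - survival U (i, k)) -
        stopped (score U (i, k)) M \<omega> / sqrt (real M) = (\<Sum>l\<le>k. \<Sum>u\<in>U. ?\<psi> M \<omega> i u l * (?W l u M \<omega> - ?H l u M \<omega>) +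
      \<mu> u * ((?\<psi> M \<omega> i u l - conv_inv U q i u l) * (stopped (dev u (?g l)) M \<omega> / sqrt (real M))))"
      using reliability_hat_expansion[OF assms, of i0 M k]
    proof eventually_elim
      fix \<omega>
      assume exp: "reliability_hat U (P i0) J S M \<omega> (i, k) - survival U (i, k) =
        conv_vec U (?\<psi> M \<omega>) (\<lambda>e. emp (fst e) (one_step U (survival U) (snd e)) M \<omega> - survival U e) (i, k)"
      have "sqrt (real M) * (reliability_hat U (P i0) J S M \<omega> (i, k) - survival U (i, k)) =
          (\<Sum>l\<le>k. \<Sum>u\<in>U. ?\<psi> M \<omega> i u l * ?W l u M \<omega>)"
        unfolding exp conv_vec_apply sum_distrib_left fst_conv snd_conv
        by (intro sum.cong refl) (simp add: integral_one_step_survival)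
      \<comment> \<open>Here \<open>a\<close> is the estimated inverse and \<open>b\<close> its
        limit: the error splits into the linearization error of the averages and the error of the
        inverse times a tight sequence.\<close>
      moreover have "a * (w - m * h) + m * ((a - b) * h) = a * w - b * (m * h)" for a b w m h :: real
        by (simp add: algebra_simps)
      ultimately show "sqrt (real M) * (reliability_hat U (P i0) J S M \<omega> (i, k) - survival U (i, k)) -
          stopped (score U (i, k)) M \<omega> / sqrt (real M) = (\<Sum>l\<le>k. \<Sum>u\<in>U. ?\<psi> M \<omega> i u l * (?W l u M \<omega> - ?H l u M \<omega>) +
        \<mu> u * ((?\<psi> M \<omega> i u l - conv_inv U q i u l) * (stopped (dev u (?g l)) M \<omega> / sqrt (real M))))"
        unfolding st by (simp only: sum_subtractf)
    qed
  qed
qed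

text \<open>Increments carry the factor \<mu> i and state \<open>i\<close> is left with frequency 1
  / \<mu> i; squared factor times frequency leaves the weight \<mu> i of the variance. States
  outside \<open>U\<close> have influence 0.\<close>

lemma score_comb:
  fixes U D :: "'a set" and F :: "('a \<times> nat) set"
  assumes "finite F"
  defines "\<Phi> \<equiv> \<lambda>c i j k. \<Sum>e\<in>F. c e * score U e i j k"
  assumes UD: "U \<union> D = UNIV" "U \<inter> D = {}"
  shows "centred (\<Phi> c)"
    and "(\<Sum>i\<in>UNIV. (1 / \<mu> i) * (\<integral>y. (\<Phi> c i (fst y) (snd y))\<^sup>2 \<partial>K i)) =
      (\<Sum>e\<in>F. \<Sum>e'\<in>F. c e * c e' * reliability_variance U D \<mu> q e e')"
proof -
  let ?g = "influence U" and ?E = "\<lambda>e i. \<integral>y. influence U e i y \<partial>K i"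
  obtain C where C: "\<And>e i y. \<bar>?g e i y\<bar> \<le> C e" using influence_bounded by metis
  have ig: "integrable (K i) (?g e i)" for e i
    by (rule integrable_pmf_bounded[where B = "C e"]) (simp add: C)
  have igg: "integrable (K i) (\<lambda>y. ?g e i y * ?g e' i y)" for e e' i
    by (rule integrable_pmf_bounded[where B = "C e * C e'"]) (unfold real_norm_def abs_mult, intro mult_mono C, auto intro: order_trans[OF abs_ge_zero C])
  have E: "\<bar>?E e i\<bar> \<le> C e" for e i
  proof -
    have "\<bar>?E e i\<bar> \<le> (\<integral>y. \<bar>?g e i y\<bar> \<partial>K i)" by (rule integral_abs_bound)
    also have "\<dots> \<le> C e" by (rule expectation_pmf_le) (simp_all add: ig C)
    finally show ?thesis .
  qed
  have \<Phi>: "\<Phi> c i j k = \<mu> i * (\<Sum>e\<in>F. c e * (?g e i (j, k) - ?E e i))" for i j k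
    by (simp add: \<Phi>_def score_eq sum_distrib_left algebra_simps)
  show "centred (\<Phi> c)"
    unfolding centred_def
  proof (intro conjI allI exI)
    fix i j k
    have "\<bar>\<Phi> c i j k\<bar> \<le> \<mu> i * (\<Sum>e\<in>F. \<bar>c e\<bar> * (2 * C e))"
    proof -
      have "\<bar>?g e i (j, k) - ?E e i\<bar> \<le> 2 * C e" for e using C[of e i "(j, k)"] E[of i e] by linarith
      then show ?thesis unfolding \<Phi> abs_mult using \<mu>_pos[of i]
        by (auto intro!: mult_left_mono order_trans[OF sum_abs] sum_mono simp: abs_mult)
    qed
    also have "\<dots> \<le> (\<Sum>i\<in>UNIV. \<mu> i) * (\<Sum>e\<in>F. \<bar>c e\<bar> * (2 * C e))"
    proof (rule mult_right_mono)
      show "\<mu> i \<le> (\<Sum>i\<in>UNIV. \<mu> i)" by (rule member_le_sum) (auto intro: less_imp_le \<mu>_pos)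
      have "0 \<le> C e" for e using C[of e undefined undefined] by linarith
      then show "0 \<le> (\<Sum>e\<in>F. \<bar>c e\<bar> * (2 * C e))" by (intro sum_nonneg mult_nonneg_nonneg) auto
    qed
    finally show "\<bar>\<Phi> c i j k\<bar> \<le> (\<Sum>i\<in>UNIV. \<mu> i) * (\<Sum>e\<in>F. \<bar>c e\<bar> * (2 * C e))" .
  next
    fix i
    show "(\<integral>y. \<Phi> c i (fst y) (snd y) \<partial>K i) = 0"
      unfolding \<Phi> using ig by simp
  qed
  have sq: "(\<integral>y. (\<Phi> c i (fst y) (snd y))\<^sup>2 \<partial>K i) = (\<mu> i)\<^sup>2 * (\<Sum>e\<in>F. \<Sum>e'\<in>F. c e * c e' *
      ((\<integral>y. ?g e i y * ?g e' i y \<partial>K i) - ?E e i * ?E e' i))" for i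
  proof -
    have cov: "(\<integral>y. (?g e i y - ?E e i) * (?g e' i y - ?E e' i) \<partial>K i) = (\<integral>y. ?g e i y * ?g e' i y \<partial>K i) - ?E e i * ?E e' i"
      and icov: "integrable (K i) (\<lambda>y. (?g e i y - ?E e i) * (?g e' i y - ?E e' i))" for e e'
    proof -
      have eq: "(?g e i y - ?E e i) * (?g e' i y - ?E e' i) =
          ?g e i y * ?g e' i y - ?E e' i * ?g e i y - ?E e i * ?g e' i y + ?E e i * ?E e' i" for y
        by (simp add: algebra_simps)
      show "(\<integral>y. (?g e i y - ?E e i) * (?g e' i y - ?E e' i) \<partial>K i) = (\<integral>y. ?g e i y * ?g e' i y \<partial>K i) - ?E e i * ?E e' i"
        unfolding eq using ig igg by simp
      show "integrable (K i) (\<lambda>y. (?g e i y - ?E e i) * (?g e' i y - ?E e' i))"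
        unfolding eq using ig igg by simp
    qed
    have "(\<Phi> c i (fst y) (snd y))\<^sup>2 = (\<mu> i)\<^sup>2 * (\<Sum>e\<in>F. \<Sum>e'\<in>F. c e * c e' * ((?g e i y - ?E e i) * (?g e' i y - ?E e' i)))" for y
      unfolding \<Phi> power_mult_distrib
      by (simp add: power2_eq_square[of "sum _ _"] sum_product mult_ac)
    then show ?thesis using icov by (simp add: cov)
  qed
  have "(\<Sum>i\<in>UNIV. (1 / \<mu> i) * (\<integral>y. (\<Phi> c i (fst y) (snd y))\<^sup>2 \<partial>K i)) =
      (\<Sum>i\<in>UNIV. \<mu> i * (\<Sum>e\<in>F. \<Sum>e'\<in>F. c e * c e' * ((\<integral>y. ?g e i y * ?g e' i y \<partial>K i) - ?E e i * ?E e' i)))"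
  proof (rule sum.cong[OF refl])
    fix i
    have "(1 / m) * (m\<^sup>2 * x) = m * x" if "m > 0" for m x :: real
      using that by (simp add: power2_eq_square)
    from this[OF \<mu>_pos] show "(1 / \<mu> i) * (\<integral>y. (\<Phi> c i (fst y) (snd y))\<^sup>2 \<partial>K i) =
        \<mu> i * (\<Sum>e\<in>F. \<Sum>e'\<in>F. c e * c e' * ((\<integral>y. ?g e i y * ?g e' i y \<partial>K i) - ?E e i * ?E e' i))"
      unfolding sq .
  qed
  also have "\<dots> = (\<Sum>i\<in>U. \<mu> i * (\<Sum>e\<in>F. \<Sum>e'\<in>F. c e * c e' * ((\<integral>y. ?g e i y * ?g e' i y \<partial>K i) - ?E e i * ?E e' i)))"
    by (rule sum.mono_neutral_right) (auto simp: influence_def)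
  also have "\<dots> = (\<Sum>e\<in>F. \<Sum>e'\<in>F. c e * c e' * (\<Sum>i\<in>U. \<mu> i * ((\<integral>y. ?g e i y * ?g e' i y \<partial>K i) - ?E e i * ?E e' i)))"
  proof -
    let ?t = "\<lambda>i e e'. c e * c e' * (\<mu> i * ((\<integral>y. ?g e i y * ?g e' i y \<partial>K i) - ?E e i * ?E e' i))"
    have "(\<Sum>i\<in>U. \<mu> i * (\<Sum>e\<in>F. \<Sum>e'\<in>F. c e * c e' * ((\<integral>y. ?g e i y * ?g e' i y \<partial>K i) - ?E e i * ?E e' i))) =
        (\<Sum>i\<in>U. \<Sum>e\<in>F. \<Sum>e'\<in>F. ?t i e e')"
      unfolding sum_distrib_left by (intro sum.cong refl) (rule mult.left_commute)
    also have "\<dots> = (\<Sum>e\<in>F. \<Sum>i\<in>U. \<Sum>e'\<in>F. ?t i e e')" by (rule sum.swap)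
    also have "\<dots> = (\<Sum>e\<in>F. \<Sum>e'\<in>F. \<Sum>i\<in>U. ?t i e e')" by (rule sum.cong[OF refl]) (rule sum.swap)
    finally show ?thesis unfolding sum_distrib_left .
  qed
  finally show "(\<Sum>i\<in>UNIV. (1 / \<mu> i) * (\<integral>y. (\<Phi> c i (fst y) (snd y))\<^sup>2 \<partial>K i)) =
      (\<Sum>e\<in>F. \<Sum>e'\<in>F. c e * c e' * reliability_variance U D \<mu> q e e')"
    unfolding variance_summands(3)[OF UD] .
qed

text \<open>The Cramer--Wold reduction: a finite combination of coordinates differs from one
  normalised martingale by a term vanishing in probability. Positivity of the covariance comes from
  writing its quadratic form as a weighted sum of second moments.\<close>

theorem reliability_clt:
  assumes UD: "U \<union> D = UNIV" "U \<inter> D = {}"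
  shows "\<exists>\<nu>. centered_gaussian_law (U \<times> UNIV) (reliability_variance U D \<mu> q) \<nu> \<and>
    converges_in_distribution (P i0) (U \<times> UNIV)
      (\<lambda>M \<omega>. \<lambda>e \<in> U \<times> UNIV. sqrt (real M) * (reliability_hat U (P i0) J S M \<omega> e - reliability D P J S e)) \<nu>"
proof -
  interpret prob_space "P i0" by (rule prob_space_P)
  let ?I = "U \<times> (UNIV :: nat set)" and ?V = "reliability_variance U D \<mu> q"
  let ?X = "\<lambda>M \<omega>. \<lambda>e \<in> ?I. sqrt (real M) * (reliability_hat U (P i0) J S M \<omega> e - reliability D P J S e)"
  have sym: "?V e e' = ?V e' e" for e e'
    unfolding variance_summands(3)[OF UD] by (simp add: mult.commute)
  have pos: "0 \<le> (\<Sum>e\<in>F. \<Sum>e'\<in>F. c e * c e' * ?V e e')" if "finite F" for F c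
    unfolding score_comb(2)[OF that UD, of c, symmetric]
    by (intro sum_nonneg mult_nonneg_nonneg integral_nonneg_AE) (auto simp: less_imp_le[OF \<mu>_pos])
  obtain \<nu> where \<nu>: "centered_gaussian_law ?I ?V \<nu>"
    and char_\<nu>: "\<And>F c. finite F \<Longrightarrow> F \<subseteq> ?I \<Longrightarrow> (\<integral>y. iexp (lin_comb F c y) \<partial>\<nu>) =
      complex_of_real (exp (- (\<Sum>e\<in>F. \<Sum>e'\<in>F. c e * c e' * ?V e e') / 2))"
    by (rule centered_gaussian_law_exists[of ?I ?V]) (use sym pos in auto)
  have "converges_in_distribution (P i0) ?I ?X \<nu>"
  proof (rule converges_in_distribution_if_char_conv)
    show "prob_space (P i0)" by unfold_locales
    show "prob_space \<nu>" "sets \<nu> = sets (\<Pi>\<^sub>M i\<in>?I. (borel :: real measure))"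
      using \<nu> by (auto simp: centered_gaussian_law_def)
    show mX: "?X M \<in> measurable (P i0) (\<Pi>\<^sub>M i\<in>?I. borel)" for M
      by (intro measurable_restrict borel_measurable_times borel_measurable_diff borel_measurable_const
          measurable_reliability_hat)
    fix F c assume F: "finite F" "F \<subseteq> ?I"
    let ?\<Phi> = "\<lambda>i j k. \<Sum>e\<in>F. c e * score U e i j k"
    show "(\<lambda>M. \<integral>\<omega>. iexp (lin_comb F c (?X M \<omega>)) \<partial>P i0) \<longlonglongrightarrow> (\<integral>y. iexp (lin_comb F c y) \<partial>\<nu>)"
      unfolding char_\<nu>[OF F] score_comb(2)[OF F(1) UD, of c, symmetric]
    proof (rule char_tendsto_prob_cong[OF _ _ _ stopped_clt[OF score_comb(1)[OF F(1) UD, of c]]])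
      show "(\<lambda>\<omega>. lin_comb F c (?X M \<omega>)) \<in> borel_measurable (P i0)" for M
        by (rule measurable_compose[OF mX borel_measurable_lin_comb[OF F(2)]])
      show "(\<lambda>\<omega>. stopped ?\<Phi> M \<omega> / sqrt (real M)) \<in> borel_measurable (P i0)" for M by measurable
      have lim: "tendsto_prob (P i0) (\<lambda>M \<omega>. \<Sum>e\<in>F. c e * (sqrt (real M) *
          (reliability_hat U (P i0) J S M \<omega> e - survival U e) - stopped (score U e) M \<omega> / sqrt (real M))) (\<Sum>e\<in>F. c e * 0)"
      proof (intro tendsto_prob_sum tendsto_prob_cmult)
        fix e assume "e \<in> F"
        then obtain i k where e: "e = (i, k)" "i \<in> U" using F(2) by (cases e) auto
        show "tendsto_prob (P i0) (\<lambda>M \<omega>. sqrt (real M) *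
          (reliability_hat U (P i0) J S M \<omega> e - survival U e) - stopped (score U e) M \<omega> / sqrt (real M)) 0"
          unfolding e(1) by (rule reliability_hat_linearization[OF e(2)])
      qed
      have eq: "lin_comb F c (?X M \<omega>) - stopped ?\<Phi> M \<omega> / sqrt (real M) = (\<Sum>e\<in>F. c e * (sqrt (real M) *
          (reliability_hat U (P i0) J S M \<omega> e - survival U e) - stopped (score U e) M \<omega> / sqrt (real M)))" for M \<omega>
      proof -
        have "lin_comb F c (?X M \<omega>) = (\<Sum>e\<in>F. c e * (sqrt (real M) * (reliability_hat U (P i0) J S M \<omega> e - survival U e)))"
          unfolding lin_comb_def
        proof (rule sum.cong[OF refl])
          fix e assume "e \<in> F"
          then obtain i k where e: "e = (i, k)" "i \<in> U" using F(2) by (cases e) auto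
          then show "c e * ?X M \<omega> e = c e * (sqrt (real M) * (reliability_hat U (P i0) J S M \<omega> e - survival U e))"
            using reliability_eq_survival[OF UD e(2), of k] by simp
        qed
        moreover have "stopped ?\<Phi> M \<omega> / sqrt (real M) = (\<Sum>e\<in>F. c e * (stopped (score U e) M \<omega> / sqrt (real M)))"
          unfolding stopped_def by (simp only: stop_sum_sum stop_sum_cmult sum_divide_distrib times_divide_eq_right)
        ultimately show ?thesis by (simp only: right_diff_distrib sum_subtractf)
      qed
      show "tendsto_prob (P i0) (\<lambda>M \<omega>. lin_comb F c (?X M \<omega>) - stopped ?\<Phi> M \<omega> / sqrt (real M)) 0"
        using lim unfolding eq by simp
    qed
  qed
  with \<nu> show ?thesis by blast
qed

end

text \<open>Since \<open>infsum\<close> is 0 on families that are not summable, the first conjunct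
  certifies that the two infinite sums in the variance are genuine.\<close>

theorem theorem5p3:
  fixes q :: "('e::finite) mseq"
    and P :: "'e \<Rightarrow> 'w measure"
    and J :: "nat \<Rightarrow> 'w \<Rightarrow> 'e"
    and S :: "nat \<Rightarrow> 'w \<Rightarrow> nat"
    and U D :: "'e set"
    and i0 :: 'e
    and \<mu> :: "'e \<Rightarrow> real"
  defines "\<mu> \<equiv> (\<lambda>i. enn2real (mean_recurrence P J S i))"
  assumes "markov_renewal_chain q P J S"
    and A1: "irreducible_chain P J"
    and A2: "aperiodic_chain P J S"
    and A3: "positive_recurrent_chain P J S"
    and "U \<union> D = UNIV" and "U \<inter> D = {}" and "U \<noteq> {}" and "D \<noteq> {}"
    and "i0 \<in> U"
  shows "(\<forall>e \<in> U \<times> UNIV. \<forall>e' \<in> U \<times> UNIV.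
            var_summand_UU U \<mu> q e e' summable_on (U \<times> U \<times> UNIV) \<and>
            var_summand_UD U \<mu> q e e' summable_on (U \<times> D \<times> UNIV)) \<and>
         (\<exists>\<nu>. centered_gaussian_law (U \<times> UNIV) (reliability_variance U D \<mu> q) \<nu> \<and>
              converges_in_distribution (P i0) (U \<times> UNIV)
                (\<lambda>M \<omega>. \<lambda>e \<in> U \<times> UNIV.
                   sqrt (real M) * (reliability_hat U (P i0) J S M \<omega> e - reliability D P J S e))
                \<nu>)"
proof -
  interpret chain: markov_renewal_chain q P J S by fact
  interpret chain: positive_recurrent_markov_renewal_chain q P J S
    by unfold_locales (rule A1, rule A3)
  have \<mu>: "\<mu> = chain.\<mu>" by (simp add: \<mu>_def chain.\<mu>_def fun_eq_iff)
  note UD = \<open>U \<union> D = UNIV\<close> \<open>U \<inter> D = {}\<close>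
  show ?thesis
    using chain.variance_summands(1,2)[OF UD] chain.reliability_clt[OF UD, of i0] unfolding \<mu> by blast
qed

end
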